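(* Let $(H,\Delta,\epsilon)$ be a weak bialgebra over the field $k$. Put $R:=H_t$, the target counital subalgebra of $H$. Then the structure $(H,\Gamma,C)$ of a $\times_R$-bialgebra on the algebra $H$ is given as follows. The $R^e$-ring structure of $H$ is given by $\iota\colon R^e\to H$, $\iota(x\otimes\overline y)=x\,\epsilon'_s(y)$ for $x,y\in R$. The comultiplication $\Gamma\colon H\to H\times_R H\subset H\diamond H$ is the composition of $\Delta\colon H\to H\otimes H$ with the canonical surjection $H\otimes H\to H\diamond H$ (in particular this composition takes values in $H\times_RH$). The counit is $C\colon H\to\operatorname{End}(R)$, $C(h)(x)=\epsilon_t(hx)$ for $h\in H$, $x\in R$.
   Context: $k$ is a field; algebras (unital, associative), coalgebras, $\otimes$ are over $k$; Sweedler notation $\Delta(h)=h_{(1)}\otimes h_{(2)}$, and $1_{(1)}\otimes 1_{(2)}=\Delta(1)$. Weak bialgebra: an algebra and coalgebra $H$ with $\Delta(gh)=\Delta(g)\Delta(h)$ and, for all $f,g,h\in H$: $\epsilon(fgh)=\epsilon(fg_{(1)})\epsilon(g_{(2)}h)=\epsilon(fg_{(2)})\epsilon(g_{(1)}h)$, and $1_{(1)}\otimes1_{(2)}\otimes1_{(3)}=(\Delta(1)\otimes1)(1\otimes\Delta(1))=(1\otimes\Delta(1))(\Delta(1)\otimes1)$. (Neither $\Delta(1)=1\otimes1$ nor multiplicativity of $\epsilon$ is required.) Counital maps: $\epsilon_s(h)=1_{(1)}\epsilon(h1_{(2)})$, $\epsilon_t(h)=\epsilon(1_{(1)}h)1_{(2)}$,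 $\epsilon_s'(h)=1_{(1)}\epsilon(1_{(2)}h)$. $H_s=\epsilon_s(H)$ and $H_t=\epsilon_t(H)$ are the source and target counital subalgebras; they are subalgebras of $H$ which commute elementwise. $\times_R$-bialgebras: Let $R$ be a $k$-algebra, $\overline R$ its opposite algebra, $r\mapsto\overline r$ the canonical anti-isomorphism $R\to\overline R$, $R^e=R\otimes\overline R$, $r\overline s:=r\otimes\overline s$. An $R^e$-ring is a $k$-algebra $L$ with an algebra map $R^e\to L$; one writes $r,\overline s$ also for images in $L$. For left $R^e$-modules $M,N$, $M\diamond N:=M\otimes N/\langle\overline rm\otimes n-m\otimes rn\mid r\in R,m\in M,n\in N\rangle$. For $R^e$-bimodules $M,N$, $M\times_RN\subset M\diamond N$ is the subspace of all $\sum m_i\otimes n_i$ with $\sum m_i\overline s\otimes n_i=\sum m_i\otimes n_is$ for all $s\in R$. If $M,N$ are $R^e$-rings, so is $M\times_RN$ with multiplication $(\sum m_i\otimes n_i)(\sum m_j'\otimes n_j')=\sum m_im_j'\otimes n_in_j'$ and $R^e$-ring structure $r\otimes\overline s\mapsto r\otimes\overline s$ (i.e. the image of $r$ in the first factor, that of $\overline s$ in the second). $\operatorname{End}(R)$ ($k$-linear endomorphisms) is an $R^e$-ring via $r\otimes\overline s\mapsto(t\mapsto rts)$. A $\times_R$-bialgebra is an $R^e$-ring $L$ with homomorphisms of $R^e$-rings (algebra maps over $R^e$) $\Gamma\colon L\to L\times_RL$, $\Gamma(\ell)=\ell_{[1]}\otimes\ell_{[2]}$, and $C\colon L\to\operatorname{End}(R)$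 such that the induced map $\Gamma_0\colon L\to L\diamond L$ is coassociative, $(\Gamma_0\diamond L)\Gamma_0=(L\diamond\Gamma_0)\Gamma_0\colon L\to L\diamond L\diamond L$, and $\overline{C(\ell_{[2]})(1)}\,\ell_{[1]}=\ell=C(\ell_{[1]})(1)\,\ell_{[2]}$ for all $\ell\in L$. *)

theory Defs
  imports "HOL-Algebra.Module" "HOL-Algebra.AbelCoset"
begin

section \<open>Algebras and linear maps\<close>

text \<open>The library locale \<^locale>\<open>algebra\<close> is restricted to commutative algebras; here the
  multiplication need not commute, and the zero algebra is allowed.\<close>

locale k_algebra = module K A + base: field K + alg: ring A for K (structure) and A (structure) +
  assumes smult_mult_left:
      "\<lbrakk>a \<in> carrier K; x \<in> carrier A; y \<in> carrier A\<rbrakk> \<Longrightarrow>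
        (a \<odot>\<^bsub>A\<^esub> x) \<otimes>\<^bsub>A\<^esub> y = a \<odot>\<^bsub>A\<^esub> (x \<otimes>\<^bsub>A\<^esub> y)"
    and smult_mult_right:
      "\<lbrakk>a \<in> carrier K; x \<in> carrier A; y \<in> carrier A\<rbrakk> \<Longrightarrow>
        x \<otimes>\<^bsub>A\<^esub> (a \<odot>\<^bsub>A\<^esub> y) = a \<odot>\<^bsub>A\<^esub> (x \<otimes>\<^bsub>A\<^esub> y)"

definition linear_maps ::
    "('k, 'y) ring_scheme \<Rightarrow> ('k, 'a, 'u) module_scheme \<Rightarrow> ('k, 'b, 'v) module_scheme \<Rightarrow> ('a \<Rightarrow> 'b) set"
  where "linear_maps K M N = {f \<in> carrier M \<rightarrow> carrier N.
    (\<forall>x\<in>carrier M. \<forall>y\<in>carrier M. f (x \<oplus>\<^bsub>M\<^esub> y) = f x \<oplus>\<^bsub>N\<^esub> f y) \<and>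
    (\<forall>a\<in>carrier K. \<forall>x\<in>carrier M. f (a \<odot>\<^bsub>M\<^esub> x) = a \<odot>\<^bsub>N\<^esub> f x)}"

definition alg_hom ::
    "('k, 'y) ring_scheme \<Rightarrow> ('k, 'a, 'u) module_scheme \<Rightarrow> ('k, 'b, 'v) module_scheme \<Rightarrow> ('a \<Rightarrow> 'b) set"
  where "alg_hom K A B = ring_hom A B \<inter> linear_maps K A B"

definition base_module :: "('k, 'y) ring_scheme \<Rightarrow> ('k, 'k) module"
  where "base_module K = \<lparr>carrier = carrier K, mult = mult K, one = one K,
    zero = zero K, add = add K, smult = mult K\<rparr>"

definition opposite :: "('k, 'a, 'u) module_scheme \<Rightarrow> ('k, 'a, 'u) module_scheme"
  where "opposite A = A\<lparr>mult := \<lambda>x y. y \<otimes>\<^bsub>A\<^esub> x\<rparr>"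

text \<open>\<open>End(R)\<close>. Endomorphisms are made extensional on the carrier, so that
  equality in the record is equality of maps on \<open>R\<close>.\<close>

definition end_algebra ::
    "('k, 'y) ring_scheme \<Rightarrow> ('k, 'r, 'u) module_scheme \<Rightarrow> ('k, 'r \<Rightarrow> 'r) module"
  where "end_algebra K R = \<lparr>carrier = linear_maps K R R \<inter> extensional (carrier R),
    mult = compose (carrier R), one = (\<lambda>x\<in>carrier R. x),
    zero = (\<lambda>x\<in>carrier R. \<zero>\<^bsub>R\<^esub>), add = (\<lambda>f g. \<lambda>x\<in>carrier R. f x \<oplus>\<^bsub>R\<^esub> g x),
    smult = (\<lambda>a f. \<lambda>x\<in>carrier R. a \<odot>\<^bsub>R\<^esub> f x)\<rparr>"


section \<open>Quotient spaces and tensor products\<close>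

definition lin_span :: "('k, 'y) ring_scheme \<Rightarrow> ('k, 'a, 'u) module_scheme \<Rightarrow> 'a set \<Rightarrow> 'a set"
  where "lin_span K V S = \<Inter>{W. submodule W K V \<and> S \<subseteq> W}"

text \<open>The quotient \<open>V / W\<close> of vector spaces; its elements are the cosets of \<open>W\<close>.\<close>

definition quotient_space :: "('k, 'a, 'u) module_scheme \<Rightarrow> 'a set \<Rightarrow> ('k, 'a set) module"
  where "quotient_space V W = \<lparr>carrier = a_rcosets\<^bsub>V\<^esub> W, mult = undefined, one = undefined,
    zero = W, add = set_add V, smult = (\<lambda>a X. \<Union>x\<in>X. W +>\<^bsub>V\<^esub> (a \<odot>\<^bsub>V\<^esub> x))\<rparr>"

text \<open>The vector space with basis \<open>B\<close>: finitely supported functions vanishing off \<open>B\<close>.\<close>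

definition free_space :: "('k, 'y) ring_scheme \<Rightarrow> 'b set \<Rightarrow> ('k, 'b \<Rightarrow> 'k) module"
  where "free_space K B = \<lparr>
    carrier = {f. (\<forall>p. f p \<in> carrier K) \<and> (\<forall>p. p \<notin> B \<longrightarrow> f p = \<zero>\<^bsub>K\<^esub>) \<and> finite {p. f p \<noteq> \<zero>\<^bsub>K\<^esub>}},
    mult = undefined, one = undefined, zero = (\<lambda>p. \<zero>\<^bsub>K\<^esub>),
    add = (\<lambda>f g p. f p \<oplus>\<^bsub>K\<^esub> g p), smult = (\<lambda>a f p. a \<otimes>\<^bsub>K\<^esub> f p)\<rparr>"

definition free_gen :: "('k, 'y) ring_scheme \<Rightarrow> 'b \<Rightarrow> 'b \<Rightarrow> 'k"
  where "free_gen K b = (\<lambda>p. if p = b then \<one>\<^bsub>K\<^esub> else \<zero>\<^bsub>K\<^esub>)"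

abbreviation tensor_free ::
    "('k, 'y) ring_scheme \<Rightarrow> ('k, 'm, 'u) module_scheme \<Rightarrow> ('k, 'n, 'v) module_scheme \<Rightarrow>
      ('k, 'm \<times> 'n \<Rightarrow> 'k) module"
  where "tensor_free K M N \<equiv> free_space K (carrier M \<times> carrier N)"

definition tensor_null ::
    "('k, 'y) ring_scheme \<Rightarrow> ('k, 'm, 'u) module_scheme \<Rightarrow> ('k, 'n, 'v) module_scheme \<Rightarrow>
      ('m \<times> 'n \<Rightarrow> 'k) set"
  where "tensor_null K M N = (let F = tensor_free K M N; e = (\<lambda>m n. free_gen K (m, n)) in
    lin_span K F
     ({e (m \<oplus>\<^bsub>M\<^esub> m') n \<ominus>\<^bsub>F\<^esub> (e m n \<oplus>\<^bsub>F\<^esub> e m' n) | m m' n.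
         m \<in> carrier M \<and> m' \<in> carrier M \<and> n \<in> carrier N} \<union>
      {e m (n \<oplus>\<^bsub>N\<^esub> n') \<ominus>\<^bsub>F\<^esub> (e m n \<oplus>\<^bsub>F\<^esub> e m n') | m n n'.
         m \<in> carrier M \<and> n \<in> carrier N \<and> n' \<in> carrier N} \<union>
      {e (a \<odot>\<^bsub>M\<^esub> m) n \<ominus>\<^bsub>F\<^esub> (a \<odot>\<^bsub>F\<^esub> e m n) | a m n.
         a \<in> carrier K \<and> m \<in> carrier M \<and> n \<in> carrier N} \<union>
      {e m (a \<odot>\<^bsub>N\<^esub> n) \<ominus>\<^bsub>F\<^esub> (a \<odot>\<^bsub>F\<^esub> e m n) | a m n.
         a \<in> carrier K \<and> m \<in> carrier M \<and> n \<in> carrier N}))"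

definition tens ::
    "('k, 'y) ring_scheme \<Rightarrow> ('k, 'm, 'u) module_scheme \<Rightarrow> ('k, 'n, 'v) module_scheme \<Rightarrow>
      'm \<Rightarrow> 'n \<Rightarrow> ('m \<times> 'n \<Rightarrow> 'k) set"
  where "tens K M N m n = tensor_null K M N +>\<^bsub>tensor_free K M N\<^esub> free_gen K (m, n)"

text \<open>\<open>tensor_lift K T \<phi>\<close> is the linear map from a tensor product to \<open>T\<close> with
  \<open>m \<otimes> n \<mapsto> \<phi> m n\<close>; in Sweedler notation, \<open>tensor_lift K T \<phi> (\<Delta> h) = \<phi> h\<^sub>(\<^sub>1\<^sub>) h\<^sub>(\<^sub>2\<^sub>)\<close>.
  It is meaningful for bilinear \<open>\<phi>\<close> only: then
  all representatives of a tensor give the same value, so that the image is a singleton.\<close>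

definition free_lift ::
    "('k, 'y) ring_scheme \<Rightarrow> ('k, 't, 'w) module_scheme \<Rightarrow> ('m \<Rightarrow> 'n \<Rightarrow> 't) \<Rightarrow> ('m \<times> 'n \<Rightarrow> 'k) \<Rightarrow> 't"
  where "free_lift K T \<phi> f =
    finsum T (\<lambda>p. f p \<odot>\<^bsub>T\<^esub> \<phi> (fst p) (snd p)) {p. f p \<noteq> \<zero>\<^bsub>K\<^esub>}"

definition tensor_lift ::
    "('k, 'y) ring_scheme \<Rightarrow> ('k, 't, 'w) module_scheme \<Rightarrow> ('m \<Rightarrow> 'n \<Rightarrow> 't) \<Rightarrow> ('m \<times> 'n \<Rightarrow> 'k) set \<Rightarrow> 't"
  where "tensor_lift K T \<phi> X = the_elem (free_lift K T \<phi> ` X)"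

text \<open>\<open>M \<otimes> N\<close>, with the product \<open>(m \<otimes> n)(m' \<otimes> n') = mm' \<otimes> nn'\<close>; the fields \<^const>\<open>mult\<close> and
  \<^const>\<open>one\<close> are meaningful only if \<open>M\<close> and \<open>N\<close> are algebras.\<close>

definition tensor ::
    "('k, 'y) ring_scheme \<Rightarrow> ('k, 'm, 'u) module_scheme \<Rightarrow> ('k, 'n, 'v) module_scheme \<Rightarrow>
      ('k, ('m \<times> 'n \<Rightarrow> 'k) set) module"
  where "tensor K M N = (let T = quotient_space (tensor_free K M N) (tensor_null K M N) in
    T\<lparr>mult := \<lambda>X Y. tensor_lift K T (\<lambda>m n. tensor_lift K T
          (\<lambda>m' n'. tens K M N (m \<otimes>\<^bsub>M\<^esub> m') (n \<otimes>\<^bsub>N\<^esub> n')) Y) X,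
      one := tens K M N \<one>\<^bsub>M\<^esub> \<one>\<^bsub>N\<^esub>\<rparr>)"

text \<open>The map \<open>f \<otimes> g\<close> into \<open>M' \<otimes> N'\<close>.\<close>

definition tensor_map ::
    "('k, 'y) ring_scheme \<Rightarrow> ('k, 'm1, 'u) module_scheme \<Rightarrow> ('k, 'n1, 'v) module_scheme \<Rightarrow>
      ('m \<Rightarrow> 'm1) \<Rightarrow> ('n \<Rightarrow> 'n1) \<Rightarrow> ('m \<times> 'n \<Rightarrow> 'k) set \<Rightarrow> ('m1 \<times> 'n1 \<Rightarrow> 'k) set"
  where "tensor_map K M' N' f g =
    tensor_lift K (tensor K M' N') (\<lambda>m n. tens K M' N' (f m) (g n))"

text \<open>The canonical isomorphism \<open>(M \<otimes> N) \<otimes> P \<rightarrow> M \<otimes> (N \<otimes> P)\<close>.\<close>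

definition tensor_assoc ::
    "('k, 'y) ring_scheme \<Rightarrow> ('k, 'm, 'u) module_scheme \<Rightarrow> ('k, 'n, 'v) module_scheme \<Rightarrow>
      ('k, 'p, 'w) module_scheme \<Rightarrow> (('m \<times> 'n \<Rightarrow> 'k) set \<times> 'p \<Rightarrow> 'k) set \<Rightarrow>
      ('m \<times> ('n \<times> 'p \<Rightarrow> 'k) set \<Rightarrow> 'k) set"
  where "tensor_assoc K M N P = (let T = tensor K M (tensor K N P) in
    tensor_lift K T (\<lambda>x p. tensor_lift K T
      (\<lambda>m n. tens K M (tensor K N P) m (tens K N P n p)) x))"


section \<open>Weak bialgebras\<close>

locale coalgebra = module K H + base: field K for K (structure) and H (structure) +
  fixes \<Delta> \<epsilon>
  assumes comult_linear: "\<Delta> \<in> linear_maps K H (tensor K H H)"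
    and counit_linear: "\<epsilon> \<in> linear_maps K H (base_module K)"
    and coassoc: "h \<in> carrier H \<Longrightarrow>
      tensor_assoc K H H H (tensor_map K (tensor K H H) H \<Delta> id (\<Delta> h))
        = tensor_map K H (tensor K H H) id \<Delta> (\<Delta> h)"
    and counit_left: "h \<in> carrier H \<Longrightarrow> tensor_lift K H (\<lambda>a b. \<epsilon> a \<odot>\<^bsub>H\<^esub> b) (\<Delta> h) = h"
    and counit_right: "h \<in> carrier H \<Longrightarrow> tensor_lift K H (\<lambda>a b. \<epsilon> b \<odot>\<^bsub>H\<^esub> a) (\<Delta> h) = h"

text \<open>In the two axioms on \<open>\<Delta>(1)\<close>, the space \<open>H \<otimes> H \<otimes> H\<close> is bracketed as \<open>H \<otimes> (H \<otimes> H)\<close>.\<close>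

locale weak_bialgebra = k_algebra K H + coalgebra K H \<Delta> \<epsilon>
  for K (structure) and H (structure) and \<Delta> \<epsilon> +
  assumes comult_mult: "\<lbrakk>g \<in> carrier H; h \<in> carrier H\<rbrakk> \<Longrightarrow>
      \<Delta> (g \<otimes>\<^bsub>H\<^esub> h) = \<Delta> g \<otimes>\<^bsub>tensor K H H\<^esub> \<Delta> h"
    and counit_mult12: "\<lbrakk>f \<in> carrier H; g \<in> carrier H; h \<in> carrier H\<rbrakk> \<Longrightarrow>
      \<epsilon> (f \<otimes>\<^bsub>H\<^esub> g \<otimes>\<^bsub>H\<^esub> h) =
        tensor_lift K (base_module K) (\<lambda>a b. \<epsilon> (f \<otimes>\<^bsub>H\<^esub> a) \<otimes>\<^bsub>K\<^esub> \<epsilon> (b \<otimes>\<^bsub>H\<^esub> h)) (\<Delta> g)"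
    and counit_mult21: "\<lbrakk>f \<in> carrier H; g \<in> carrier H; h \<in> carrier H\<rbrakk> \<Longrightarrow>
      \<epsilon> (f \<otimes>\<^bsub>H\<^esub> g \<otimes>\<^bsub>H\<^esub> h) =
        tensor_lift K (base_module K) (\<lambda>a b. \<epsilon> (f \<otimes>\<^bsub>H\<^esub> b) \<otimes>\<^bsub>K\<^esub> \<epsilon> (a \<otimes>\<^bsub>H\<^esub> h)) (\<Delta> g)"
    and comult_one1:
      "tensor_map K H (tensor K H H) id \<Delta> (\<Delta> \<one>\<^bsub>H\<^esub>) =
        tensor_assoc K H H H (tens K (tensor K H H) H (\<Delta> \<one>\<^bsub>H\<^esub>) \<one>\<^bsub>H\<^esub>)
          \<otimes>\<^bsub>tensor K H (tensor K H H)\<^esub> tens K H (tensor K H H) \<one>\<^bsub>H\<^esub> (\<Delta> \<one>\<^bsub>H\<^esub>)"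
    and comult_one2:
      "tensor_map K H (tensor K H H) id \<Delta> (\<Delta> \<one>\<^bsub>H\<^esub>) =
        tens K H (tensor K H H) \<one>\<^bsub>H\<^esub> (\<Delta> \<one>\<^bsub>H\<^esub>)
          \<otimes>\<^bsub>tensor K H (tensor K H H)\<^esub>
        tensor_assoc K H H H (tens K (tensor K H H) H (\<Delta> \<one>\<^bsub>H\<^esub>) \<one>\<^bsub>H\<^esub>)"

context
  fixes K :: "('k, 'y) ring_scheme" and H :: "('k, 'h) module"
    and \<Delta> :: "'h \<Rightarrow> ('h \<times> 'h \<Rightarrow> 'k) set" and \<epsilon> :: "'h \<Rightarrow> 'k"
begin

definition counit_target :: "'h \<Rightarrow> 'h"
  where "counit_target h = tensor_lift K H (\<lambda>a b. \<epsilon> (a \<otimes>\<^bsub>H\<^esub> h) \<odot>\<^bsub>H\<^esub> b) (\<Delta> \<one>\<^bsub>H\<^esub>)"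

definition counit_source' :: "'h \<Rightarrow> 'h"
  where "counit_source' h = tensor_lift K H (\<lambda>a b. \<epsilon> (b \<otimes>\<^bsub>H\<^esub> h) \<odot>\<^bsub>H\<^esub> a) (\<Delta> \<one>\<^bsub>H\<^esub>)"

definition target_subalgebra :: "('k, 'h) module"
  where "target_subalgebra = H\<lparr>carrier := counit_target ` carrier H\<rparr>"

end


section \<open>Rings over the enveloping algebra\<close>

text \<open>The opposite algebra has the same carrier as \<open>R\<close>, and the canonical anti-isomorphism is the
  identity. Thus \<open>r \<otimes> s\<close> in \<open>enveloping K R\<close> stands for \<open>r\<close> tensored with the bar of \<open>s\<close>.\<close>

definition enveloping ::
    "('k, 'y) ring_scheme \<Rightarrow> ('k, 'r) module \<Rightarrow> ('k, ('r \<times> 'r \<Rightarrow> 'k) set) module"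
  where "enveloping K R = tensor K R (opposite R)"

locale enveloping_ring =
  base_alg: k_algebra K R + ring_alg: k_algebra K L
  for K (structure) and R :: "('k, 'r) module" and L :: "('k, 'l) module" and \<iota> +
  assumes unit_hom: "\<iota> \<in> alg_hom K (enveloping K R) L"

text \<open>The images of \<open>r\<close> and of the bar of \<open>r\<close> in an algebra with structure map \<open>\<iota>\<close>.\<close>

definition src :: "('k, 'y) ring_scheme \<Rightarrow> ('k, 'r) module \<Rightarrow> (('r \<times> 'r \<Rightarrow> 'k) set \<Rightarrow> 'l) \<Rightarrow> 'r \<Rightarrow> 'l"
  where "src K R \<iota> r = \<iota> (tens K R (opposite R) r \<one>\<^bsub>R\<^esub>)"

definition bar :: "('k, 'y) ring_scheme \<Rightarrow> ('k, 'r) module \<Rightarrow> (('r \<times> 'r \<Rightarrow> 'k) set \<Rightarrow> 'l) \<Rightarrow> 'r \<Rightarrow> 'l"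
  where "bar K R \<iota> r = \<iota> (tens K R (opposite R) \<one>\<^bsub>R\<^esub> r)"

text \<open>A left module over the enveloping algebra is recorded as a vector space together with
  the actions \<open>act r\<close> of \<open>r\<close> and \<open>bact r\<close> of the bar of \<open>r\<close>.\<close>

record ('k, 'm, 'r) env_module = "('k, 'm) module" +
  act :: "'r \<Rightarrow> 'm \<Rightarrow> 'm"
  bact :: "'r \<Rightarrow> 'm \<Rightarrow> 'm"

definition left_regular ::
    "('k, 'y) ring_scheme \<Rightarrow> ('k, 'r) module \<Rightarrow> ('k, 'l) module \<Rightarrow> (('r \<times> 'r \<Rightarrow> 'k) set \<Rightarrow> 'l) \<Rightarrow>
      ('k, 'l, 'r) env_module"
  where "left_regular K R L \<iota> = module.extend L
    (env_module.fields (\<lambda>r l. src K R \<iota> r \<otimes>\<^bsub>L\<^esub> l) (\<lambda>r l. bar K R \<iota> r \<otimes>\<^bsub>L\<^esub> l))"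


section \<open>The product over the base algebra\<close>

definition diamond_null ::
    "('k, 'y) ring_scheme \<Rightarrow> ('k, 'r) module \<Rightarrow> ('k, 'm, 'r) env_module \<Rightarrow> ('k, 'n, 'r) env_module \<Rightarrow>
      ('m \<times> 'n \<Rightarrow> 'k) set set"
  where "diamond_null K R M N = lin_span K (tensor K M N)
    {tens K M N (bact M r m) n \<ominus>\<^bsub>tensor K M N\<^esub> tens K M N m (act N r n) | r m n.
       r \<in> carrier R \<and> m \<in> carrier M \<and> n \<in> carrier N}"

text \<open>The canonical surjection from \<open>M \<otimes> N\<close> onto \<open>M \<diamondop> N\<close>.\<close>

definition diamond_proj ::
    "('k, 'y) ring_scheme \<Rightarrow> ('k, 'r) module \<Rightarrow> ('k, 'm, 'r) env_module \<Rightarrow> ('k, 'n, 'r) env_module \<Rightarrow>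
      ('m \<times> 'n \<Rightarrow> 'k) set \<Rightarrow> ('m \<times> 'n \<Rightarrow> 'k) set set"
  where "diamond_proj K R M N t = diamond_null K R M N +>\<^bsub>tensor K M N\<^esub> t"

definition dtens ::
    "('k, 'y) ring_scheme \<Rightarrow> ('k, 'r) module \<Rightarrow> ('k, 'm, 'r) env_module \<Rightarrow> ('k, 'n, 'r) env_module \<Rightarrow>
      'm \<Rightarrow> 'n \<Rightarrow> ('m \<times> 'n \<Rightarrow> 'k) set set"
  where "dtens K R M N m n = diamond_proj K R M N (tens K M N m n)"

text \<open>The linear map from \<open>M \<diamondop> N\<close> to \<open>T\<close> induced by a bilinear \<open>\<phi>\<close>
  with \<open>\<phi> (bact M r m) n = \<phi> m (act N r n)\<close>.\<close>

definition diamond_lift ::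
    "('k, 'y) ring_scheme \<Rightarrow> ('k, 't, 'w) module_scheme \<Rightarrow> ('m \<Rightarrow> 'n \<Rightarrow> 't) \<Rightarrow>
      ('m \<times> 'n \<Rightarrow> 'k) set set \<Rightarrow> 't"
  where "diamond_lift K T \<phi> X = the_elem (tensor_lift K T \<phi> ` X)"

text \<open>\<open>M \<diamondop> N\<close> is again a left module: \<open>r\<close> acts on the first factor, and the bar of \<open>r\<close> on the
  second. The iterated products refer to these actions.\<close>

definition diamond ::
    "('k, 'y) ring_scheme \<Rightarrow> ('k, 'r) module \<Rightarrow> ('k, 'm, 'r) env_module \<Rightarrow> ('k, 'n, 'r) env_module \<Rightarrow>
      ('k, ('m \<times> 'n \<Rightarrow> 'k) set set, 'r) env_module"
  where "diamond K R M N = (let D = quotient_space (tensor K M N) (diamond_null K R M N) in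
    module.extend D (env_module.fields
      (\<lambda>r. diamond_lift K D (\<lambda>m n. dtens K R M N (act M r m) n))
      (\<lambda>r. diamond_lift K D (\<lambda>m n. dtens K R M N m (bact N r n)))))"

definition diamond_map ::
    "('k, 'y) ring_scheme \<Rightarrow> ('k, 'r) module \<Rightarrow> ('k, 'm1, 'r) env_module \<Rightarrow> ('k, 'n1, 'r) env_module \<Rightarrow>
      ('m \<Rightarrow> 'm1) \<Rightarrow> ('n \<Rightarrow> 'n1) \<Rightarrow> ('m \<times> 'n \<Rightarrow> 'k) set set \<Rightarrow> ('m1 \<times> 'n1 \<Rightarrow> 'k) set set"
  where "diamond_map K R M' N' f g =
    diamond_lift K (diamond K R M' N') (\<lambda>m n. dtens K R M' N' (f m) (g n))"

text \<open>The canonical isomorphism \<open>(M \<diamondop> N) \<diamondop> P \<rightarrow> M \<diamondop> (N \<diamondop> P)\<close>.\<close>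

definition diamond_assoc ::
    "('k, 'y) ring_scheme \<Rightarrow> ('k, 'r) module \<Rightarrow> ('k, 'm, 'r) env_module \<Rightarrow> ('k, 'n, 'r) env_module \<Rightarrow>
      ('k, 'p, 'r) env_module \<Rightarrow> (('m \<times> 'n \<Rightarrow> 'k) set set \<times> 'p \<Rightarrow> 'k) set set \<Rightarrow>
      ('m \<times> ('n \<times> 'p \<Rightarrow> 'k) set set \<Rightarrow> 'k) set set"
  where "diamond_assoc K R M N P = (let D = diamond K R M (diamond K R N P) in
    diamond_lift K D (\<lambda>x p. diamond_lift K D
      (\<lambda>m n. dtens K R M (diamond K R N P) m (dtens K R N P n p)) x))"

text \<open>\<open>L \<times>\<^sub>R L\<close> as an algebra. An element of \<open>L \<diamondop> L\<close> is a coset in \<open>L \<otimes> L\<close>; the product of two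
  elements of \<open>L \<times>\<^sub>R L\<close> is computed on representatives in \<open>L \<otimes> L\<close> and does not depend on their
  choice.\<close>

definition takeuchi_carrier ::
    "('k, 'y) ring_scheme \<Rightarrow> ('k, 'r) module \<Rightarrow> ('k, 'l) module \<Rightarrow> (('r \<times> 'r \<Rightarrow> 'k) set \<Rightarrow> 'l) \<Rightarrow>
      ('l \<times> 'l \<Rightarrow> 'k) set set set"
  where "takeuchi_carrier K R L \<iota> = (let M = left_regular K R L \<iota>; D = diamond K R M M in
    {X \<in> carrier D. \<forall>s\<in>carrier R.
       diamond_lift K D (\<lambda>m n. dtens K R M M (m \<otimes>\<^bsub>L\<^esub> bar K R \<iota> s) n) X =
       diamond_lift K D (\<lambda>m n. dtens K R M M m (n \<otimes>\<^bsub>L\<^esub> src K R \<iota> s)) X})"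

definition takeuchi ::
    "('k, 'y) ring_scheme \<Rightarrow> ('k, 'r) module \<Rightarrow> ('k, 'l) module \<Rightarrow> (('r \<times> 'r \<Rightarrow> 'k) set \<Rightarrow> 'l) \<Rightarrow>
      ('k, ('l \<times> 'l \<Rightarrow> 'k) set set) module"
  where "takeuchi K R L \<iota> = (let M = left_regular K R L \<iota>; D = diamond K R M M in
    \<lparr>carrier = takeuchi_carrier K R L \<iota>,
     mult = (\<lambda>X Y. the_elem {diamond_proj K R M M (t \<otimes>\<^bsub>tensor K L L\<^esub> u) | t u. t \<in> X \<and> u \<in> Y}),
     one = dtens K R M M \<one>\<^bsub>L\<^esub> \<one>\<^bsub>L\<^esub>,
     zero = zero D, add = add D, smult = smult D\<rparr>)"

text \<open>The structure maps of \<open>L \<times>\<^sub>R L\<close> and \<open>End(R)\<close> as rings over the enveloping algebra.\<close>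

definition takeuchi_unit ::
    "('k, 'y) ring_scheme \<Rightarrow> ('k, 'r) module \<Rightarrow> ('k, 'l) module \<Rightarrow> (('r \<times> 'r \<Rightarrow> 'k) set \<Rightarrow> 'l) \<Rightarrow>
      ('r \<times> 'r \<Rightarrow> 'k) set \<Rightarrow> ('l \<times> 'l \<Rightarrow> 'k) set set"
  where "takeuchi_unit K R L \<iota> = (let M = left_regular K R L \<iota> in
    tensor_lift K (takeuchi K R L \<iota>) (\<lambda>r s. dtens K R M M (src K R \<iota> r) (bar K R \<iota> s)))"

definition end_unit ::
    "('k, 'y) ring_scheme \<Rightarrow> ('k, 'r) module \<Rightarrow> ('r \<times> 'r \<Rightarrow> 'k) set \<Rightarrow> 'r \<Rightarrow> 'r"
  where "end_unit K R =
    tensor_lift K (end_algebra K R) (\<lambda>r s. \<lambda>t\<in>carrier R. r \<otimes>\<^bsub>R\<^esub> t \<otimes>\<^bsub>R\<^esub> s)"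


section \<open>Bialgebras over a noncommutative base\<close>

locale times_bialgebra = enveloping_ring K R L \<iota>
  for K (structure) and R :: "('k, 'r) module" and L :: "('k, 'l) module" and \<iota> +
  fixes \<Gamma> :: "'l \<Rightarrow> ('l \<times> 'l \<Rightarrow> 'k) set set" and C :: "'l \<Rightarrow> 'r \<Rightarrow> 'r"
  assumes comult_hom: "\<Gamma> \<in> alg_hom K L (takeuchi K R L \<iota>)"
    and comult_unit: "z \<in> carrier (enveloping K R) \<Longrightarrow> \<Gamma> (\<iota> z) = takeuchi_unit K R L \<iota> z"
    and counit_hom: "C \<in> alg_hom K L (end_algebra K R)"
    and counit_unit: "z \<in> carrier (enveloping K R) \<Longrightarrow> C (\<iota> z) = end_unit K R z"
    and comult_coassoc: "M = left_regular K R L \<iota> \<Longrightarrow> l \<in> carrier L \<Longrightarrow>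
      diamond_assoc K R M M M (diamond_map K R (diamond K R M M) M \<Gamma> id (\<Gamma> l))
        = diamond_map K R M (diamond K R M M) id \<Gamma> (\<Gamma> l)"
    and counit_bar: "l \<in> carrier L \<Longrightarrow>
      diamond_lift K L (\<lambda>m n. bar K R \<iota> (C n \<one>\<^bsub>R\<^esub>) \<otimes>\<^bsub>L\<^esub> m) (\<Gamma> l) = l"
    and counit_src: "l \<in> carrier L \<Longrightarrow>
      diamond_lift K L (\<lambda>m n. src K R \<iota> (C m \<one>\<^bsub>R\<^esub>) \<otimes>\<^bsub>L\<^esub> n) (\<Gamma> l) = l"

end

theory Submission
  imports Defs
begin

text \<open>Slicing the axioms on \<open>\<Delta>(1)\<close> with functionals \<open>\<epsilon>(- h)\<close> gives
  \<open>\<Delta>(x) = \<Delta>(1)(x \<otimes> 1) = (x \<otimes> 1)\<Delta>(1)\<close> for \<open>x \<in> H\<^sub>t\<close>, the mirror statement for the image of \<open>\<epsilon>'\<^sub>s\<close>, and the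
  transfer rule \<open>\<Delta>(h)(1 \<otimes> x) = \<Delta>(h)(\<epsilon>'\<^sub>s(x) \<otimes> 1)\<close>. The transfer rule makes \<open>\<epsilon>'\<^sub>s\<close> anti-multiplicative on
  \<open>H\<^sub>t\<close>, puts the image of \<open>\<Delta>\<close> into the Takeuchi product, and says that \<open>\<Delta>(h)\<close> annihilates the kernel
  of \<open>H \<otimes> H \<rightarrow> H \<diamondop> H\<close> by left multiplication; as that kernel is a right ideal, \<open>\<Gamma>\<close> is multiplicative.
  Unitality of \<open>\<Gamma>\<close> holds since \<open>\<Delta>(1) \<in> H \<otimes> H\<^sub>t\<close>: modulo the kernel, \<open>\<Delta>(1)(m \<otimes> n)\<close> becomes
  \<open>\<epsilon>'\<^sub>s(1\<^sub>(\<^sub>2\<^sub>)) 1\<^sub>(\<^sub>1\<^sub>) m \<otimes> n = m \<otimes> n\<close>. The counit laws reduce to those of \<open>H\<close> through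
  \<open>\<epsilon>(f \<epsilon>\<^sub>t(h)) = \<epsilon>(f h) = \<epsilon>(f \<epsilon>'\<^sub>s(h))\<close>.\<close>

section \<open>Linear maps and quotient spaces\<close>

text \<open>Sweedler calculations cannot be transcribed term by term, because
  \<open>\<Delta> h\<close> is a coset and comes with no chosen sum of pure tensors. Each identity
  is therefore generalised: the coproduct under study becomes a variable tensor, both sides become
  linear maps in it, \<open>linear_tensor_eqI\<close> compares these on pure tensors, and only then
  is the coproduct put back. Hence the many explicit compositions of linear maps. A second obstacle
  is that the relations of \<open>H \<diamondop> H\<close> are imposed by left multiplication, so
  left multiplication by an arbitrary tensor need not respect them. For the idempotent
  \<open>\<Delta>1\<close> it does, in the best possible way: extended by linearity,
  \<open>dproj_\<Delta>1_mult\<close> and \<open>\<Delta>_mult_dproj\<close> say that two tensors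
  have the same class exactly when their products with \<open>\<Delta>1\<close> on the left agree.
  Thus \<open>H \<diamondop> H\<close> is a copy of the direct summand
  \<open>\<Delta>1 \<bullet> (H \<otimes> H)\<close> of \<open>H \<otimes> H\<close>.\<close>

lemma linear_mapsI:
  assumes "\<And>x. x \<in> carrier M \<Longrightarrow> f x \<in> carrier N"
    and "\<And>x y. x \<in> carrier M \<Longrightarrow> y \<in> carrier M \<Longrightarrow> f (x \<oplus>\<^bsub>M\<^esub> y) = f x \<oplus>\<^bsub>N\<^esub> f y"
    and "\<And>a x. a \<in> carrier K \<Longrightarrow> x \<in> carrier M \<Longrightarrow> f (a \<odot>\<^bsub>M\<^esub> x) = a \<odot>\<^bsub>N\<^esub> f x"
  shows "f \<in> linear_maps K M N"
  using assms by (auto simp: linear_maps_def)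

lemma
  assumes "f \<in> linear_maps K M N"
  shows linear_closed: "x \<in> carrier M \<Longrightarrow> f x \<in> carrier N"
    and linear_add: "x \<in> carrier M \<Longrightarrow> y \<in> carrier M \<Longrightarrow> f (x \<oplus>\<^bsub>M\<^esub> y) = f x \<oplus>\<^bsub>N\<^esub> f y"
    and linear_smult: "a \<in> carrier K \<Longrightarrow> x \<in> carrier M \<Longrightarrow> f (a \<odot>\<^bsub>M\<^esub> x) = a \<odot>\<^bsub>N\<^esub> f x"
  using assms by (auto simp: linear_maps_def)

lemma linear_zero:
  assumes "f \<in> linear_maps K M N" "module K M" "module K N"
  shows "f \<zero>\<^bsub>M\<^esub> = \<zero>\<^bsub>N\<^esub>"
proof -
  interpret M: module K M by fact
  interpret N: module K N by fact
  have "f (\<zero>\<^bsub>K\<^esub> \<odot>\<^bsub>M\<^esub> \<zero>\<^bsub>M\<^esub>) = \<zero>\<^bsub>K\<^esub> \<odot>\<^bsub>N\<^esub> f \<zero>\<^bsub>M\<^esub>"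
    by (rule linear_smult[OF assms(1)]) auto
  then show ?thesis
    using linear_closed[OF assms(1), of "\<zero>\<^bsub>M\<^esub>"] by simp
qed

lemma linear_minus:
  assumes "f \<in> linear_maps K M N" "module K M" "module K N" "x \<in> carrier M" "y \<in> carrier M"
  shows "f (x \<ominus>\<^bsub>M\<^esub> y) = f x \<ominus>\<^bsub>N\<^esub> f y"
proof -
  interpret M: module K M by fact
  interpret N: module K N by fact
  have m: "\<ominus>\<^bsub>M\<^esub> y = (\<ominus>\<^bsub>K\<^esub> \<one>\<^bsub>K\<^esub>) \<odot>\<^bsub>M\<^esub> y"
    using assms(5) by (simp add: M.smult_l_minus)
  show ?thesis
    unfolding a_minus_def m using assms linear_closed[OF assms(1)]
    by (simp add: linear_add linear_smult N.smult_l_minus)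
qed

lemma linear_maps_comp:
  assumes "f \<in> linear_maps K M N" "g \<in> linear_maps K N P"
  shows "(\<lambda>x. g (f x)) \<in> linear_maps K M P"
  using assms by (auto simp: linear_maps_def Pi_iff)

lemma linear_id: "id \<in> linear_maps K M M"
  by (auto simp: linear_maps_def)

text \<open>Axioms hold in \<open>Q\<close> because they hold for chosen preimages in
  \<open>V\<close>. \<open>Q\<close> enters as a bare record, which is how quotients, tensor
  products and regular modules are presented.\<close>

lemma module_surj_image:
  assumes "module K V" and surj: "p ` carrier V = carrier Q"
    and add: "\<And>x y. x \<in> carrier V \<Longrightarrow> y \<in> carrier V \<Longrightarrow> p (x \<oplus>\<^bsub>V\<^esub> y) = p x \<oplus>\<^bsub>Q\<^esub> p y"
    and zero: "p \<zero>\<^bsub>V\<^esub> = \<zero>\<^bsub>Q\<^esub>"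
    and smult: "\<And>a x. a \<in> carrier K \<Longrightarrow> x \<in> carrier V \<Longrightarrow> p (a \<odot>\<^bsub>V\<^esub> x) = a \<odot>\<^bsub>Q\<^esub> p x"
  shows "module K Q"
proof -
  interpret V: module K V by fact
  have c: "p x \<in> carrier Q" if "x \<in> carrier V" for x
    using surj that by blast
  have ex: "\<exists>x\<in>carrier V. q = p x" if "q \<in> carrier Q" for q
    using surj that by blast
  show ?thesis
  proof (intro moduleI abelian_groupI)
    show "cring K" by unfold_locales
    show "\<zero>\<^bsub>Q\<^esub> \<in> carrier Q" using c[of "\<zero>\<^bsub>V\<^esub>"] zero by simp
  next
    fix x y assume "x \<in> carrier Q" "y \<in> carrier Q"
    then obtain u v where "x = p u" "y = p v" "u \<in> carrier V" "v \<in> carrier V" using ex by metis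
    then show "x \<oplus>\<^bsub>Q\<^esub> y \<in> carrier Q" "x \<oplus>\<^bsub>Q\<^esub> y = y \<oplus>\<^bsub>Q\<^esub> x"
      by (simp_all add: add[symmetric] c V.M.a_comm)
  next
    fix x y z assume "x \<in> carrier Q" "y \<in> carrier Q" "z \<in> carrier Q"
    then obtain u v w where "x = p u" "y = p v" "z = p w"
      "u \<in> carrier V" "v \<in> carrier V" "w \<in> carrier V" using ex by metis
    then show "x \<oplus>\<^bsub>Q\<^esub> y \<oplus>\<^bsub>Q\<^esub> z = x \<oplus>\<^bsub>Q\<^esub> (y \<oplus>\<^bsub>Q\<^esub> z)"
      by (simp add: add[symmetric] V.M.a_assoc)
  next
    fix x assume "x \<in> carrier Q"
    then obtain u where u: "x = p u" "u \<in> carrier V" using ex by metis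
    then show "\<zero>\<^bsub>Q\<^esub> \<oplus>\<^bsub>Q\<^esub> x = x" "\<one>\<^bsub>K\<^esub> \<odot>\<^bsub>Q\<^esub> x = x"
      by (simp_all add: add[symmetric] zero[symmetric] smult[symmetric])
    have "p (\<ominus>\<^bsub>V\<^esub> u) \<oplus>\<^bsub>Q\<^esub> x = \<zero>\<^bsub>Q\<^esub>"
      using u by (simp add: add[symmetric] zero V.M.l_neg)
    then show "\<exists>y\<in>carrier Q. y \<oplus>\<^bsub>Q\<^esub> x = \<zero>\<^bsub>Q\<^esub>"
      using c u(2) by blast
  next
    fix a x assume a: "a \<in> carrier K" "x \<in> carrier Q"
    then obtain u where u: "x = p u" "u \<in> carrier V" using ex by metis
    with a show "a \<odot>\<^bsub>Q\<^esub> x \<in> carrier Q"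
      by (simp add: smult[symmetric] c)
  next
    fix a b x assume a: "a \<in> carrier K" "b \<in> carrier K" "x \<in> carrier Q"
    then obtain u where u: "x = p u" "u \<in> carrier V" using ex by metis
    with a show "(a \<oplus>\<^bsub>K\<^esub> b) \<odot>\<^bsub>Q\<^esub> x = (a \<odot>\<^bsub>Q\<^esub> x) \<oplus>\<^bsub>Q\<^esub> (b \<odot>\<^bsub>Q\<^esub> x)"
      "(a \<otimes>\<^bsub>K\<^esub> b) \<odot>\<^bsub>Q\<^esub> x = a \<odot>\<^bsub>Q\<^esub> (b \<odot>\<^bsub>Q\<^esub> x)"
      by (simp_all add: smult[symmetric] add[symmetric] V.smult_l_distr V.smult_assoc1)
  next
    fix a x y assume a: "a \<in> carrier K" "x \<in> carrier Q" "y \<in> carrier Q"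
    then obtain u v where "x = p u" "y = p v" "u \<in> carrier V" "v \<in> carrier V" using ex by metis
    with a show "a \<odot>\<^bsub>Q\<^esub> (x \<oplus>\<^bsub>Q\<^esub> y) = (a \<odot>\<^bsub>Q\<^esub> x) \<oplus>\<^bsub>Q\<^esub> (a \<odot>\<^bsub>Q\<^esub> y)"
      by (simp add: smult[symmetric] add[symmetric] V.smult_r_distr)
  qed
qed

text \<open>The identity map serves as the surjection. This moves module structure between records
  that differ only in other fields, such as the product of a tensor product or the actions of an
  \<open>env_module\<close>.\<close>

lemma module_cong:
  assumes "module K M" "carrier N = carrier M" "add N = add M" "zero N = zero M" "smult N = smult M"
  shows "module K N"
  by (rule module_surj_image[OF assms(1), of "\<lambda>x. x"]) (simp_all add: assms)

lemma submodule_abelian_subgroup: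
  assumes "module K V" "submodule W K V"
  shows "abelian_subgroup W V"
proof -
  interpret V: module K V by fact
  interpret W: submodule W K V by fact
  show ?thesis
    by (rule abelian_subgroupI3) (unfold_locales, simp)
qed

lemma quotient_sel [simp]:
  "zero (quotient_space V W) = W" "add (quotient_space V W) = set_add V"
  "smult (quotient_space V W) = (\<lambda>a X. \<Union>x\<in>X. W +>\<^bsub>V\<^esub> (a \<odot>\<^bsub>V\<^esub> x))"
  "carrier (quotient_space V W) = a_rcosets\<^bsub>V\<^esub> W"
  by (auto simp: quotient_space_def)

lemma coset_eq_iff:
  assumes "module K V" "submodule W K V" "x \<in> carrier V" "y \<in> carrier V"
  shows "W +>\<^bsub>V\<^esub> x = W +>\<^bsub>V\<^esub> y \<longleftrightarrow> x \<ominus>\<^bsub>V\<^esub> y \<in> W"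
proof -
  interpret V: module K V by fact
  interpret W: abelian_subgroup W V using submodule_abelian_subgroup assms by blast
  have "W +>\<^bsub>V\<^esub> x = W +>\<^bsub>V\<^esub> y \<longleftrightarrow> x \<in> W +>\<^bsub>V\<^esub> y"
    using W.a_repr_independence'[OF _ assms(4)] W.a_rcos_self[OF assms(3)] by metis
  also have "\<dots> \<longleftrightarrow> x \<ominus>\<^bsub>V\<^esub> y \<in> W"
    unfolding a_minus_def by (rule W.a_rcos_module[OF assms(4,3)])
  finally show ?thesis .
qed

text \<open>The union in the scalar multiplication of \<open>quotient_space\<close> is a union of
  equal sets: multiples of two representatives differ by an element of \<open>W\<close>.\<close>

lemma coset_smult:
  assumes "module K V" "submodule W K V" "x \<in> carrier V" "a \<in> carrier K"
  shows "(\<Union>z\<in>W +>\<^bsub>V\<^esub> x. W +>\<^bsub>V\<^esub> (a \<odot>\<^bsub>V\<^esub> z)) = W +>\<^bsub>V\<^esub> (a \<odot>\<^bsub>V\<^esub> x)"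
proof -
  interpret V: module K V by fact
  interpret W: abelian_subgroup W V using submodule_abelian_subgroup assms by blast
  interpret S: submodule W K V by fact
  have e: "W +>\<^bsub>V\<^esub> (a \<odot>\<^bsub>V\<^esub> z) = W +>\<^bsub>V\<^esub> (a \<odot>\<^bsub>V\<^esub> x)" if z: "z \<in> W +>\<^bsub>V\<^esub> x" for z
  proof -
    obtain w where w: "w \<in> W" "z = w \<oplus>\<^bsub>V\<^esub> x"
      using z by (auto simp: a_r_coset_def')
    then have "z \<in> carrier V" using W.a_subset assms by auto
    have "a \<odot>\<^bsub>V\<^esub> z = a \<odot>\<^bsub>V\<^esub> w \<oplus>\<^bsub>V\<^esub> a \<odot>\<^bsub>V\<^esub> x"
      using w W.a_subset assms by (auto simp: V.smult_r_distr)
    moreover have "a \<odot>\<^bsub>V\<^esub> w \<in> W" using w assms by auto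
    ultimately have "a \<odot>\<^bsub>V\<^esub> z \<in> W +>\<^bsub>V\<^esub> (a \<odot>\<^bsub>V\<^esub> x)"
      by (auto simp: a_r_coset_def')
    then show ?thesis
      using W.a_repr_independence' assms by (metis V.smult_closed)
  qed
  have "x \<in> W +>\<^bsub>V\<^esub> x" using W.a_rcos_self assms by blast
  then show ?thesis using e by blast
qed

lemma coset_map_linear:
  assumes "module K V" "submodule W K V"
  shows "(+>\<^bsub>V\<^esub>) W \<in> linear_maps K V (quotient_space V W)"
proof -
  interpret V: module K V by fact
  interpret W: abelian_subgroup W V using submodule_abelian_subgroup assms by blast
  show ?thesis
    by (rule linear_mapsI)
      (auto simp: W.a_rcos_sum coset_smult[OF assms] A_RCOSETS_def')
qed

lemma coset_map_surj: "(+>\<^bsub>V\<^esub>) W ` carrier V = carrier (quotient_space V W)"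
  by (auto simp: A_RCOSETS_def')

lemma coset_zero:
  assumes "module K V" "submodule W K V"
  shows "W +>\<^bsub>V\<^esub> \<zero>\<^bsub>V\<^esub> = W"
proof -
  interpret V: module K V by fact
  interpret W: abelian_subgroup W V using submodule_abelian_subgroup assms by blast
  show ?thesis using W.a_subset by simp
qed

lemma quotient_module:
  assumes "module K V" "submodule W K V"
  shows "module K (quotient_space V W)"
  by (rule module_surj_image[OF assms(1) coset_map_surj[of V W]])
    (use linear_add[OF coset_map_linear[OF assms]] linear_smult[OF coset_map_linear[OF assms]]
      coset_zero[OF assms] in simp_all)

text \<open>A linear map that kills \<open>W\<close> is constant on each coset, so the image of the
  coset is a singleton. Both kinds of lift are instances, with \<open>tensor_null\<close> and
  \<open>diamond_null\<close> for \<open>W\<close>.\<close>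

lemma the_elem_coset:
  assumes "module K V" "submodule W K V" "module K T" "f \<in> linear_maps K V T"
    and W0: "\<And>w. w \<in> W \<Longrightarrow> f w = \<zero>\<^bsub>T\<^esub>" and x: "x \<in> carrier V"
  shows "the_elem (f ` (W +>\<^bsub>V\<^esub> x)) = f x"
proof -
  interpret V: module K V by fact
  interpret T: module K T by fact
  interpret W: abelian_subgroup W V using submodule_abelian_subgroup assms by blast
  have "f z = f x" if z: "z \<in> W +>\<^bsub>V\<^esub> x" for z
  proof -
    obtain w where w: "w \<in> W" "z = w \<oplus>\<^bsub>V\<^esub> x"
      using z by (auto simp: a_r_coset_def')
    then show ?thesis
      using W.a_subset x linear_closed[OF assms(4) x] by (auto simp: linear_add[OF assms(4)] W0)
  qed
  moreover have "x \<in> W +>\<^bsub>V\<^esub> x" using W.a_rcos_self x by blast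
  ultimately have "f ` (W +>\<^bsub>V\<^esub> x) = {f x}" by blast
  then show ?thesis by simp
qed

lemma kernel_submodule:
  assumes "module K V" "module K T" "f \<in> linear_maps K V T"
  shows "submodule {x \<in> carrier V. f x = \<zero>\<^bsub>T\<^esub>} K V"
proof -
  interpret V: module K V by fact
  interpret T: module K T by fact
  show ?thesis
  proof (rule V.submoduleI)
    fix x assume x: "x \<in> {x \<in> carrier V. f x = \<zero>\<^bsub>T\<^esub>}"
    have "\<ominus>\<^bsub>V\<^esub> x = \<zero>\<^bsub>V\<^esub> \<ominus>\<^bsub>V\<^esub> x"
      using x by (simp add: a_minus_def)
    then show "\<ominus>\<^bsub>V\<^esub> x \<in> {x \<in> carrier V. f x = \<zero>\<^bsub>T\<^esub>}"
      using x linear_minus[OF assms(3,1,2), of "\<zero>\<^bsub>V\<^esub>" x] linear_zero[OF assms(3,1,2)]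
      by (simp add: a_minus_def)
  qed (use linear_zero[OF assms(3,1,2)] linear_add[OF assms(3)] linear_smult[OF assms(3)] in auto)
qed

lemma lin_span_superset: "S \<subseteq> lin_span K V S"
  by (auto simp: lin_span_def)

lemma lin_span_least: "submodule W K V \<Longrightarrow> S \<subseteq> W \<Longrightarrow> lin_span K V S \<subseteq> W"
  by (auto simp: lin_span_def)

lemma lin_span_submodule:
  assumes "module K V" "S \<subseteq> carrier V"
  shows "submodule (lin_span K V S) K V"
proof -
  interpret V: module K V by fact
  have c: "submodule (carrier V) K V" by (rule V.carrier_is_submodule)
  show ?thesis
  proof (rule V.submoduleI)
    show "lin_span K V S \<subseteq> carrier V" by (rule lin_span_least[OF c assms(2)])
    show "\<zero>\<^bsub>V\<^esub> \<in> lin_span K V S"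
      unfolding lin_span_def using subgroup.one_closed[OF submodule.axioms(1)] by fastforce
  qed (auto simp: lin_span_def V.submoduleE)
qed

text \<open>The kernel is a submodule, so it contains a span as soon as it contains the generators.
  This confines every well-definedness check to the generating relations.\<close>

lemma lin_span_zero:
  assumes "module K V" "module K T" "f \<in> linear_maps K V T" "S \<subseteq> carrier V"
    and "\<And>s. s \<in> S \<Longrightarrow> f s = \<zero>\<^bsub>T\<^esub>" "x \<in> lin_span K V S"
  shows "f x = \<zero>\<^bsub>T\<^esub>"
  using lin_span_least[OF kernel_submodule[OF assms(1,2,3)], of S] assms(4-6) by blast

section \<open>Free spaces\<close>

lemma free_sel [simp]:
  "carrier (free_space K B) =
    {f. (\<forall>p. f p \<in> carrier K) \<and> (\<forall>p. p \<notin> B \<longrightarrow> f p = \<zero>\<^bsub>K\<^esub>) \<and> finite {p. f p \<noteq> \<zero>\<^bsub>K\<^esub>}}"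
  "zero (free_space K B) = (\<lambda>p. \<zero>\<^bsub>K\<^esub>)" "add (free_space K B) = (\<lambda>f g p. f p \<oplus>\<^bsub>K\<^esub> g p)"
  "smult (free_space K B) = (\<lambda>a f p. a \<otimes>\<^bsub>K\<^esub> f p)"
  by (auto simp: free_space_def)

lemma free_space_module:
  fixes K :: "('k, 'y) ring_scheme" and B :: "'b set"
  assumes "cring K"
  shows "module K (free_space K B)"
proof -
  interpret K: cring K by fact
  have fin: "finite {p. f p \<oplus>\<^bsub>K\<^esub> g p \<noteq> \<zero>\<^bsub>K\<^esub>}"
    if "finite {p. f p \<noteq> \<zero>\<^bsub>K\<^esub>}" "finite {p. g p \<noteq> \<zero>\<^bsub>K\<^esub>}" for f g :: "'b \<Rightarrow> 'k"
    by (rule finite_subset[OF _ finite_UnI[OF that]]) auto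
  have fin': "finite {p. a \<otimes>\<^bsub>K\<^esub> f p \<noteq> \<zero>\<^bsub>K\<^esub>}"
    if "finite {p. f p \<noteq> \<zero>\<^bsub>K\<^esub>}" "a \<in> carrier K" for f :: "'b \<Rightarrow> 'k" and a
    by (rule finite_subset[OF _ that(1)]) (use that in auto)
  show ?thesis
  proof (intro moduleI abelian_groupI)
    fix f assume f: "f \<in> carrier (free_space K B)"
    have "finite {p. \<ominus>\<^bsub>K\<^esub> f p \<noteq> \<zero>\<^bsub>K\<^esub>}"
      by (rule finite_subset[of _ "{p. f p \<noteq> \<zero>\<^bsub>K\<^esub>}"]) (use f in auto)
    then show "\<exists>g\<in>carrier (free_space K B). g \<oplus>\<^bsub>free_space K B\<^esub> f = \<zero>\<^bsub>free_space K B\<^esub>"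
      using f by (intro bexI[of _ "\<lambda>p. \<ominus>\<^bsub>K\<^esub> f p"]) (auto simp: K.l_neg)
  qed (auto simp: assms fin fin' K.a_ac K.m_assoc K.l_distr K.r_distr)
qed

lemma free_gen_closed:
  assumes "cring K" "b \<in> B"
  shows "free_gen K b \<in> carrier (free_space K B)"
proof -
  interpret K: cring K by fact
  have "finite {p. free_gen K b p \<noteq> \<zero>\<^bsub>K\<^esub>}"
    by (rule finite_subset[of _ "{b}"]) (auto simp: free_gen_def)
  then show ?thesis using assms(2) by (auto simp: free_gen_def)
qed

lemma free_space_induct [consumes 2, case_names zero add]:
  assumes "cring K" and f: "f \<in> carrier (free_space K B)" and z: "P (\<lambda>p. \<zero>\<^bsub>K\<^esub>)"
    and add: "\<And>a b f. a \<in> carrier K \<Longrightarrow> b \<in> B \<Longrightarrow> f \<in> carrier (free_space K B) \<Longrightarrow> P f \<Longrightarrow>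
      P (a \<odot>\<^bsub>free_space K B\<^esub> free_gen K b \<oplus>\<^bsub>free_space K B\<^esub> f)"
  shows "P f"
proof -
  interpret K: cring K by fact
  have "finite F \<Longrightarrow> f \<in> carrier (free_space K B) \<Longrightarrow> {p. f p \<noteq> \<zero>\<^bsub>K\<^esub>} \<subseteq> F \<Longrightarrow> P f" for F f
  proof (induction F arbitrary: f rule: finite_induct)
    case empty
    then have "f = (\<lambda>p. \<zero>\<^bsub>K\<^esub>)" by auto
    then show ?case using z by simp
  next
    case (insert b F)
    \<comment> \<open>Erase the value at \<open>b\<close>: the support of \<open>g\<close> lies in
      \<open>F\<close>, and \<open>f\<close> is recovered by adding one multiple of a generator, or
      nothing when \<open>b\<close> lies outside \<open>B\<close>.\<close>
    define g where "g = f(b := \<zero>\<^bsub>K\<^esub>)"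
    have fin: "finite {p. g p \<noteq> \<zero>\<^bsub>K\<^esub>}"
      by (rule finite_subset[OF _ insert(1)]) (use insert.prems in \<open>auto simp: g_def\<close>)
    have g: "g \<in> carrier (free_space K B)" using insert.prems fin by (auto simp: g_def)
    have Pg: "P g" by (rule insert.IH[OF g]) (use insert.prems in \<open>auto simp: g_def\<close>)
    show ?case
    proof (cases "b \<in> B")
      case True
      have e: "f = f b \<odot>\<^bsub>free_space K B\<^esub> free_gen K b \<oplus>\<^bsub>free_space K B\<^esub> g"
        using insert.prems by (auto simp: g_def free_gen_def)
      show ?thesis
        by (subst e) (rule add[OF _ True g Pg], use insert.prems in auto)
    next
      case False
      then have "f = g" using insert.prems by (auto simp: g_def)
      then show ?thesis using Pg by simp
    qed
  qed
  then show ?thesis using f by auto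
qed

text \<open>The sum defining \<open>free_lift\<close> runs over the support, which can shrink by
  cancellation. Padding with zero terms over a fixed \<open>F\<close> lets sums for different
  functions be compared.\<close>

lemma free_lift_superset:
  assumes "module K T" "f \<in> carrier (free_space K (A \<times> B))" "\<phi> \<in> A \<rightarrow> B \<rightarrow> carrier T"
    and "finite F" "{p. f p \<noteq> \<zero>\<^bsub>K\<^esub>} \<subseteq> F" "F \<subseteq> A \<times> B"
  shows "free_lift K T \<phi> f = (\<Oplus>\<^bsub>T\<^esub>p\<in>F. f p \<odot>\<^bsub>T\<^esub> \<phi> (fst p) (snd p))"
proof -
  interpret T: module K T by fact
  show ?thesis
    unfolding free_lift_def
    by (rule T.add.finprod_mono_neutral_cong_left) (use assms in \<open>auto simp: Pi_iff\<close>)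
qed

lemma free_lift_linear:
  assumes "module K T" "\<phi> \<in> A \<rightarrow> B \<rightarrow> carrier T"
  shows "free_lift K T \<phi> \<in> linear_maps K (free_space K (A \<times> B)) T"
proof -
  interpret T: module K T by fact
  let ?F = "free_space K (A \<times> B)"
  interpret F: module K ?F by (rule free_space_module) unfold_locales
  have supp: "{p. f p \<noteq> \<zero>\<^bsub>K\<^esub>} \<subseteq> A \<times> B" if "f \<in> carrier ?F" for f
    using that by auto
  show ?thesis
  proof (rule linear_mapsI)
    fix f assume f: "f \<in> carrier ?F"
    have "free_lift K T \<phi> f = (\<Oplus>\<^bsub>T\<^esub>p\<in>{p. f p \<noteq> \<zero>\<^bsub>K\<^esub>}. f p \<odot>\<^bsub>T\<^esub> \<phi> (fst p) (snd p))"
      by (simp add: free_lift_def)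
    also have "\<dots> \<in> carrier T"
      by (rule T.M.finsum_closed) (use f supp[OF f] assms(2) in \<open>auto simp: Pi_iff\<close>)
    finally show "free_lift K T \<phi> f \<in> carrier T" .
  next
    fix f g assume f: "f \<in> carrier ?F" and g: "g \<in> carrier ?F"
    let ?S = "{p. f p \<noteq> \<zero>\<^bsub>K\<^esub>} \<union> {p. g p \<noteq> \<zero>\<^bsub>K\<^esub>}"
    have fg: "f \<oplus>\<^bsub>?F\<^esub> g \<in> carrier ?F" using f g by (rule F.M.a_closed)
    have S: "finite ?S" "?S \<subseteq> A \<times> B" using f g by auto
    have c: "p \<in> ?S \<Longrightarrow> \<phi> (fst p) (snd p) \<in> carrier T" for p
      using S assms(2) by (fastforce simp: Pi_iff)
    have "free_lift K T \<phi> (f \<oplus>\<^bsub>?F\<^esub> g) = (\<Oplus>\<^bsub>T\<^esub>p\<in>?S. (f \<oplus>\<^bsub>?F\<^esub> g) p \<odot>\<^bsub>T\<^esub> \<phi> (fst p) (snd p))"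
      by (rule free_lift_superset[OF assms(1) fg assms(2) S(1) _ S(2)]) (use f g in auto)
    also have "\<dots> = (\<Oplus>\<^bsub>T\<^esub>p\<in>?S. f p \<odot>\<^bsub>T\<^esub> \<phi> (fst p) (snd p) \<oplus>\<^bsub>T\<^esub> g p \<odot>\<^bsub>T\<^esub> \<phi> (fst p) (snd p))"
      by (rule T.M.finsum_cong') (use f g c in \<open>auto simp: T.smult_l_distr\<close>)
    also have "\<dots> = (\<Oplus>\<^bsub>T\<^esub>p\<in>?S. f p \<odot>\<^bsub>T\<^esub> \<phi> (fst p) (snd p)) \<oplus>\<^bsub>T\<^esub> (\<Oplus>\<^bsub>T\<^esub>p\<in>?S. g p \<odot>\<^bsub>T\<^esub> \<phi> (fst p) (snd p))"
      by (rule T.M.finsum_addf) (use f g c in auto)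
    also have "\<dots> = free_lift K T \<phi> f \<oplus>\<^bsub>T\<^esub> free_lift K T \<phi> g"
      using free_lift_superset[OF assms(1) f assms(2) S(1) _ S(2)]
        free_lift_superset[OF assms(1) g assms(2) S(1) _ S(2)] by simp
    finally show "free_lift K T \<phi> (f \<oplus>\<^bsub>?F\<^esub> g) = free_lift K T \<phi> f \<oplus>\<^bsub>T\<^esub> free_lift K T \<phi> g" .
  next
    fix a f assume a: "a \<in> carrier K" and f: "f \<in> carrier ?F"
    let ?S = "{p. f p \<noteq> \<zero>\<^bsub>K\<^esub>}"
    have S: "finite ?S" "?S \<subseteq> A \<times> B" using f by auto
    have c: "p \<in> ?S \<Longrightarrow> \<phi> (fst p) (snd p) \<in> carrier T" for p
      using S assms(2) by (fastforce simp: Pi_iff)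
    have "free_lift K T \<phi> (a \<odot>\<^bsub>?F\<^esub> f) = (\<Oplus>\<^bsub>T\<^esub>p\<in>?S. (a \<odot>\<^bsub>?F\<^esub> f) p \<odot>\<^bsub>T\<^esub> \<phi> (fst p) (snd p))"
      by (rule free_lift_superset[OF assms(1) _ assms(2) S(1) _ S(2)]) (use a f F.smult_closed[OF a f] in auto)
    also have "\<dots> = (\<Oplus>\<^bsub>T\<^esub>p\<in>?S. a \<odot>\<^bsub>T\<^esub> (f p \<odot>\<^bsub>T\<^esub> \<phi> (fst p) (snd p)))"
      by (rule T.M.finsum_cong') (use a f c in \<open>auto simp: T.smult_assoc1\<close>)
    also have "\<dots> = a \<odot>\<^bsub>T\<^esub> free_lift K T \<phi> f"
      unfolding free_lift_def by (rule T.finsum_smult_ldistr[symmetric]) (use S a f c in auto)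
    finally show "free_lift K T \<phi> (a \<odot>\<^bsub>?F\<^esub> f) = a \<odot>\<^bsub>T\<^esub> free_lift K T \<phi> f" .
  qed
qed

lemma free_lift_gen:
  assumes "module K T" "\<phi> \<in> A \<rightarrow> B \<rightarrow> carrier T" "a \<in> A" "b \<in> B"
  shows "free_lift K T \<phi> (free_gen K (a, b)) = \<phi> a b"
proof -
  interpret T: module K T by fact
  have c: "\<phi> a b \<in> carrier T" using assms by auto
  have g: "free_gen K (a, b) \<in> carrier (free_space K (A \<times> B))"
    by (rule free_gen_closed) (use assms in \<open>auto intro: T.R.is_cring\<close>)
  have "free_lift K T \<phi> (free_gen K (a, b)) = (\<Oplus>\<^bsub>T\<^esub>p\<in>{(a, b)}. free_gen K (a, b) p \<odot>\<^bsub>T\<^esub> \<phi> (fst p) (snd p))"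
    by (rule free_lift_superset[OF assms(1) g assms(2)]) (use assms in \<open>auto simp: free_gen_def\<close>)
  also have "\<dots> = \<phi> a b"
    using c by (simp add: T.M.finsum_insert free_gen_def)
  finally show ?thesis .
qed

section \<open>Bilinear maps and tensor products\<close>

definition bilinear_maps ::
    "('k, 'y) ring_scheme \<Rightarrow> ('k, 'm, 'u) module_scheme \<Rightarrow> ('k, 'n, 'v) module_scheme \<Rightarrow>
      ('k, 't, 'w) module_scheme \<Rightarrow> ('m \<Rightarrow> 'n \<Rightarrow> 't) set"
  where "bilinear_maps K M N T = {\<phi>. (\<forall>m\<in>carrier M. \<phi> m \<in> linear_maps K N T) \<and>
    (\<forall>n\<in>carrier N. (\<lambda>m. \<phi> m n) \<in> linear_maps K M T)}"

lemma bilinearI: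
  assumes "\<And>m n. m \<in> carrier M \<Longrightarrow> n \<in> carrier N \<Longrightarrow> \<phi> m n \<in> carrier T"
    and "\<And>m m' n. m \<in> carrier M \<Longrightarrow> m' \<in> carrier M \<Longrightarrow> n \<in> carrier N \<Longrightarrow>
      \<phi> (m \<oplus>\<^bsub>M\<^esub> m') n = \<phi> m n \<oplus>\<^bsub>T\<^esub> \<phi> m' n"
    and "\<And>m n n'. m \<in> carrier M \<Longrightarrow> n \<in> carrier N \<Longrightarrow> n' \<in> carrier N \<Longrightarrow>
      \<phi> m (n \<oplus>\<^bsub>N\<^esub> n') = \<phi> m n \<oplus>\<^bsub>T\<^esub> \<phi> m n'"
    and "\<And>a m n. a \<in> carrier K \<Longrightarrow> m \<in> carrier M \<Longrightarrow> n \<in> carrier N \<Longrightarrow>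
      \<phi> (a \<odot>\<^bsub>M\<^esub> m) n = a \<odot>\<^bsub>T\<^esub> \<phi> m n"
    and "\<And>a m n. a \<in> carrier K \<Longrightarrow> m \<in> carrier M \<Longrightarrow> n \<in> carrier N \<Longrightarrow>
      \<phi> m (a \<odot>\<^bsub>N\<^esub> n) = a \<odot>\<^bsub>T\<^esub> \<phi> m n"
  shows "\<phi> \<in> bilinear_maps K M N T"
  using assms by (auto simp: bilinear_maps_def intro!: linear_mapsI)

lemma
  assumes "\<phi> \<in> bilinear_maps K M N T"
  shows bilinear_closed: "m \<in> carrier M \<Longrightarrow> n \<in> carrier N \<Longrightarrow> \<phi> m n \<in> carrier T"
    and bilinear_add_left: "m \<in> carrier M \<Longrightarrow> m' \<in> carrier M \<Longrightarrow> n \<in> carrier N \<Longrightarrow>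
      \<phi> (m \<oplus>\<^bsub>M\<^esub> m') n = \<phi> m n \<oplus>\<^bsub>T\<^esub> \<phi> m' n"
    and bilinear_add_right: "m \<in> carrier M \<Longrightarrow> n \<in> carrier N \<Longrightarrow> n' \<in> carrier N \<Longrightarrow>
      \<phi> m (n \<oplus>\<^bsub>N\<^esub> n') = \<phi> m n \<oplus>\<^bsub>T\<^esub> \<phi> m n'"
    and bilinear_smult_left: "a \<in> carrier K \<Longrightarrow> m \<in> carrier M \<Longrightarrow> n \<in> carrier N \<Longrightarrow>
      \<phi> (a \<odot>\<^bsub>M\<^esub> m) n = a \<odot>\<^bsub>T\<^esub> \<phi> m n"
    and bilinear_smult_right: "a \<in> carrier K \<Longrightarrow> m \<in> carrier M \<Longrightarrow> n \<in> carrier N \<Longrightarrow>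
      \<phi> m (a \<odot>\<^bsub>N\<^esub> n) = a \<odot>\<^bsub>T\<^esub> \<phi> m n"
  using assms by (auto simp: bilinear_maps_def linear_maps_def)

lemma
  assumes "\<phi> \<in> bilinear_maps K M N T"
  shows bilinear_left: "n \<in> carrier N \<Longrightarrow> (\<lambda>m. \<phi> m n) \<in> linear_maps K M T"
    and bilinear_right: "m \<in> carrier M \<Longrightarrow> \<phi> m \<in> linear_maps K N T"
  using assms by (auto simp: bilinear_maps_def)

lemma bilinear_comp:
  assumes "\<phi> \<in> bilinear_maps K M N T" "f \<in> linear_maps K M' M" "g \<in> linear_maps K N' N"
    "h \<in> linear_maps K T T'"
  shows "(\<lambda>m n. h (\<phi> (f m) (g n))) \<in> bilinear_maps K M' N' T'"
  using linear_maps_comp[OF linear_maps_comp[OF assms(3) bilinear_right[OF assms(1)]] assms(4)]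
    linear_maps_comp[OF linear_maps_comp[OF assms(2) bilinear_left[OF assms(1)]] assms(4)]
    linear_closed[OF assms(2)] linear_closed[OF assms(3)]
  unfolding bilinear_maps_def by auto

lemma bilinear_comp_out:
  assumes "\<phi> \<in> bilinear_maps K M N T" "h \<in> linear_maps K T T'"
  shows "(\<lambda>m n. h (\<phi> m n)) \<in> bilinear_maps K M N T'"
  using bilinear_comp[OF assms(1) linear_id linear_id assms(2)] by simp

lemma tensor_sel [simp]:
  "zero (tensor K M N) = zero (quotient_space (tensor_free K M N) (tensor_null K M N))"
  "add (tensor K M N) = add (quotient_space (tensor_free K M N) (tensor_null K M N))"
  "smult (tensor K M N) = smult (quotient_space (tensor_free K M N) (tensor_null K M N))"
  "carrier (tensor K M N) = carrier (quotient_space (tensor_free K M N) (tensor_null K M N))"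
  "one (tensor K M N) = tens K M N \<one>\<^bsub>M\<^esub> \<one>\<^bsub>N\<^esub>"
  by (auto simp: tensor_def Let_def quotient_space_def)

locale two_modules = M: module K M + N: module K N
  for K :: "('k, 'y) ring_scheme" (structure)
    and M :: "('k, 'm, 'u) module_scheme" (structure)
    and N :: "('k, 'n, 'v) module_scheme" (structure)
begin

abbreviation "F \<equiv> tensor_free K M N"
abbreviation "tnull \<equiv> tensor_null K M N"
abbreviation "T \<equiv> tensor K M N"
abbreviation tensor_elt :: "'m \<Rightarrow> 'n \<Rightarrow> ('m \<times> 'n \<Rightarrow> 'k) set" (infixl \<open>\<star>\<close> 72) where "m \<star> n \<equiv> tens K M N m n"

lemma F_module: "module K F"
  by (rule free_space_module) unfold_locales

sublocale F: module K F
  by (rule F_module)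

lemma gen_closed: "m \<in> carrier M \<Longrightarrow> n \<in> carrier N \<Longrightarrow> free_gen K (m, n) \<in> carrier F"
  by (rule free_gen_closed) (auto intro: M.R.is_cring)

lemma tnull_submodule: "submodule tnull K F"
  unfolding tensor_null_def Let_def
  by (rule lin_span_submodule[OF F_module], intro Un_least subsetI; elim CollectE exE conjE;
      hypsubst; intro F.M.minus_closed F.M.a_closed F.smult_closed gen_closed M.M.a_closed
        N.M.a_closed M.smult_closed N.smult_closed; assumption)

lemma tensor_module: "module K T"
  by (rule module_cong[OF quotient_module[OF F_module tnull_submodule]]) (auto simp del: quotient_sel)

sublocale T: module K T
  by (rule tensor_module)

lemma proj_linear: "(+>\<^bsub>F\<^esub>) tnull \<in> linear_maps K F T"
  using coset_map_linear[OF F_module tnull_submodule] by (simp add: linear_maps_def)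

lemma proj_surj:
  assumes "x \<in> carrier T"
  obtains f where "f \<in> carrier F" "x = tnull +>\<^bsub>F\<^esub> f"
  using assms coset_map_surj[of F tnull] by (auto simp del: quotient_sel free_sel)

lemma tens_closed [simp, intro]: "m \<in> carrier M \<Longrightarrow> n \<in> carrier N \<Longrightarrow> m \<star> n \<in> carrier T"
  unfolding tens_def by (rule linear_closed[OF proj_linear gen_closed])

lemma tnull_relations:
  assumes "m \<in> carrier M" "n \<in> carrier N"
  shows "m' \<in> carrier M \<Longrightarrow> free_gen K (m \<oplus>\<^bsub>M\<^esub> m', n) \<ominus>\<^bsub>F\<^esub>
      (free_gen K (m, n) \<oplus>\<^bsub>F\<^esub> free_gen K (m', n)) \<in> tnull"
    and "n' \<in> carrier N \<Longrightarrow> free_gen K (m, n \<oplus>\<^bsub>N\<^esub> n') \<ominus>\<^bsub>F\<^esub>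
      (free_gen K (m, n) \<oplus>\<^bsub>F\<^esub> free_gen K (m, n')) \<in> tnull"
    and "a \<in> carrier K \<Longrightarrow> free_gen K (a \<odot>\<^bsub>M\<^esub> m, n) \<ominus>\<^bsub>F\<^esub> (a \<odot>\<^bsub>F\<^esub> free_gen K (m, n)) \<in> tnull"
    and "a \<in> carrier K \<Longrightarrow> free_gen K (m, a \<odot>\<^bsub>N\<^esub> n) \<ominus>\<^bsub>F\<^esub> (a \<odot>\<^bsub>F\<^esub> free_gen K (m, n)) \<in> tnull"
  unfolding tensor_null_def Let_def
  using assms by (blast intro: subsetD[OF lin_span_superset])+

lemma tens_bilinear: "tens K M N \<in> bilinear_maps K M N T"
proof -
  note eq = coset_eq_iff[OF F_module tnull_submodule, THEN iffD2]
  note add = linear_add[OF proj_linear, symmetric] and smult = linear_smult[OF proj_linear, symmetric]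
  show ?thesis
    unfolding tens_def
    by (intro bilinearI; (subst add smult)?; (intro eq tnull_relations linear_closed[OF proj_linear])?;
        (intro gen_closed F.M.a_closed F.smult_closed)?)
      (simp_all del: free_sel)
qed

lemmas tens_smult_left = bilinear_smult_left[OF tens_bilinear]
  and tens_smult_right = bilinear_smult_right[OF tens_bilinear]

lemma tens_zero: "\<zero>\<^bsub>M\<^esub> \<star> \<zero>\<^bsub>N\<^esub> = \<zero>\<^bsub>T\<^esub>"
  using tens_smult_left[of \<zero> "\<zero>\<^bsub>M\<^esub>" "\<zero>\<^bsub>N\<^esub>"] by (simp del: tensor_sel)

text \<open>Sums of pure tensors suffice: a scalar is absorbed into the left factor and zero is
  itself pure by \<open>tens_zero\<close>, so neither needs a case.\<close>

lemma tensor_induct [consumes 1, case_names tens add]: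
  assumes x: "x \<in> carrier T"
    and tens: "\<And>m n. m \<in> carrier M \<Longrightarrow> n \<in> carrier N \<Longrightarrow> P (m \<star> n)"
    and add: "\<And>x y. x \<in> carrier T \<Longrightarrow> y \<in> carrier T \<Longrightarrow> P x \<Longrightarrow> P y \<Longrightarrow> P (x \<oplus>\<^bsub>T\<^esub> y)"
  shows "P x"
proof -
  let ?p = "(+>\<^bsub>F\<^esub>) tnull"
  have "P (?p f)" if f: "f \<in> carrier F" for f
    using M.R.is_cring f
  proof (induction rule: free_space_induct)
    case zero
    have "?p \<zero>\<^bsub>F\<^esub> = \<zero>\<^bsub>M\<^esub> \<star> \<zero>\<^bsub>N\<^esub>"
      using linear_zero[OF proj_linear F_module tensor_module] tens_zero by simp
    moreover have "P (\<zero>\<^bsub>M\<^esub> \<star> \<zero>\<^bsub>N\<^esub>)" by (rule tens) auto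
    ultimately show ?case by simp
  next
    case (add a b f)
    obtain m n where b: "b = (m, n)" "m \<in> carrier M" "n \<in> carrier N"
      using add by auto
    have g: "a \<odot>\<^bsub>F\<^esub> free_gen K b \<in> carrier F"
      unfolding b(1) by (intro F.smult_closed gen_closed b add)
    have "?p (a \<odot>\<^bsub>F\<^esub> free_gen K b \<oplus>\<^bsub>F\<^esub> f) = ?p (a \<odot>\<^bsub>F\<^esub> free_gen K b) \<oplus>\<^bsub>T\<^esub> ?p f"
      by (rule linear_add[OF proj_linear g]) (rule add)
    also have "?p (a \<odot>\<^bsub>F\<^esub> free_gen K b) = a \<odot>\<^bsub>T\<^esub> (m \<star> n)"
      unfolding b(1) tens_def by (rule linear_smult[OF proj_linear]) (intro gen_closed b add)+
    also have "\<dots> = (a \<odot>\<^bsub>M\<^esub> m) \<star> n"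
      by (rule tens_smult_left[symmetric]) (use b add in auto)
    finally show ?case
      using assms(3)[of "(a \<odot>\<^bsub>M\<^esub> m) \<star> n" "?p f"] tens[of "a \<odot>\<^bsub>M\<^esub> m" n] b add
        linear_closed[OF proj_linear add(3)] by (simp del: tensor_sel free_sel add: tens_closed)
  qed
  then show ?thesis using x by (elim proj_surj) simp
qed

lemma linear_tensor_eqI:
  assumes "f \<in> linear_maps K T S" "g \<in> linear_maps K T S" "x \<in> carrier T"
    and "\<And>m n. m \<in> carrier M \<Longrightarrow> n \<in> carrier N \<Longrightarrow> f (m \<star> n) = g (m \<star> n)"
  shows "f x = g x"
  using assms(3)
proof (induction rule: tensor_induct)
  case (add x y)
  then show ?case by (simp only: linear_add[OF assms(1)] linear_add[OF assms(2)])
qed (rule assms(4))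

context
  fixes S :: "('k, 's, 'w) module_scheme" and \<phi>
  assumes S: "module K S" and \<phi>: "\<phi> \<in> bilinear_maps K M N S"
begin

interpretation S: module K S by (rule S)

lemma bilinear_Pi: "\<phi> \<in> carrier M \<rightarrow> carrier N \<rightarrow> carrier S"
  using bilinear_closed[OF \<phi>] by auto

text \<open>Each of the four families of relations is one clause of the bilinearity of
  \<open>\<phi>\<close>, written as a difference.\<close>

lemma free_lift_null: "f \<in> tnull \<Longrightarrow> free_lift K S \<phi> f = \<zero>\<^bsub>S\<^esub>"
proof -
  note lin = free_lift_linear[OF S bilinear_Pi]
  note linear = linear_minus[OF lin F_module S] linear_add[OF lin] linear_smult[OF lin]
  have zero: "x \<ominus>\<^bsub>S\<^esub> x = \<zero>\<^bsub>S\<^esub>" if "x \<in> carrier S" for x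
    using that by (simp add: a_minus_def S.M.r_neg)
  show "f \<in> tnull \<Longrightarrow> free_lift K S \<phi> f = \<zero>\<^bsub>S\<^esub>"
    unfolding tensor_null_def Let_def
    by (erule lin_span_zero[OF F_module S lin, rotated -1], intro Un_least subsetI;
        elim UnE CollectE exE conjE; hypsubst)
      (simp_all only: linear gen_closed F.M.a_closed F.M.minus_closed F.smult_closed M.M.a_closed
        N.M.a_closed M.smult_closed N.smult_closed free_lift_gen[OF S bilinear_Pi]
        bilinear_closed[OF \<phi>] bilinear_add_left[OF \<phi>] bilinear_add_right[OF \<phi>]
        bilinear_smult_left[OF \<phi>] bilinear_smult_right[OF \<phi>] zero S.M.a_closed S.smult_closed)
qed

lemma tensor_lift_proj: "f \<in> carrier F \<Longrightarrow> tensor_lift K S \<phi> (tnull +>\<^bsub>F\<^esub> f) = free_lift K S \<phi> f"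
  unfolding tensor_lift_def
  by (rule the_elem_coset[OF F_module tnull_submodule S free_lift_linear[OF S bilinear_Pi] free_lift_null])

lemma tensor_lift_tens:
  "m \<in> carrier M \<Longrightarrow> n \<in> carrier N \<Longrightarrow> tensor_lift K S \<phi> (m \<star> n) = \<phi> m n"
  unfolding tens_def using tensor_lift_proj[OF gen_closed] free_lift_gen[OF S bilinear_Pi] by metis

lemma tensor_lift_linear: "tensor_lift K S \<phi> \<in> linear_maps K T S"
proof (rule linear_mapsI)
  note lin = free_lift_linear[OF S bilinear_Pi]
  fix x assume x: "x \<in> carrier T"
  then obtain f where f: "f \<in> carrier F" "x = tnull +>\<^bsub>F\<^esub> f" by (elim proj_surj)
  then show "tensor_lift K S \<phi> x \<in> carrier S"
    using linear_closed[OF lin f(1)] by (simp add: tensor_lift_proj)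
  fix a assume a: "a \<in> carrier K"
  show "tensor_lift K S \<phi> (a \<odot>\<^bsub>T\<^esub> x) = a \<odot>\<^bsub>S\<^esub> tensor_lift K S \<phi> x"
    unfolding f(2) linear_smult[OF proj_linear a f(1), symmetric]
    using tensor_lift_proj F.smult_closed[OF a f(1)] f(1) linear_smult[OF lin a f(1)] by simp
next
  note lin = free_lift_linear[OF S bilinear_Pi]
  fix x y assume x: "x \<in> carrier T" and y: "y \<in> carrier T"
  from x obtain f where f: "f \<in> carrier F" "x = tnull +>\<^bsub>F\<^esub> f" by (elim proj_surj)
  from y obtain g where g: "g \<in> carrier F" "y = tnull +>\<^bsub>F\<^esub> g" by (elim proj_surj)
  show "tensor_lift K S \<phi> (x \<oplus>\<^bsub>T\<^esub> y) = tensor_lift K S \<phi> x \<oplus>\<^bsub>S\<^esub> tensor_lift K S \<phi> y"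
    unfolding f(2) g(2) linear_add[OF proj_linear f(1) g(1), symmetric]
    using tensor_lift_proj F.M.a_closed[OF f(1) g(1)] f(1) g(1) linear_add[OF lin f(1) g(1)] by simp
qed

lemma tensor_lift_unique:
  assumes "f \<in> linear_maps K T S" "x \<in> carrier T"
    and "\<And>m n. m \<in> carrier M \<Longrightarrow> n \<in> carrier N \<Longrightarrow> f (m \<star> n) = \<phi> m n"
  shows "f x = tensor_lift K S \<phi> x"
  by (rule linear_tensor_eqI[OF assms(1) tensor_lift_linear assms(2)]) (simp add: assms(3) tensor_lift_tens)

end

lemma tensor_lift_comp:
  assumes "module K S" "module K S'" "\<phi> \<in> bilinear_maps K M N S" "f \<in> linear_maps K S S'" "x \<in> carrier T"
  shows "f (tensor_lift K S \<phi> x) = tensor_lift K S' (\<lambda>m n. f (\<phi> m n)) x"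
  by (rule tensor_lift_unique[OF assms(2) bilinear_comp_out[OF assms(3,4)]
      linear_maps_comp[OF tensor_lift_linear[OF assms(1,3)] assms(4)] assms(5)])
    (simp add: tensor_lift_tens[OF assms(1,3)])

lemma bilinear_cong:
  assumes "\<phi> \<in> bilinear_maps K M N S"
    and "\<And>m n. m \<in> carrier M \<Longrightarrow> n \<in> carrier N \<Longrightarrow> \<psi> m n = \<phi> m n"
  shows "\<psi> \<in> bilinear_maps K M N S"
  using assms by (intro bilinearI) (simp_all add: bilinear_closed bilinear_add_left bilinear_add_right
    bilinear_smult_left bilinear_smult_right)

text \<open>\<open>\<psi>\<close> agrees with \<open>\<phi>\<close> on carriers only, so one cannot
  rewrite under the lift; but then both maps are bilinear, and agreement on pure tensors is
  enough.\<close>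

lemma tensor_lift_cong:
  assumes "module K S" "\<phi> \<in> bilinear_maps K M N S" "x \<in> carrier T"
    and eq: "\<And>m n. m \<in> carrier M \<Longrightarrow> n \<in> carrier N \<Longrightarrow> \<psi> m n = \<phi> m n"
  shows "tensor_lift K S \<psi> x = tensor_lift K S \<phi> x"
proof -
  have \<psi>: "\<psi> \<in> bilinear_maps K M N S" by (rule bilinear_cong[OF assms(2) eq])
  show ?thesis
    by (rule linear_tensor_eqI[OF tensor_lift_linear[OF assms(1) \<psi>] tensor_lift_linear[OF assms(1,2)] assms(3)])
      (simp add: tensor_lift_tens[OF assms(1) \<psi>] tensor_lift_tens[OF assms(1,2)] eq)
qed

end

text \<open>The lifted map changes with \<open>p\<close>, so linearity in \<open>p\<close> is not an
  instance of linearity of one lift. Induction on \<open>x\<close> reduces it to pure tensors, where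
  \<open>right\<close> applies. Nested lifts rest on this.\<close>

lemma lift_param_bilinear:
  assumes "two_modules K M N" "module K P" "module K S"
    and left: "\<And>p. p \<in> carrier P \<Longrightarrow> (\<lambda>m n. \<psi> m n p) \<in> bilinear_maps K M N S"
    and right: "\<And>m n. m \<in> carrier M \<Longrightarrow> n \<in> carrier N \<Longrightarrow> \<psi> m n \<in> linear_maps K P S"
  shows "(\<lambda>x p. tensor_lift K S (\<lambda>m n. \<psi> m n p) x) \<in> bilinear_maps K (tensor K M N) P S"
proof -
  interpret MN: two_modules K M N by fact
  interpret P: module K P by fact
  interpret S: module K S by fact
  note lin = MN.tensor_lift_linear[OF assms(3) left] and val = MN.tensor_lift_tens[OF assms(3) left]
  show ?thesis
  proof (rule bilinearI)
    fix x p p' assume x: "x \<in> carrier MN.T" and p: "p \<in> carrier P" "p' \<in> carrier P"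
    show "tensor_lift K S (\<lambda>m n. \<psi> m n (p \<oplus>\<^bsub>P\<^esub> p')) x =
        tensor_lift K S (\<lambda>m n. \<psi> m n p) x \<oplus>\<^bsub>S\<^esub> tensor_lift K S (\<lambda>m n. \<psi> m n p') x"
      using x
    proof (induction rule: MN.tensor_induct)
      case (add x y)
      note c = linear_closed[OF lin, OF _ add(1)] linear_closed[OF lin, OF _ add(2)]
      show ?case
        using p add(3,4) c by (simp add: linear_add[OF lin, OF _ add(1,2)] S.M.a_ac del: tensor_sel)
    qed (use p in \<open>simp add: val linear_add[OF right]\<close>)
  next
    fix a x p assume a: "a \<in> carrier K" and x: "x \<in> carrier MN.T" and p: "p \<in> carrier P"
    show "tensor_lift K S (\<lambda>m n. \<psi> m n (a \<odot>\<^bsub>P\<^esub> p)) x = a \<odot>\<^bsub>S\<^esub> tensor_lift K S (\<lambda>m n. \<psi> m n p) x"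
      using x
    proof (induction rule: MN.tensor_induct)
      case (add x y)
      note c = linear_closed[OF lin, OF _ add(1)] linear_closed[OF lin, OF _ add(2)]
      show ?case
        using p a add(3,4) c by (simp add: linear_add[OF lin, OF _ add(1,2)] S.smult_r_distr del: tensor_sel)
    qed (use p a in \<open>simp add: val linear_smult[OF right]\<close>)
  qed (use linear_closed[OF lin] linear_add[OF lin] linear_smult[OF lin] in \<open>simp_all del: tensor_sel\<close>)
qed

text \<open>The product of a tensor algebra is a lift nested in a lift. For frozen \<open>y\<close>
  the inner lift is bilinear in \<open>m\<close> and \<open>n\<close> by
  \<open>lift_param_bilinear\<close> with one of them as parameter; a further use of that lemma
  varies \<open>x\<close> and \<open>y\<close>.\<close>

lemma
  assumes "two_modules K M N" "two_modules K M' N'" "module K S"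
    and left: "\<And>m' n'. m' \<in> carrier M' \<Longrightarrow> n' \<in> carrier N' \<Longrightarrow>
      (\<lambda>m n. \<psi> m n m' n') \<in> bilinear_maps K M N S"
    and right: "\<And>m n. m \<in> carrier M \<Longrightarrow> n \<in> carrier N \<Longrightarrow> \<psi> m n \<in> bilinear_maps K M' N' S"
  shows double_lift_bilinear: "(\<lambda>x y. tensor_lift K S (\<lambda>m n. tensor_lift K S (\<psi> m n) y) x)
      \<in> bilinear_maps K (tensor K M N) (tensor K M' N') S" (is ?bil)
    and double_lift_tens: "m \<in> carrier M \<Longrightarrow> n \<in> carrier N \<Longrightarrow> m' \<in> carrier M' \<Longrightarrow> n' \<in> carrier N' \<Longrightarrow>
      tensor_lift K S (\<lambda>m n. tensor_lift K S (\<psi> m n) (tens K M' N' m' n')) (tens K M N m n) = \<psi> m n m' n'"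
proof -
  interpret MN: two_modules K M N by fact
  interpret MN': two_modules K M' N' by fact
  have l: "(\<lambda>m n. tensor_lift K S (\<psi> m n) y) \<in> bilinear_maps K M N S" if y: "y \<in> carrier MN'.T" for y
    unfolding bilinear_maps_def
  proof (intro CollectI conjI ballI)
    fix m assume m: "m \<in> carrier M"
    have "(\<lambda>y n. tensor_lift K S (\<lambda>m' n'. \<psi> m n m' n') y) \<in> bilinear_maps K (tensor K M' N') N S"
      by (rule lift_param_bilinear[OF assms(2) MN.N.module_axioms assms(3)])
        (use right bilinear_right[OF left] m in auto)
    from bilinear_right[OF this y] show "(\<lambda>n. tensor_lift K S (\<psi> m n) y) \<in> linear_maps K N S" by simp
  next
    fix n assume n: "n \<in> carrier N"
    have "(\<lambda>y m. tensor_lift K S (\<lambda>m' n'. \<psi> m n m' n') y) \<in> bilinear_maps K (tensor K M' N') M S"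
      by (rule lift_param_bilinear[OF assms(2) MN.M.module_axioms assms(3)])
        (use right bilinear_left[OF left] n in auto)
    from bilinear_right[OF this y] show "(\<lambda>m. tensor_lift K S (\<psi> m n) y) \<in> linear_maps K M S" by simp
  qed
  show ?bil
    by (rule lift_param_bilinear[OF assms(1) MN'.tensor_module assms(3) l MN'.tensor_lift_linear[OF assms(3) right]])
  assume m: "m \<in> carrier M" "n \<in> carrier N" "m' \<in> carrier M'" "n' \<in> carrier N'"
  then show "tensor_lift K S (\<lambda>m n. tensor_lift K S (\<psi> m n) (tens K M' N' m' n')) (tens K M N m n) = \<psi> m n m' n'"
    using MN.tensor_lift_tens[OF assms(3) l] MN'.tensor_lift_tens[OF assms(3) right]
      MN'.tens_closed[OF m(3,4)] by (simp del: tensor_sel)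
qed

section \<open>Tensor products of algebras\<close>

lemma (in k_algebra) mult_bilinear: "mult A \<in> bilinear_maps K A A A"
  by (rule bilinearI) (auto simp: alg.l_distr alg.r_distr smult_mult_left smult_mult_right)

locale two_algebras = A: k_algebra K A + B: k_algebra K B
  for K :: "('k, 'y) ring_scheme" (structure)
    and A :: "('k, 'a, 'u) module_scheme" (structure)
    and B :: "('k, 'b, 'v) module_scheme" (structure)

sublocale two_algebras \<subseteq> two_modules K A B
  by unfold_locales

context two_algebras
begin

notation tensor_elt (infixl \<open>\<star>\<close> 72)

lemma
  shows tensor_mult_bilinear: "mult T \<in> bilinear_maps K T T T"
    and tensor_mult_tens: "a \<in> carrier A \<Longrightarrow> b \<in> carrier B \<Longrightarrow> a' \<in> carrier A \<Longrightarrow> b' \<in> carrier B \<Longrightarrow>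
      a \<star> b \<otimes>\<^bsub>T\<^esub> a' \<star> b' = (a \<otimes>\<^bsub>A\<^esub> a') \<star> (b \<otimes>\<^bsub>B\<^esub> b')"
proof -
  \<comment> \<open>The product is built from lifts into the bare quotient, the record before its
    fields \<open>mult\<close> and \<open>one\<close> are filled in; \<open>?Q\<close> and
    \<open>T\<close> have the same linear structure.\<close>
  let ?Q = "quotient_space (tensor_free K A B) (tensor_null K A B)"
  have Q: "module K ?Q" by (rule quotient_module[OF F_module tnull_submodule])
  have eq: "bilinear_maps K M N ?Q = bilinear_maps K M N T" for M N
    by (simp add: bilinear_maps_def linear_maps_def)
  have m: "mult T = (\<lambda>X Y. tensor_lift K ?Q (\<lambda>m n. tensor_lift K ?Q
      (\<lambda>m' n'. (m \<otimes>\<^bsub>A\<^esub> m') \<star> (n \<otimes>\<^bsub>B\<^esub> n')) Y) X)"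
    by (simp add: tensor_def Let_def quotient_space_def)
  have l: "(\<lambda>m n. (m \<otimes>\<^bsub>A\<^esub> m') \<star> (n \<otimes>\<^bsub>B\<^esub> n')) \<in> bilinear_maps K A B ?Q"
    if "m' \<in> carrier A" "n' \<in> carrier B" for m' n'
    unfolding eq using bilinear_comp[OF tens_bilinear bilinear_left[OF A.mult_bilinear that(1)]
      bilinear_left[OF B.mult_bilinear that(2)] linear_id] by simp
  have r: "(\<lambda>m' n'. (m \<otimes>\<^bsub>A\<^esub> m') \<star> (n \<otimes>\<^bsub>B\<^esub> n')) \<in> bilinear_maps K A B ?Q"
    if "m \<in> carrier A" "n \<in> carrier B" for m n
    unfolding eq using bilinear_comp[OF tens_bilinear bilinear_right[OF A.mult_bilinear that(1)]
      bilinear_right[OF B.mult_bilinear that(2)] linear_id] by simp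
  show "mult T \<in> bilinear_maps K T T T"
    unfolding m eq[symmetric]
    by (rule double_lift_bilinear[OF two_modules_axioms two_modules_axioms Q l r])
  show "a \<in> carrier A \<Longrightarrow> b \<in> carrier B \<Longrightarrow> a' \<in> carrier A \<Longrightarrow> b' \<in> carrier B \<Longrightarrow>
      a \<star> b \<otimes>\<^bsub>T\<^esub> a' \<star> b' = (a \<otimes>\<^bsub>A\<^esub> a') \<star> (b \<otimes>\<^bsub>B\<^esub> b')"
    unfolding m by (rule double_lift_tens[OF two_modules_axioms two_modules_axioms Q l r])
qed

lemmas tmult_closed = bilinear_closed[OF tensor_mult_bilinear]
  and tmult_add_left = bilinear_add_left[OF tensor_mult_bilinear]
  and tmult_add_right = bilinear_add_right[OF tensor_mult_bilinear]
  and tmult_smult_left = bilinear_smult_left[OF tensor_mult_bilinear]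
  and tmult_smult_right = bilinear_smult_right[OF tensor_mult_bilinear]

text \<open>Both sides are additive in each of the three factors, whence three nested inductions
  down to pure tensors.\<close>

lemma tmult_assoc:
  assumes "x \<in> carrier T" "y \<in> carrier T" "z \<in> carrier T"
  shows "x \<otimes>\<^bsub>T\<^esub> y \<otimes>\<^bsub>T\<^esub> z = x \<otimes>\<^bsub>T\<^esub> (y \<otimes>\<^bsub>T\<^esub> z)"
  using assms(1)
proof (induction rule: tensor_induct)
  case (tens a b)
  show ?case using assms(2)
  proof (induction rule: tensor_induct)
    case (tens a' b')
    show ?case using assms(3)
    proof (induction rule: tensor_induct)
      case (tens a'' b'')
      show ?case
        using \<open>a \<in> _\<close> \<open>b \<in> _\<close> \<open>a' \<in> _\<close> \<open>b' \<in> _\<close> tens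
        by (simp del: tensor_sel add: tensor_mult_tens A.alg.m_assoc B.alg.m_assoc)
    qed (simp del: tensor_sel add: \<open>a \<in> _\<close> \<open>b \<in> _\<close> \<open>a' \<in> _\<close> \<open>b' \<in> _\<close> tmult_add_right tmult_closed tens_closed)
  qed (simp del: tensor_sel add: assms \<open>a \<in> _\<close> \<open>b \<in> _\<close> tmult_add_right tmult_add_left tmult_closed tens_closed)
qed (simp del: tensor_sel add: assms tmult_add_left tmult_closed tens_closed)

lemma tensor_k_algebra: "k_algebra K T"
proof (intro k_algebra.intro tensor_module k_algebra_axioms.intro ringI monoidI)
  have one: "\<one>\<^bsub>T\<^esub> \<in> carrier T"
    using tens_closed[OF A.alg.one_closed B.alg.one_closed] by simp
  then show "\<one>\<^bsub>T\<^esub> \<in> carrier T" .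
  fix x assume x: "x \<in> carrier T"
  show "\<one>\<^bsub>T\<^esub> \<otimes>\<^bsub>T\<^esub> x = x" using x
  proof (induction rule: tensor_induct)
    case (add x y)
    then show ?case using tmult_add_right[OF one add(1,2)] by simp
  qed (simp add: tensor_mult_tens del: tensor_sel(1-4))
  show "x \<otimes>\<^bsub>T\<^esub> \<one>\<^bsub>T\<^esub> = x" using x
  proof (induction rule: tensor_induct)
    case (add x y)
    then show ?case using tmult_add_left[OF add(1,2) one] by simp
  qed (simp add: tensor_mult_tens del: tensor_sel(1-4))
qed (intro A.base.field_axioms T.abelian_group_axioms tmult_closed tmult_assoc tmult_add_left
  tmult_add_right tmult_smult_left tmult_smult_right; assumption)+

sublocale T: k_algebra K T
  by (rule tensor_k_algebra)

end

section \<open>Modules over the enveloping algebra\<close>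

text \<open>An interface met by the regular module of an algebra over the enveloping algebra and
  again by every product \<open>M \<diamondop> N\<close>, so that iterated products are
  covered.\<close>

locale env_mod = module K M
  for K :: "('k, 'y) ring_scheme" (structure)
    and R :: "('k, 'r) module"
    and M :: "('k, 'm, 'r) env_module" (structure) +
  assumes act_linear: "r \<in> carrier R \<Longrightarrow> act M r \<in> linear_maps K M M"
    and bact_linear: "r \<in> carrier R \<Longrightarrow> bact M r \<in> linear_maps K M M"
    and act_bact: "r \<in> carrier R \<Longrightarrow> s \<in> carrier R \<Longrightarrow> m \<in> carrier M \<Longrightarrow>
      act M r (bact M s m) = bact M s (act M r m)"
begin

lemma act_closed [simp, intro]: "r \<in> carrier R \<Longrightarrow> m \<in> carrier M \<Longrightarrow> act M r m \<in> carrier M"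
  by (rule linear_closed[OF act_linear])

lemma bact_closed [simp, intro]: "r \<in> carrier R \<Longrightarrow> m \<in> carrier M \<Longrightarrow> bact M r m \<in> carrier M"
  by (rule linear_closed[OF bact_linear])

end

definition balanced_maps ::
    "('k, 'y) ring_scheme \<Rightarrow> ('k, 'r) module \<Rightarrow> ('k, 'm, 'r) env_module \<Rightarrow> ('k, 'n, 'r) env_module \<Rightarrow>
      ('k, 't, 'w) module_scheme \<Rightarrow> ('m \<Rightarrow> 'n \<Rightarrow> 't) set"
  where "balanced_maps K R M N S = {\<phi> \<in> bilinear_maps K M N S.
    \<forall>r\<in>carrier R. \<forall>m\<in>carrier M. \<forall>n\<in>carrier N. \<phi> (bact M r m) n = \<phi> m (act N r n)}"

lemma balancedD:
  assumes "\<phi> \<in> balanced_maps K R M N S"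
  shows "\<phi> \<in> bilinear_maps K M N S"
    and "r \<in> carrier R \<Longrightarrow> m \<in> carrier M \<Longrightarrow> n \<in> carrier N \<Longrightarrow> \<phi> (bact M r m) n = \<phi> m (act N r n)"
  using assms by (auto simp: balanced_maps_def)

lemma balancedI:
  assumes "\<phi> \<in> bilinear_maps K M N S"
    and "\<And>r m n. r \<in> carrier R \<Longrightarrow> m \<in> carrier M \<Longrightarrow> n \<in> carrier N \<Longrightarrow> \<phi> (bact M r m) n = \<phi> m (act N r n)"
  shows "\<phi> \<in> balanced_maps K R M N S"
  using assms by (auto simp: balanced_maps_def)

lemma diamond_sel [simp]:
  "zero (diamond K R M N) = zero (quotient_space (tensor K M N) (diamond_null K R M N))"
  "add (diamond K R M N) = add (quotient_space (tensor K M N) (diamond_null K R M N))"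
  "smult (diamond K R M N) = smult (quotient_space (tensor K M N) (diamond_null K R M N))"
  "carrier (diamond K R M N) = carrier (quotient_space (tensor K M N) (diamond_null K R M N))"
  "act (diamond K R M N) r = diamond_lift K (quotient_space (tensor K M N) (diamond_null K R M N))
    (\<lambda>m n. dtens K R M N (act M r m) n)"
  "bact (diamond K R M N) r = diamond_lift K (quotient_space (tensor K M N) (diamond_null K R M N))
    (\<lambda>m n. dtens K R M N m (bact N r n))"
  by (auto simp: diamond_def Let_def quotient_space_def module.defs env_module.defs)

locale two_env = M: env_mod K R M + N: env_mod K R N
  for K :: "('k, 'y) ring_scheme" (structure)
    and R :: "('k, 'r) module"
    and M :: "('k, 'm, 'r) env_module" (structure)
    and N :: "('k, 'n, 'r) env_module" (structure)

sublocale two_env \<subseteq> two_modules K M N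
  by unfold_locales

context two_env
begin

notation tensor_elt (infixl \<open>\<star>\<close> 72)
abbreviation "dnull \<equiv> diamond_null K R M N"
abbreviation "D \<equiv> diamond K R M N"
abbreviation "dproj \<equiv> diamond_proj K R M N"
abbreviation dtensor_elt :: "'m \<Rightarrow> 'n \<Rightarrow> ('m \<times> 'n \<Rightarrow> 'k) set set" (infixl \<open>\<diamondop>\<close> 72)
  where "m \<diamondop> n \<equiv> dtens K R M N m n"

lemma dnull_gens_closed:
  "{bact M r m \<star> n \<ominus>\<^bsub>T\<^esub> m \<star> act N r n |r m n. r \<in> carrier R \<and> m \<in> carrier M \<and> n \<in> carrier N} \<subseteq> carrier T"
  by (intro subsetI; elim CollectE exE conjE; hypsubst;
      intro T.M.minus_closed tens_closed M.bact_closed N.act_closed; assumption)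

lemma dnull_submodule: "submodule dnull K T"
  unfolding diamond_null_def by (rule lin_span_submodule[OF tensor_module dnull_gens_closed])

lemma quot_module: "module K (quotient_space T dnull)"
  by (rule quotient_module[OF tensor_module dnull_submodule])

lemma diamond_module: "module K D"
  by (rule module_cong[OF quot_module]) (auto simp del: quotient_sel)

sublocale D: module K D
  by (rule diamond_module)

text \<open>In \<open>diamond\<close> the actions are lifts into the quotient record without action
  fields. These equalities let facts about that record be read as facts about
  \<open>D\<close>.\<close>

lemma linear_maps_quot:
  "linear_maps K S (quotient_space T dnull) = linear_maps K S D"
  "linear_maps K (quotient_space T dnull) S = linear_maps K D S"
  by (simp_all add: linear_maps_def del: quotient_sel tensor_sel)

lemma bilinear_maps_quot:
  "bilinear_maps K A B (quotient_space T dnull) = bilinear_maps K A B D"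
  by (simp add: bilinear_maps_def linear_maps_quot)

lemma balanced_maps_quot:
  "balanced_maps K R A B (quotient_space T dnull) = balanced_maps K R A B D"
  by (simp add: balanced_maps_def bilinear_maps_quot)

lemma dproj_linear: "dproj \<in> linear_maps K T D"
  unfolding diamond_proj_def using coset_map_linear[OF tensor_module dnull_submodule]
  by (simp add: linear_maps_quot)

lemma dproj_surj:
  assumes "x \<in> carrier D"
  obtains t where "t \<in> carrier T" "x = dproj t"
  using assms coset_map_surj[of T dnull] by (auto simp: diamond_proj_def simp del: quotient_sel tensor_sel)

lemma dproj_eq_iff: "s \<in> carrier T \<Longrightarrow> t \<in> carrier T \<Longrightarrow> dproj s = dproj t \<longleftrightarrow> s \<ominus>\<^bsub>T\<^esub> t \<in> dnull"
  unfolding diamond_proj_def by (rule coset_eq_iff[OF tensor_module dnull_submodule])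

lemma dtens_balanced: "dtens K R M N \<in> balanced_maps K R M N D"
proof (rule balancedI)
  have "(\<lambda>m n. dproj (m \<star> n)) \<in> bilinear_maps K M N D"
    by (rule bilinear_comp_out[OF tens_bilinear dproj_linear])
  then show "dtens K R M N \<in> bilinear_maps K M N D"
    by (simp add: dtens_def[abs_def])
  fix r m n assume c: "r \<in> carrier R" "m \<in> carrier M" "n \<in> carrier N"
  have "dproj (bact M r m \<star> n) = dproj (m \<star> act N r n)"
    unfolding dproj_eq_iff[OF tens_closed[OF M.bact_closed[OF c(1,2)] c(3)]
      tens_closed[OF c(2) N.act_closed[OF c(1,3)]]] diamond_null_def
    by (rule subsetD[OF lin_span_superset]) (use c in blast)
  then show "bact M r m \<diamondop> n = m \<diamondop> act N r n"
    by (simp add: dtens_def)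
qed

lemmas dtens_bilinear = balancedD(1)[OF dtens_balanced]
  and dtens_bal = balancedD(2)[OF dtens_balanced]
lemmas dtens_closed = bilinear_closed[OF dtens_bilinear]

lemma diamond_induct [consumes 1, case_names dtens add]:
  assumes "x \<in> carrier D"
    and dtens: "\<And>m n. m \<in> carrier M \<Longrightarrow> n \<in> carrier N \<Longrightarrow> P (m \<diamondop> n)"
    and add: "\<And>x y. x \<in> carrier D \<Longrightarrow> y \<in> carrier D \<Longrightarrow> P x \<Longrightarrow> P y \<Longrightarrow> P (x \<oplus>\<^bsub>D\<^esub> y)"
  shows "P x"
proof -
  have "P (dproj t)" if "t \<in> carrier T" for t
    using that
  proof (induction rule: tensor_induct)
    case (tens m n)
    then show ?case using dtens by (simp add: dtens_def)
  next
    case (add x y)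
    then show ?case
      using assms(3)[OF linear_closed[OF dproj_linear] linear_closed[OF dproj_linear]]
      by (simp only: linear_add[OF dproj_linear])
  qed
  then show ?thesis using assms(1) by (elim dproj_surj) simp
qed

context
  fixes S :: "('k, 's, 'w) module_scheme" and \<phi>
  assumes S: "module K S" and \<phi>: "\<phi> \<in> balanced_maps K R M N S"
begin

lemma tensor_lift_dnull: "t \<in> dnull \<Longrightarrow> tensor_lift K S \<phi> t = \<zero>\<^bsub>S\<^esub>"
proof -
  interpret S: module K S by (rule S)
  note \<phi>b = balancedD(1)[OF \<phi>]
  note lin = tensor_lift_linear[OF S \<phi>b]
  have zero: "x \<ominus>\<^bsub>S\<^esub> x = \<zero>\<^bsub>S\<^esub>" if "x \<in> carrier S" for x
    using that by (simp add: a_minus_def S.M.r_neg)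
  show "t \<in> dnull \<Longrightarrow> tensor_lift K S \<phi> t = \<zero>\<^bsub>S\<^esub>"
    unfolding diamond_null_def
    by (erule lin_span_zero[OF tensor_module S lin dnull_gens_closed, rotated -1];
        elim CollectE exE conjE; hypsubst)
      (simp only: linear_minus[OF lin tensor_module S] tens_closed M.bact_closed N.act_closed
        tensor_lift_tens[OF S \<phi>b] balancedD(2)[OF \<phi>] zero bilinear_closed[OF \<phi>b])
qed

lemma diamond_lift_proj: "t \<in> carrier T \<Longrightarrow> diamond_lift K S \<phi> (dproj t) = tensor_lift K S \<phi> t"
  unfolding diamond_lift_def diamond_proj_def
  by (rule the_elem_coset[OF tensor_module dnull_submodule S tensor_lift_linear[OF S balancedD(1)[OF \<phi>]]
        tensor_lift_dnull])

lemma diamond_lift_dtens: "m \<in> carrier M \<Longrightarrow> n \<in> carrier N \<Longrightarrow> diamond_lift K S \<phi> (m \<diamondop> n) = \<phi> m n"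
  unfolding dtens_def using diamond_lift_proj tensor_lift_tens[OF S balancedD(1)[OF \<phi>]] tens_closed by metis

lemma diamond_lift_linear: "diamond_lift K S \<phi> \<in> linear_maps K D S"
proof (rule linear_mapsI)
  note lin = tensor_lift_linear[OF S balancedD(1)[OF \<phi>]]
  fix x assume x: "x \<in> carrier D"
  then obtain f where f: "f \<in> carrier T" "x = dproj f" by (elim dproj_surj)
  then show "diamond_lift K S \<phi> x \<in> carrier S"
    using linear_closed[OF lin f(1)] by (simp add: diamond_lift_proj)
  fix a assume a: "a \<in> carrier K"
  show "diamond_lift K S \<phi> (a \<odot>\<^bsub>D\<^esub> x) = a \<odot>\<^bsub>S\<^esub> diamond_lift K S \<phi> x"
    unfolding f(2) linear_smult[OF dproj_linear a f(1), symmetric]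
    by (simp only: diamond_lift_proj T.smult_closed[OF a f(1)] f(1) linear_smult[OF lin a f(1)])
next
  note lin = tensor_lift_linear[OF S balancedD(1)[OF \<phi>]]
  fix x y assume x: "x \<in> carrier D" and y: "y \<in> carrier D"
  from x obtain f where f: "f \<in> carrier T" "x = dproj f" by (elim dproj_surj)
  from y obtain g where g: "g \<in> carrier T" "y = dproj g" by (elim dproj_surj)
  show "diamond_lift K S \<phi> (x \<oplus>\<^bsub>D\<^esub> y) = diamond_lift K S \<phi> x \<oplus>\<^bsub>S\<^esub> diamond_lift K S \<phi> y"
    unfolding f(2) g(2) linear_add[OF dproj_linear f(1) g(1), symmetric]
    by (simp only: diamond_lift_proj T.M.a_closed[OF f(1) g(1)] f(1) g(1) linear_add[OF lin f(1) g(1)])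
qed

end

lemma linear_diamond_eqI:
  assumes "f \<in> linear_maps K D S" "g \<in> linear_maps K D S" "x \<in> carrier D"
    and "\<And>m n. m \<in> carrier M \<Longrightarrow> n \<in> carrier N \<Longrightarrow> f (m \<diamondop> n) = g (m \<diamondop> n)"
  shows "f x = g x"
  using assms(3)
proof (induction rule: diamond_induct)
  case (add x y)
  then show ?case by (simp only: linear_add[OF assms(1)] linear_add[OF assms(2)])
qed (rule assms(4))

text \<open>The relations use the bar action on \<open>M\<close> and the plain action on
  \<open>N\<close>. The operators applied here are the other two, and on each module the two actions
  commute.\<close>

lemma dtens_act_balanced:
  assumes "r \<in> carrier R"
  shows "(\<lambda>m n. act M r m \<diamondop> n) \<in> balanced_maps K R M N D"
    and "(\<lambda>m n. m \<diamondop> bact N r n) \<in> balanced_maps K R M N D"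
  using bilinear_comp[OF dtens_bilinear M.act_linear[OF assms] linear_id linear_id]
    bilinear_comp[OF dtens_bilinear linear_id N.bact_linear[OF assms] linear_id] assms
  by (auto intro!: balancedI simp: M.act_bact dtens_bal N.act_bact[symmetric])

lemma diamond_act_eq:
  assumes "r \<in> carrier R"
  shows "act D r = diamond_lift K (quotient_space T dnull) (\<lambda>m n. act M r m \<diamondop> n)"
    and "bact D r = diamond_lift K (quotient_space T dnull) (\<lambda>m n. m \<diamondop> bact N r n)"
  by simp_all

lemma
  assumes "r \<in> carrier R"
  shows diamond_act_linear: "act D r \<in> linear_maps K D D"
    and diamond_bact_linear: "bact D r \<in> linear_maps K D D"
    and diamond_act_dtens: "m \<in> carrier M \<Longrightarrow> n \<in> carrier N \<Longrightarrow> act D r (m \<diamondop> n) = act M r m \<diamondop> n"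
    and diamond_bact_dtens: "m \<in> carrier M \<Longrightarrow> n \<in> carrier N \<Longrightarrow> bact D r (m \<diamondop> n) = m \<diamondop> bact N r n"
  unfolding diamond_act_eq[OF assms]
  using diamond_lift_linear[OF quot_module, unfolded balanced_maps_quot linear_maps_quot, OF dtens_act_balanced(1)[OF assms]]
    diamond_lift_linear[OF quot_module, unfolded balanced_maps_quot linear_maps_quot, OF dtens_act_balanced(2)[OF assms]]
    diamond_lift_dtens[OF quot_module, unfolded balanced_maps_quot, OF dtens_act_balanced(1)[OF assms]]
    diamond_lift_dtens[OF quot_module, unfolded balanced_maps_quot, OF dtens_act_balanced(2)[OF assms]]
  by auto

lemma diamond_env_mod: "env_mod K R D"
proof (intro env_mod.intro env_mod_axioms.intro diamond_module diamond_act_linear diamond_bact_linear)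
  fix r s x assume c: "r \<in> carrier R" "s \<in> carrier R" "x \<in> carrier D"
  note a = diamond_act_linear[OF c(1)] and b = diamond_bact_linear[OF c(2)]
  show "act D r (bact D s x) = bact D s (act D r x)"
    by (rule linear_diamond_eqI[OF linear_maps_comp[OF b a] linear_maps_comp[OF a b] c(3)])
      (simp only: diamond_act_dtens diamond_bact_dtens c M.act_closed N.bact_closed)
qed

sublocale D: env_mod K R D
  by (rule diamond_env_mod)

end

text \<open>On \<open>M \<diamondop> N\<close> the bar of \<open>r\<close> acts through
  \<open>N\<close>; hence \<open>bal\<close> relates \<open>N\<close> and \<open>P\<close>, while
  \<open>left\<close> takes care of the relations between \<open>M\<close> and
  \<open>N\<close>.\<close>

lemma diamond_lift_param_balanced:
  assumes "two_env K R M N" "env_mod K R P" "module K S"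
    and left: "\<And>p. p \<in> carrier P \<Longrightarrow> (\<lambda>m n. \<psi> m n p) \<in> balanced_maps K R M N S"
    and right: "\<And>m n. m \<in> carrier M \<Longrightarrow> n \<in> carrier N \<Longrightarrow> \<psi> m n \<in> linear_maps K P S"
    and bal: "\<And>r m n p. r \<in> carrier R \<Longrightarrow> m \<in> carrier M \<Longrightarrow> n \<in> carrier N \<Longrightarrow> p \<in> carrier P \<Longrightarrow>
      \<psi> m (bact N r n) p = \<psi> m n (act P r p)"
  shows "(\<lambda>x p. diamond_lift K S (\<lambda>m n. \<psi> m n p) x) \<in> balanced_maps K R (diamond K R M N) P S"
proof -
  interpret MN: two_env K R M N by fact
  interpret P: env_mod K R P by fact
  interpret S: module K S by fact
  note lin = MN.diamond_lift_linear[OF assms(3) left]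
  note val = MN.diamond_lift_dtens[OF assms(3) left]
  have bil: "(\<lambda>x p. tensor_lift K S (\<lambda>m n. \<psi> m n p) x) \<in> bilinear_maps K (tensor K M N) P S"
    by (rule lift_param_bilinear[OF MN.two_modules_axioms P.module_axioms assms(3) balancedD(1)[OF left] right])
  show ?thesis
  proof (rule balancedI)
    show "(\<lambda>x p. diamond_lift K S (\<lambda>m n. \<psi> m n p) x) \<in> bilinear_maps K (diamond K R M N) P S"
      unfolding bilinear_maps_def
    proof (intro CollectI conjI ballI lin)
      fix x assume "x \<in> carrier MN.D"
      then obtain t where t: "t \<in> carrier MN.T" "x = MN.dproj t" by (elim MN.dproj_surj)
      \<comment> \<open>One representative \<open>t\<close> serves for all \<open>p\<close>, so
        linearity in \<open>p\<close> is inherited from the lift on the tensor product.\<close>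
      have e: "diamond_lift K S (\<lambda>m n. \<psi> m n p) x = tensor_lift K S (\<lambda>m n. \<psi> m n p) t" if "p \<in> carrier P" for p
        unfolding t(2) by (rule MN.diamond_lift_proj[OF assms(3) left[OF that] t(1)])
      show "(\<lambda>p. diamond_lift K S (\<lambda>m n. \<psi> m n p) x) \<in> linear_maps K P S"
        using bilinear_right[OF bil t(1)] by (auto simp: linear_maps_def e)
    qed
  next
    fix r x p assume c: "r \<in> carrier R" "x \<in> carrier MN.D" "p \<in> carrier P"
    show "diamond_lift K S (\<lambda>m n. \<psi> m n p) (bact MN.D r x) = diamond_lift K S (\<lambda>m n. \<psi> m n (act P r p)) x"
      by (rule MN.linear_diamond_eqI[OF linear_maps_comp[OF MN.diamond_bact_linear[OF c(1)] lin[OF c(3)]]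
          lin[OF P.act_closed[OF c(1,3)]] c(2)])
        (simp only: MN.diamond_bact_dtens c val MN.N.bact_closed P.act_closed bal)
  qed
qed

section \<open>Associativity of tensor and diamond products\<close>

lemma
  assumes "module K M" "module K N" "module K P"
  shows tensor_assoc_linear: "tensor_assoc K M N P \<in>
      linear_maps K (tensor K (tensor K M N) P) (tensor K M (tensor K N P))"
    and tensor_assoc_tens: "m \<in> carrier M \<Longrightarrow> n \<in> carrier N \<Longrightarrow> p \<in> carrier P \<Longrightarrow>
      tensor_assoc K M N P (tens K (tensor K M N) P (tens K M N m n) p) =
        tens K M (tensor K N P) m (tens K N P n p)"
proof -
  interpret MN: two_modules K M N by (intro two_modules.intro assms)
  interpret NP: two_modules K N P by (intro two_modules.intro assms)
  interpret X: two_modules K MN.T P by (intro two_modules.intro assms MN.tensor_module)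
  interpret Y: two_modules K M NP.T by (intro two_modules.intro assms NP.tensor_module)
  have l: "(\<lambda>m n. tens K M (tensor K N P) m (tens K N P n p)) \<in> bilinear_maps K M N Y.T"
    if "p \<in> carrier P" for p
    using bilinear_comp[OF Y.tens_bilinear linear_id bilinear_left[OF NP.tens_bilinear that] linear_id] by simp
  have r: "(\<lambda>p. tens K M (tensor K N P) m (tens K N P n p)) \<in> linear_maps K P Y.T"
    if "m \<in> carrier M" "n \<in> carrier N" for m n
    by (rule linear_maps_comp[OF bilinear_right[OF NP.tens_bilinear that(2)] bilinear_right[OF Y.tens_bilinear that(1)]])
  note bil = lift_param_bilinear[OF MN.two_modules_axioms assms(3) Y.tensor_module l r]
  show "tensor_assoc K M N P \<in> linear_maps K X.T Y.T"
    unfolding tensor_assoc_def Let_def by (rule X.tensor_lift_linear[OF Y.tensor_module bil])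
  assume c: "m \<in> carrier M" "n \<in> carrier N" "p \<in> carrier P"
  show "tensor_assoc K M N P (tens K (tensor K M N) P (tens K M N m n) p) =
        tens K M (tensor K N P) m (tens K N P n p)"
    unfolding tensor_assoc_def Let_def
    by (simp only: X.tensor_lift_tens[OF Y.tensor_module bil] MN.tens_closed c
        MN.tensor_lift_tens[OF Y.tensor_module l])
qed

text \<open>The relation between \<open>M\<close> and \<open>N\<close> survives because
  \<open>r\<close> acts on \<open>N \<diamondop> P\<close> through \<open>N\<close>; the relation
  between \<open>N\<close> and \<open>P\<close> is already divided out in
  \<open>N \<diamondop> P\<close>.\<close>

lemma
  assumes "env_mod K R M" "env_mod K R N" "env_mod K R P"
  shows diamond_assoc_linear: "diamond_assoc K R M N P \<in>
      linear_maps K (diamond K R (diamond K R M N) P) (diamond K R M (diamond K R N P))"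
    and diamond_assoc_dtens: "m \<in> carrier M \<Longrightarrow> n \<in> carrier N \<Longrightarrow> p \<in> carrier P \<Longrightarrow>
      diamond_assoc K R M N P (dtens K R (diamond K R M N) P (dtens K R M N m n) p) =
        dtens K R M (diamond K R N P) m (dtens K R N P n p)"
proof -
  interpret MN: two_env K R M N by (intro two_env.intro assms)
  interpret NP: two_env K R N P by (intro two_env.intro assms)
  interpret X: two_env K R MN.D P by (intro two_env.intro assms MN.diamond_env_mod)
  interpret Y: two_env K R M NP.D by (intro two_env.intro assms NP.diamond_env_mod)
  let ?\<psi> = "\<lambda>m n p. dtens K R M NP.D m (dtens K R N P n p)"
  have l: "(\<lambda>m n. ?\<psi> m n p) \<in> balanced_maps K R M N Y.D"
    if p: "p \<in> carrier P" for p
  proof (rule balancedI)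
    show "(\<lambda>m n. ?\<psi> m n p) \<in> bilinear_maps K M N Y.D"
      using bilinear_comp[OF Y.dtens_bilinear linear_id bilinear_left[OF NP.dtens_bilinear p] linear_id] by simp
  qed (simp only: Y.dtens_bal NP.diamond_act_dtens NP.dtens_closed p)
  have r: "?\<psi> m n \<in> linear_maps K P Y.D"
    if "m \<in> carrier M" "n \<in> carrier N" for m n
    by (rule linear_maps_comp[OF bilinear_right[OF NP.dtens_bilinear that(2)] bilinear_right[OF Y.dtens_bilinear that(1)]])
  have bal: "?\<psi> m (bact N r n) p = ?\<psi> m n (act P r p)"
    if "r \<in> carrier R" "m \<in> carrier M" "n \<in> carrier N" "p \<in> carrier P" for r m n p
    using that by (simp only: NP.dtens_bal)
  note bil = diamond_lift_param_balanced[OF MN.two_env_axioms assms(3) Y.diamond_module l r bal]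
  show "diamond_assoc K R M N P \<in> linear_maps K X.D Y.D"
    unfolding diamond_assoc_def Let_def by (rule X.diamond_lift_linear[OF Y.diamond_module bil])
  assume c: "m \<in> carrier M" "n \<in> carrier N" "p \<in> carrier P"
  show "diamond_assoc K R M N P (dtens K R MN.D P (dtens K R M N m n) p) = ?\<psi> m n p"
    unfolding diamond_assoc_def Let_def
    by (simp only: X.diamond_lift_dtens[OF Y.diamond_module bil] MN.dtens_closed c
        MN.diamond_lift_dtens[OF Y.diamond_module l])
qed

declare tensor_sel(1-4) [simp del] diamond_sel [simp del] quotient_sel [simp del] free_sel [simp del]

lemma linear_maps_eq:
  assumes "f \<in> linear_maps K M N" "\<And>x. x \<in> carrier M \<Longrightarrow> f x = g x" "module K M"
  shows "g \<in> linear_maps K M N"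
proof -
  interpret M: module K M by fact
  show ?thesis
    using assms(1) by (auto simp: linear_maps_def assms(2)[symmetric])
qed

section \<open>Weak bialgebras\<close>

lemma base_sel [simp]:
  "carrier (base_module K) = carrier K" "zero (base_module K) = zero K"
  "add (base_module K) = add K" "smult (base_module K) = mult K"
  by (auto simp: base_module_def)

lemma base_module_module:
  assumes "cring K"
  shows "module K (base_module K)"
proof -
  interpret K: cring K by fact
  show ?thesis
    by (intro moduleI abelian_groupI)
      (use K.l_neg in \<open>auto simp: assms K.a_ac K.m_assoc K.l_distr K.r_distr\<close>)
qed

locale weak_bialg = weak_bialgebra K H \<Delta> \<epsilon>
  for K :: "('k, 'y) ring_scheme" (structure)
    and H :: "('k, 'h) module" (structure) and \<Delta> \<epsilon>

sublocale weak_bialg \<subseteq> HH: two_algebras K H H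
  by (intro two_algebras.intro k_algebra_axioms)

text \<open>\<open>H3\<close> and \<open>H4\<close> are the two bracketings of the triple tensor
  product; the axioms on \<open>\<Delta>1\<close> live in \<open>H3\<close>, while \<open>H4\<close>
  receives \<Delta> \<otimes> id.\<close>

sublocale weak_bialg \<subseteq> H3: two_algebras K H "tensor K H H"
  by (intro two_algebras.intro k_algebra_axioms HH.tensor_k_algebra)

sublocale weak_bialg \<subseteq> H4: two_algebras K "tensor K H H" H
  by (intro two_algebras.intro k_algebra_axioms HH.tensor_k_algebra)

sublocale weak_bialg \<subseteq> base_mod: module K "base_module K"
  by (rule base_module_module) (rule R.is_cring)

context weak_bialg
begin

abbreviation hmult (infixl \<open>\<cdot>\<close> 73) where "x \<cdot> y \<equiv> x \<otimes>\<^bsub>H\<^esub> y"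
abbreviation hsmult (infixr \<open>*\<^sub>H\<close> 75) where "a *\<^sub>H x \<equiv> a \<odot>\<^bsub>H\<^esub> x"
notation HH.tensor_elt (infixl \<open>\<star>\<close> 72)
abbreviation t2mult (infixl \<open>\<bullet>\<close> 71) where "x \<bullet> y \<equiv> x \<otimes>\<^bsub>HH.T\<^esub> y"
notation H3.tensor_elt (infixr \<open>\<star>\<^sub>3\<close> 70)
notation H4.tensor_elt (infixl \<open>\<star>\<^sub>4\<close> 70)
abbreviation t3mult (infixl \<open>\<bullet>\<^sub>3\<close> 69) where "x \<bullet>\<^sub>3 y \<equiv> x \<otimes>\<^bsub>H3.T\<^esub> y"
abbreviation hone (\<open>1\<^sub>H\<close>) where "1\<^sub>H \<equiv> \<one>\<^bsub>H\<^esub>"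
abbreviation (input) "HC \<equiv> carrier H"
abbreviation "\<Delta>1 \<equiv> \<Delta> \<one>\<^bsub>H\<^esub>"
text \<open>Here \<open>es\<close> is the paper's \<open>\<epsilon>'\<^sub>s\<close>, not \<open>\<epsilon>\<^sub>s\<close>.\<close>

abbreviation "et \<equiv> counit_target K H \<Delta> \<epsilon>"
abbreviation "es \<equiv> counit_source' K H \<Delta> \<epsilon>"
abbreviation "assoc \<equiv> tensor_assoc K H H H"
abbreviation "\<Delta>_id \<equiv> tensor_map K HH.T H \<Delta> id"
abbreviation "id_\<Delta> \<equiv> tensor_map K H HH.T id \<Delta>"

lemmas \<Delta>_closed [simp] = linear_closed[OF comult_linear]
  and \<Delta>_smult = linear_smult[OF comult_linear]

lemma \<epsilon>_closed [simp]: "x \<in> HC \<Longrightarrow> \<epsilon> x \<in> carrier K"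
  and \<epsilon>_add: "x \<in> HC \<Longrightarrow> y \<in> HC \<Longrightarrow> \<epsilon> (x \<oplus>\<^bsub>H\<^esub> y) = \<epsilon> x \<oplus> \<epsilon> y"
  and \<epsilon>_smult: "a \<in> carrier K \<Longrightarrow> x \<in> HC \<Longrightarrow> \<epsilon> (a *\<^sub>H x) = a \<otimes> \<epsilon> x"
  using linear_closed[OF counit_linear] linear_add[OF counit_linear] linear_smult[OF counit_linear]
  by simp_all

lemmas alg_simps = smult_mult_left smult_mult_right alg.m_assoc HH.tensor_mult_tens

section \<open>Slicing tensors with the counit\<close>

lemma slice_left_bilinear:
  assumes "module K N" "h \<in> HC"
  shows "(\<lambda>a n. \<epsilon> (a \<cdot> h) \<odot>\<^bsub>N\<^esub> n) \<in> bilinear_maps K H N N"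
proof -
  interpret N: module K N by fact
  have comm: "a \<odot>\<^bsub>N\<^esub> (b \<odot>\<^bsub>N\<^esub> n) = b \<odot>\<^bsub>N\<^esub> (a \<odot>\<^bsub>N\<^esub> n)" if "a \<in> carrier K" "b \<in> carrier K" "n \<in> carrier N" for a b n
    using that by (metis R.m_comm N.smult_assoc1)
  show ?thesis
    by (rule bilinearI) (use assms(2) in \<open>simp_all add: alg.l_distr \<epsilon>_add \<epsilon>_smult smult_mult_left
      N.smult_l_distr N.smult_r_distr N.smult_assoc1 comm\<close>)
qed

text \<open>Here and in \<open>slice_left_bilinear\<close> the module \<open>N\<close> is left open:
  it is \<open>H\<close> for slices of double tensors and H \<otimes> H for slices of triple
  tensors.\<close>

lemma slice_right_bilinear:
  assumes "module K N" "h \<in> HC"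
  shows "(\<lambda>n a. \<epsilon> (a \<cdot> h) \<odot>\<^bsub>N\<^esub> n) \<in> bilinear_maps K N H N"
  using slice_left_bilinear[OF assms] by (auto simp: bilinear_maps_def)

text \<open>These are \<epsilon>(- h) \<otimes> id and id \<otimes> \<epsilon>(- h) on all of H
  \<otimes> H. The counital maps are their values at \<open>\<Delta>1\<close>, so identities for an
  arbitrary tensor specialise to identities for counital maps.\<close>

definition "sliceL h = tensor_lift K H (\<lambda>a b. \<epsilon> (a \<cdot> h) *\<^sub>H b)"
definition "sliceR h = tensor_lift K H (\<lambda>a b. \<epsilon> (b \<cdot> h) *\<^sub>H a)"

lemmas sliceL_bil = slice_left_bilinear[OF module_axioms]
  and sliceR_bil = slice_right_bilinear[OF module_axioms]

lemma sliceL_linear: "h \<in> HC \<Longrightarrow> sliceL h \<in> linear_maps K HH.T H"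
  and sliceL_tens: "h \<in> HC \<Longrightarrow> a \<in> HC \<Longrightarrow> b \<in> HC \<Longrightarrow> sliceL h (a \<star> b) = \<epsilon> (a \<cdot> h) *\<^sub>H b"
  and sliceR_linear: "h \<in> HC \<Longrightarrow> sliceR h \<in> linear_maps K HH.T H"
  and sliceR_tens: "h \<in> HC \<Longrightarrow> a \<in> HC \<Longrightarrow> b \<in> HC \<Longrightarrow> sliceR h (a \<star> b) = \<epsilon> (b \<cdot> h) *\<^sub>H a"
  unfolding sliceL_def sliceR_def
  using HH.tensor_lift_linear[OF module_axioms sliceL_bil] HH.tensor_lift_tens[OF module_axioms sliceL_bil]
    HH.tensor_lift_linear[OF module_axioms sliceR_bil] HH.tensor_lift_tens[OF module_axioms sliceR_bil]
  by auto

lemmas sliceL_closed [simp] = linear_closed[OF sliceL_linear]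
  and sliceR_closed [simp] = linear_closed[OF sliceR_linear]

lemma et_slice: "et h = sliceL h \<Delta>1"
  by (simp add: counit_target_def sliceL_def)

lemma es_slice: "es h = sliceR h \<Delta>1"
  by (simp add: counit_source'_def sliceR_def)

lemma et_closed [simp]: "h \<in> HC \<Longrightarrow> et h \<in> HC"
  by (simp add: et_slice)

lemma es_closed [simp]: "h \<in> HC \<Longrightarrow> es h \<in> HC"
  by (simp add: es_slice)

lemma sliceL_one: "h \<in> HC \<Longrightarrow> sliceL 1\<^sub>H (\<Delta> h) = h"
proof -
  assume h: "h \<in> HC"
  have "tensor_lift K H (\<lambda>a b. \<epsilon> a *\<^sub>H b) (\<Delta> h) = sliceL 1\<^sub>H (\<Delta> h)"
    unfolding sliceL_def
    by (rule HH.tensor_lift_cong[OF module_axioms sliceL_bil]) (use h in simp_all)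
  then show ?thesis using counit_left[OF h] by simp
qed

lemma sliceR_one: "h \<in> HC \<Longrightarrow> sliceR 1\<^sub>H (\<Delta> h) = h"
proof -
  assume h: "h \<in> HC"
  have "tensor_lift K H (\<lambda>a b. \<epsilon> b *\<^sub>H a) (\<Delta> h) = sliceR 1\<^sub>H (\<Delta> h)"
    unfolding sliceR_def
    by (rule HH.tensor_lift_cong[OF module_axioms sliceR_bil]) (use h in simp_all)
  then show ?thesis using counit_right[OF h] by simp
qed

lemma tmult_left_linear: "t \<in> carrier HH.T \<Longrightarrow> (\<lambda>x. t \<bullet> x) \<in> linear_maps K HH.T HH.T"
  and tmult_right_linear: "t \<in> carrier HH.T \<Longrightarrow> (\<lambda>x. x \<bullet> t) \<in> linear_maps K HH.T HH.T"
  by (rule bilinear_right[OF HH.tensor_mult_bilinear], assumption)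
    (rule bilinear_left[OF HH.tensor_mult_bilinear])

lemma hmult_left_linear: "x \<in> HC \<Longrightarrow> (\<lambda>y. x \<cdot> y) \<in> linear_maps K H H"
  and hmult_right_linear: "x \<in> HC \<Longrightarrow> (\<lambda>y. y \<cdot> x) \<in> linear_maps K H H"
  by (rule bilinear_right[OF mult_bilinear], assumption) (rule bilinear_left[OF mult_bilinear])

text \<open>Since \<epsilon>((a x) h) = \<epsilon>(a (x h)), the factor on the sliced leg migrates
  into the index of the slice, and the other factor comes out on the right.\<close>

lemma sliceL_mult_right:
  assumes "h \<in> HC" "x \<in> HC" "y \<in> HC" "t \<in> carrier HH.T"
  shows "sliceL h (t \<bullet> (x \<star> y)) = sliceL (x \<cdot> h) t \<cdot> y"
  by (rule HH.linear_tensor_eqI[OF linear_maps_comp[OF tmult_right_linear sliceL_linear]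
    linear_maps_comp[OF sliceL_linear hmult_right_linear] assms(4)])
    (use assms in \<open>simp_all add: alg_simps sliceL_tens\<close>)

lemma sliceR_mult_right:
  assumes "h \<in> HC" "x \<in> HC" "y \<in> HC" "t \<in> carrier HH.T"
  shows "sliceR h (t \<bullet> (x \<star> y)) = sliceR (y \<cdot> h) t \<cdot> x"
  by (rule HH.linear_tensor_eqI[OF linear_maps_comp[OF tmult_right_linear sliceR_linear]
    linear_maps_comp[OF sliceR_linear hmult_right_linear] assms(4)])
    (use assms in \<open>simp_all add: alg_simps sliceR_tens\<close>)

lemma sliceR_mult_left:
  assumes "h \<in> HC" "x \<in> HC" "t \<in> carrier HH.T"
  shows "sliceR h ((x \<star> 1\<^sub>H) \<bullet> t) = x \<cdot> sliceR h t"
  by (rule HH.linear_tensor_eqI[OF linear_maps_comp[OF tmult_left_linear sliceR_linear]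
    linear_maps_comp[OF sliceR_linear hmult_left_linear] assms(3)])
    (use assms in \<open>simp_all add: alg_simps sliceR_tens\<close>)

lemma \<Delta>_\<Delta>1 [simp]: "h \<in> HC \<Longrightarrow> \<Delta> h \<bullet> \<Delta>1 = \<Delta> h"
  and \<Delta>1_\<Delta> [simp]: "h \<in> HC \<Longrightarrow> \<Delta>1 \<bullet> \<Delta> h = \<Delta> h"
  using comult_mult[of h "1\<^sub>H"] comult_mult[of "1\<^sub>H" h] by simp_all

text \<open>Weak multiplicativity of the counit with 1 in the middle: \<open>counit_mult21\<close>
  pairs the legs of \<open>\<Delta>1\<close> as \<open>et\<close> does, and
  \<open>counit_mult12\<close> as \<open>es\<close> does in \<open>eps_es\<close>.\<close>

lemma eps_et:
  assumes "f \<in> HC" "h \<in> HC"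
  shows "\<epsilon> (f \<cdot> et h) = \<epsilon> (f \<cdot> h)"
proof -
  have lin: "(\<lambda>y. \<epsilon> (f \<cdot> y)) \<in> linear_maps K H (base_module K)"
    by (rule linear_maps_comp[OF hmult_left_linear[OF assms(1)] counit_linear])
  have "\<epsilon> (f \<cdot> et h) = tensor_lift K (base_module K) (\<lambda>a b. \<epsilon> (f \<cdot> \<epsilon> (a \<cdot> h) *\<^sub>H b)) \<Delta>1"
    unfolding counit_target_def
    by (rule HH.tensor_lift_comp[OF module_axioms base_mod.module_axioms sliceL_bil lin]) (use assms in simp_all)
  also have "\<dots> = tensor_lift K (base_module K) (\<lambda>a b. \<epsilon> (f \<cdot> b) \<otimes> \<epsilon> (a \<cdot> h)) \<Delta>1"
    by (rule HH.tensor_lift_cong[OF base_mod.module_axioms HH.bilinear_cong[OF bilinear_comp_out[OF sliceL_bil[OF assms(2)] lin]], symmetric])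
      (use assms in \<open>simp_all add: smult_mult_right \<epsilon>_smult R.m_comm\<close>)
  also have "\<dots> = \<epsilon> (f \<cdot> h)"
    using counit_mult21[of f "1\<^sub>H" h] assms by simp
  finally show ?thesis .
qed

lemma eps_es:
  assumes "f \<in> HC" "h \<in> HC"
  shows "\<epsilon> (f \<cdot> es h) = \<epsilon> (f \<cdot> h)"
proof -
  have lin: "(\<lambda>y. \<epsilon> (f \<cdot> y)) \<in> linear_maps K H (base_module K)"
    by (rule linear_maps_comp[OF hmult_left_linear[OF assms(1)] counit_linear])
  have "\<epsilon> (f \<cdot> es h) = tensor_lift K (base_module K) (\<lambda>a b. \<epsilon> (f \<cdot> \<epsilon> (b \<cdot> h) *\<^sub>H a)) \<Delta>1"
    unfolding counit_source'_def
    by (rule HH.tensor_lift_comp[OF module_axioms base_mod.module_axioms sliceR_bil lin]) (use assms in simp_all)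
  also have "\<dots> = tensor_lift K (base_module K) (\<lambda>a b. \<epsilon> (f \<cdot> a) \<otimes> \<epsilon> (b \<cdot> h)) \<Delta>1"
    by (rule HH.tensor_lift_cong[OF base_mod.module_axioms HH.bilinear_cong[OF bilinear_comp_out[OF sliceR_bil[OF assms(2)] lin]], symmetric])
      (use assms in \<open>simp_all add: smult_mult_right \<epsilon>_smult R.m_comm\<close>)
  also have "\<dots> = \<epsilon> (f \<cdot> h)"
    using counit_mult12[of f "1\<^sub>H" h] assms by simp
  finally show ?thesis .
qed

section \<open>Triple tensors and the axioms on \<open>\<Delta>1\<close>\<close>

lemma tensor_map_linear_tens:
  assumes "f \<in> linear_maps K H A" "g \<in> linear_maps K H B" "two_modules K A B"
  shows "tensor_map K A B f g \<in> linear_maps K HH.T (tensor K A B)"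
    and "a \<in> HC \<Longrightarrow> b \<in> HC \<Longrightarrow> tensor_map K A B f g (a \<star> b) = tens K A B (f a) (g b)"
proof -
  interpret AB: two_modules K A B by fact
  have bil: "(\<lambda>m n. tens K A B (f m) (g n)) \<in> bilinear_maps K H H AB.T"
    using bilinear_comp[OF AB.tens_bilinear assms(1,2) linear_id] by simp
  show "tensor_map K A B f g \<in> linear_maps K HH.T (tensor K A B)"
    and "a \<in> HC \<Longrightarrow> b \<in> HC \<Longrightarrow> tensor_map K A B f g (a \<star> b) = tens K A B (f a) (g b)"
    unfolding tensor_map_def
    by (rule HH.tensor_lift_linear[OF AB.tensor_module bil])
      (rule HH.tensor_lift_tens[OF AB.tensor_module bil])
qed

lemmas id_\<Delta>_linear = tensor_map_linear_tens(1)[OF linear_id comult_linear H3.two_modules_axioms]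
  and id_\<Delta>_tens = tensor_map_linear_tens(2)[OF linear_id comult_linear H3.two_modules_axioms]
  and \<Delta>_id_linear = tensor_map_linear_tens(1)[OF comult_linear linear_id H4.two_modules_axioms]
  and \<Delta>_id_tens = tensor_map_linear_tens(2)[OF comult_linear linear_id H4.two_modules_axioms]
  and assoc_linear = tensor_assoc_linear[OF module_axioms module_axioms module_axioms]
  and assoc_tens = tensor_assoc_tens[OF module_axioms module_axioms module_axioms]

lemma assoc_one_linear: "(\<lambda>t. assoc (t \<star>\<^sub>4 1\<^sub>H)) \<in> linear_maps K HH.T H3.T"
  by (rule linear_maps_comp[OF bilinear_left[OF H4.tens_bilinear] assoc_linear]) simp

text \<open>Both factors in the axioms contain \<open>\<Delta>1\<close>. Only the copy on the first
  two legs is made variable; the copy on the last two legs stays whole as \<open>t\<close>.\<close>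

lemma tens3_linear:
  assumes "t \<in> carrier HH.T"
  shows "(\<lambda>u. assoc (u \<star>\<^sub>4 1\<^sub>H) \<bullet>\<^sub>3 (1\<^sub>H \<star>\<^sub>3 t)) \<in> linear_maps K HH.T H3.T"
    and "(\<lambda>u. (1\<^sub>H \<star>\<^sub>3 t) \<bullet>\<^sub>3 assoc (u \<star>\<^sub>4 1\<^sub>H)) \<in> linear_maps K HH.T H3.T"
  by (rule linear_maps_comp[OF assoc_one_linear bilinear_left[OF H3.tensor_mult_bilinear]], use assms in simp)
    (rule linear_maps_comp[OF assoc_one_linear bilinear_right[OF H3.tensor_mult_bilinear]], use assms in simp)

lemma tens3_tens:
  assumes "a \<in> HC" "b \<in> HC" "t \<in> carrier HH.T"
  shows "assoc (a \<star> b \<star>\<^sub>4 1\<^sub>H) \<bullet>\<^sub>3 (1\<^sub>H \<star>\<^sub>3 t) = a \<star>\<^sub>3 ((b \<star> 1\<^sub>H) \<bullet> t)"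
    and "(1\<^sub>H \<star>\<^sub>3 t) \<bullet>\<^sub>3 assoc (a \<star> b \<star>\<^sub>4 1\<^sub>H) = a \<star>\<^sub>3 (t \<bullet> (b \<star> 1\<^sub>H))"
  using assms by (simp_all add: assoc_tens H3.tensor_mult_tens)

text \<open>Apply \<open>\<epsilon>(- h) \<otimes> id \<otimes> id\<close> to the two axioms on \<open>\<Delta>(1)\<close>.\<close>

lemma et_comult:
  assumes h: "h \<in> HC"
  shows "\<Delta> (et h) = (et h \<star> 1\<^sub>H) \<bullet> \<Delta>1" and "\<Delta> (et h) = \<Delta>1 \<bullet> (et h \<star> 1\<^sub>H)"
proof -
  define f where "f = tensor_lift K HH.T (\<lambda>a t. \<epsilon> (a \<cdot> h) \<odot>\<^bsub>HH.T\<^esub> t)"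
  note bil = slice_left_bilinear[OF HH.tensor_module h]
  have f: "f \<in> linear_maps K H3.T HH.T"
    and f_tens: "\<And>a t. a \<in> HC \<Longrightarrow> t \<in> carrier HH.T \<Longrightarrow> f (a \<star>\<^sub>3 t) = \<epsilon> (a \<cdot> h) \<odot>\<^bsub>HH.T\<^esub> t"
    unfolding f_def using H3.tensor_lift_linear[OF HH.tensor_module bil]
      H3.tensor_lift_tens[OF HH.tensor_module bil] by auto
  note slice = linear_maps_comp[OF sliceL_linear[OF h] linear_maps_comp[OF bilinear_left[OF HH.tens_bilinear]]]
  \<comment> \<open>Slicing the first leg commutes with applying \<Delta> to the second, by
    linearity of \<Delta>.\<close>
  have "f (id_\<Delta> \<Delta>1) = \<Delta> (sliceL h \<Delta>1)"
    by (rule HH.linear_tensor_eqI[OF linear_maps_comp[OF id_\<Delta>_linear f]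
          linear_maps_comp[OF sliceL_linear[OF h] comult_linear]])
      (use h in \<open>simp_all add: id_\<Delta>_tens f_tens sliceL_tens \<Delta>_smult\<close>)
  moreover have "f (assoc (\<Delta>1 \<star>\<^sub>4 1\<^sub>H) \<bullet>\<^sub>3 (1\<^sub>H \<star>\<^sub>3 \<Delta>1)) = (sliceL h \<Delta>1 \<star> 1\<^sub>H) \<bullet> \<Delta>1"
    by (rule HH.linear_tensor_eqI[OF linear_maps_comp[OF tens3_linear(1) f] slice[OF _ tmult_right_linear]])
      (use h in \<open>simp_all add: tens3_tens f_tens sliceL_tens HH.tens_smult_left HH.tmult_smult_left\<close>)
  moreover have "f ((1\<^sub>H \<star>\<^sub>3 \<Delta>1) \<bullet>\<^sub>3 assoc (\<Delta>1 \<star>\<^sub>4 1\<^sub>H)) = \<Delta>1 \<bullet> (sliceL h \<Delta>1 \<star> 1\<^sub>H)"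
    by (rule HH.linear_tensor_eqI[OF linear_maps_comp[OF tens3_linear(2) f] slice[OF _ tmult_left_linear]])
      (use h in \<open>simp_all add: tens3_tens f_tens sliceL_tens HH.tens_smult_left HH.tmult_smult_right\<close>)
  ultimately show "\<Delta> (et h) = (et h \<star> 1\<^sub>H) \<bullet> \<Delta>1" "\<Delta> (et h) = \<Delta>1 \<bullet> (et h \<star> 1\<^sub>H)"
    using comult_one1 comult_one2 by (simp_all add: et_slice)
qed

text \<open>Apply \<open>id \<otimes> id \<otimes> \<epsilon>(- h)\<close> to the two axioms on \<open>\<Delta>(1)\<close>.\<close>

lemma es_comult:
  assumes h: "h \<in> HC"
  shows "\<Delta> (es h) = \<Delta>1 \<bullet> (1\<^sub>H \<star> es h)" and "\<Delta> (es h) = (1\<^sub>H \<star> es h) \<bullet> \<Delta>1"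
proof -
  define f where "f = tensor_lift K HH.T (\<lambda>a t. a \<star> sliceR h t)"
  have bil: "(\<lambda>a t. a \<star> sliceR h t) \<in> bilinear_maps K H HH.T HH.T"
    using bilinear_comp[OF HH.tens_bilinear linear_id sliceR_linear[OF h] linear_id] by simp
  have f: "f \<in> linear_maps K H3.T HH.T"
    and f_tens: "\<And>a t. a \<in> HC \<Longrightarrow> t \<in> carrier HH.T \<Longrightarrow> f (a \<star>\<^sub>3 t) = a \<star> sliceR h t"
    unfolding f_def using H3.tensor_lift_linear[OF HH.tensor_module bil]
      H3.tensor_lift_tens[OF HH.tensor_module bil] by auto
  have f_assoc: "f (assoc (u \<star>\<^sub>4 p)) = \<epsilon> (p \<cdot> h) \<odot>\<^bsub>HH.T\<^esub> u" if "u \<in> carrier HH.T" "p \<in> HC" for u p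
    by (rule HH.linear_tensor_eqI[OF linear_maps_comp[OF linear_maps_comp[OF bilinear_left[OF H4.tens_bilinear that(2)] assoc_linear] f]
          bilinear_left[OF slice_right_bilinear[OF HH.tensor_module h] that(2)] that(1)])
      (use h that in \<open>simp_all add: assoc_tens f_tens sliceR_tens HH.tens_smult_right\<close>)
  \<comment> \<open>Coassociativity trades \<open>id_\<Delta>\<close> for
    \<open>\<Delta>_id\<close>: there the third leg is an untouched leg of \<open>\<Delta>1\<close>,
    and slicing it leaves \<Delta> of a slice.\<close>
  have "f (assoc (\<Delta>_id \<Delta>1)) = \<Delta> (sliceR h \<Delta>1)"
    by (rule HH.linear_tensor_eqI[OF linear_maps_comp[OF linear_maps_comp[OF \<Delta>_id_linear assoc_linear] f]
          linear_maps_comp[OF sliceR_linear[OF h] comult_linear]])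
      (use h in \<open>simp_all add: \<Delta>_id_tens f_assoc sliceR_tens \<Delta>_smult\<close>)
  moreover have "f (assoc (\<Delta>1 \<star>\<^sub>4 1\<^sub>H) \<bullet>\<^sub>3 (1\<^sub>H \<star>\<^sub>3 \<Delta>1)) = \<Delta>1 \<bullet> (1\<^sub>H \<star> sliceR h \<Delta>1)"
    by (rule HH.linear_tensor_eqI[OF linear_maps_comp[OF tens3_linear(1) f] tmult_right_linear])
      (use h in \<open>simp_all add: tens3_tens f_tens sliceR_mult_left alg_simps\<close>)
  moreover have "f ((1\<^sub>H \<star>\<^sub>3 \<Delta>1) \<bullet>\<^sub>3 assoc (\<Delta>1 \<star>\<^sub>4 1\<^sub>H)) = (1\<^sub>H \<star> sliceR h \<Delta>1) \<bullet> \<Delta>1"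
    by (rule HH.linear_tensor_eqI[OF linear_maps_comp[OF tens3_linear(2) f] tmult_left_linear])
      (use h in \<open>simp_all add: tens3_tens f_tens sliceR_mult_right alg_simps\<close>)
  ultimately show "\<Delta> (es h) = \<Delta>1 \<bullet> (1\<^sub>H \<star> es h)" "\<Delta> (es h) = (1\<^sub>H \<star> es h) \<bullet> \<Delta>1"
    using comult_one1 comult_one2 coassoc[of "1\<^sub>H"] by (simp_all add: es_slice)
qed

section \<open>The target counital subalgebra and the map \<open>es\<close>\<close>

definition "Ht = et ` HC"

lemma Ht_closed [simp]: "x \<in> Ht \<Longrightarrow> x \<in> HC"
  by (auto simp: Ht_def)

lemma et_in_Ht [simp]: "h \<in> HC \<Longrightarrow> et h \<in> Ht"
  by (auto simp: Ht_def)

lemma Ht_comult: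
  assumes "x \<in> Ht"
  shows "\<Delta> x = (x \<star> 1\<^sub>H) \<bullet> \<Delta>1" and "\<Delta> x = \<Delta>1 \<bullet> (x \<star> 1\<^sub>H)"
  using assms et_comult by (auto simp: Ht_def)

text \<open>\<open>et x\<close> is \<epsilon> \<otimes> id applied to
  \<open>\<Delta>1 \<bullet> (x \<star> 1\<^sub>H)\<close>; if that tensor is
  \<open>\<Delta> x\<close>, the counit law returns \<open>x\<close>.\<close>

lemma et_eqI:
  assumes "x \<in> HC" "\<Delta> x = \<Delta>1 \<bullet> (x \<star> 1\<^sub>H)"
  shows "et x = x"
proof -
  have "et x = sliceL 1\<^sub>H (\<Delta>1 \<bullet> (x \<star> 1\<^sub>H))"
    using assms(1) by (simp_all add: sliceL_mult_right et_slice module_axioms)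
  then show ?thesis
    using sliceL_one[OF assms(1)] by (simp add: assms(2))
qed

lemma et_Ht: "x \<in> Ht \<Longrightarrow> et x = x"
  by (rule et_eqI) (simp, rule Ht_comult(2))

text \<open>As an equation between coproducts, membership can be tested on products by
  multiplicativity of \<Delta>.\<close>

lemma Ht_iff: "x \<in> Ht \<longleftrightarrow> x \<in> HC \<and> \<Delta> x = \<Delta>1 \<bullet> (x \<star> 1\<^sub>H)"
  using et_eqI Ht_comult(2) Ht_closed et_in_Ht by metis

lemma et_one: "et 1\<^sub>H = 1\<^sub>H"
  by (simp add: et_slice sliceL_one)

lemma es_one: "es 1\<^sub>H = 1\<^sub>H"
  by (simp add: es_slice sliceR_one)

lemma Ht_one [simp]: "1\<^sub>H \<in> Ht"
  using et_in_Ht[of "1\<^sub>H"] et_one by simp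

lemma Ht_mult [simp]:
  assumes "x \<in> Ht" "y \<in> Ht"
  shows "x \<cdot> y \<in> Ht"
proof -
  have "\<Delta> (x \<cdot> y) = \<Delta> x \<bullet> (\<Delta>1 \<bullet> (y \<star> 1\<^sub>H))"
    using assms by (simp add: comult_mult Ht_comult(2)[of y, symmetric])
  also have "\<dots> = \<Delta>1 \<bullet> (x \<star> 1\<^sub>H) \<bullet> (y \<star> 1\<^sub>H)"
    using assms by (simp add: HH.tmult_assoc[symmetric] Ht_comult(2)[of x, symmetric])
  also have "\<dots> = \<Delta>1 \<bullet> (x \<cdot> y \<star> 1\<^sub>H)"
    using assms by (simp add: HH.tmult_assoc HH.tensor_mult_tens)
  finally show ?thesis using assms by (simp add: Ht_iff)
qed

text \<open>\<open>\<Delta> x\<close> can be written with \<open>x\<close> on either side of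
  \<open>\<Delta>1\<close>; slicing the second leg of both forms gives the two products.\<close>

lemma Ht_es_commute:
  assumes "x \<in> Ht" "y \<in> HC"
  shows "x \<cdot> es y = es y \<cdot> x"
proof -
  have "x \<cdot> es y = sliceR y ((x \<star> 1\<^sub>H) \<bullet> \<Delta>1)"
    using assms by (simp add: sliceR_mult_left es_slice)
  also have "\<dots> = es y \<cdot> x"
    unfolding Ht_comult(1)[OF assms(1), symmetric] Ht_comult(2)[OF assms(1)]
    using assms by (simp add: sliceR_mult_right es_slice)
  finally show ?thesis .
qed

text \<open>Multiplying \<open>es_comult\<close> by \<open>\<Delta> h\<close> gives \<open>\<Delta>
  (h \<cdot> es x) = \<Delta> h \<bullet> (1\<^sub>H \<star> es x)\<close>. The counit law evaluates
  the slice of the left side, and inside the counit \<open>es x\<close> may be replaced by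
  \<open>x\<close>.\<close>

lemma mult_es:
  assumes "h \<in> HC" "x \<in> HC"
  shows "sliceR x (\<Delta> h) = h \<cdot> es x"
proof -
  have "\<Delta> (h \<cdot> es x) = \<Delta> h \<bullet> \<Delta>1 \<bullet> (1\<^sub>H \<star> es x)"
    using assms by (simp add: comult_mult es_comult(1)[of x] HH.tmult_assoc del: \<Delta>_\<Delta>1)
  then have "\<Delta> (h \<cdot> es x) = \<Delta> h \<bullet> (1\<^sub>H \<star> es x)"
    using assms by simp
  then have "h \<cdot> es x = sliceR (es x) (\<Delta> h)"
    using assms sliceR_one[of "h \<cdot> es x"] by (simp add: sliceR_mult_right)
  also have "\<dots> = sliceR x (\<Delta> h)"
    unfolding sliceR_def
    by (rule HH.tensor_lift_cong[OF module_axioms sliceR_bil]) (use assms in \<open>simp_all add: eps_es\<close>)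
  finally show ?thesis by simp
qed

lemma et_linear: "et \<in> linear_maps K H H"
  and es_linear: "es \<in> linear_maps K H H"
proof -
  \<comment> \<open>In the definition of \<open>et\<close> the argument sits inside the functional.
    Moved into the tensor as \<open>x \<star> 1\<^sub>H\<close>, it makes \<open>et\<close> a
    visible composite of linear maps; \<open>es\<close> is treated alike.\<close>
  have "(\<lambda>x. sliceL 1\<^sub>H (\<Delta>1 \<bullet> (x \<star> 1\<^sub>H))) \<in> linear_maps K H H"
    by (rule linear_maps_comp[OF linear_maps_comp[OF bilinear_left[OF HH.tens_bilinear] tmult_left_linear] sliceL_linear]) simp_all
  then show "et \<in> linear_maps K H H"
    by (rule linear_maps_eq) (simp_all add: sliceL_mult_right et_slice module_axioms)
  have "(\<lambda>x. sliceR 1\<^sub>H (\<Delta>1 \<bullet> (1\<^sub>H \<star> x))) \<in> linear_maps K H H"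
    by (rule linear_maps_comp[OF linear_maps_comp[OF bilinear_right[OF HH.tens_bilinear] tmult_left_linear] sliceR_linear]) simp_all
  then show "es \<in> linear_maps K H H"
    by (rule linear_maps_eq) (simp_all add: sliceR_mult_right es_slice module_axioms)
qed

text \<open>The argument of \<open>et\<close> is felt only through counit values of the form
  \<epsilon>(a g h), where \<open>eps_et\<close> and \<open>eps_es\<close> permit the replacement;
  \<open>es_et\<close> has the same reason.\<close>

lemma et_mult: "g \<in> HC \<Longrightarrow> h \<in> HC \<Longrightarrow> et (g \<cdot> et h) = et (g \<cdot> h)"
  and et_mult_es: "g \<in> HC \<Longrightarrow> h \<in> HC \<Longrightarrow> et (g \<cdot> es h) = et (g \<cdot> h)"
  unfolding et_slice[of "g \<cdot> _"] sliceL_def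
  by (rule HH.tensor_lift_cong[OF module_axioms sliceL_bil];
      simp add: eps_et eps_es flip: alg.m_assoc)+

lemma es_et: "h \<in> HC \<Longrightarrow> es (et h) = es h"
  unfolding es_slice sliceR_def
  by (rule HH.tensor_lift_cong[OF module_axioms sliceR_bil]) (simp_all add: eps_et)

text \<open>Apply \<open>id \<otimes> \<epsilon>(- x) \<otimes> id\<close> to \<open>1\<^sub>(\<^sub>1\<^sub>) \<otimes> 1'\<^sub>(\<^sub>1\<^sub>) 1\<^sub>(\<^sub>2\<^sub>) \<otimes> 1'\<^sub>(\<^sub>2\<^sub>) = 1\<^sub>(\<^sub>1\<^sub>) \<otimes> 1\<^sub>(\<^sub>2\<^sub>) \<otimes> 1\<^sub>(\<^sub>3\<^sub>)\<close>.\<close>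

lemma partial_counit_\<Delta>1:
  assumes x: "x \<in> HC"
  shows "tensor_lift K HH.T (\<lambda>a b. a \<star> et (b \<cdot> x)) \<Delta>1 = \<Delta>1 \<bullet> (es x \<star> 1\<^sub>H)"
proof -
  define f where "f = tensor_lift K HH.T (\<lambda>a t. a \<star> sliceL x t)"
  have bil: "(\<lambda>a t. a \<star> sliceL x t) \<in> bilinear_maps K H HH.T HH.T"
    using bilinear_comp[OF HH.tens_bilinear linear_id sliceL_linear[OF x] linear_id] by simp
  have f: "f \<in> linear_maps K H3.T HH.T"
    and f_tens: "\<And>a t. a \<in> HC \<Longrightarrow> t \<in> carrier HH.T \<Longrightarrow> f (a \<star>\<^sub>3 t) = a \<star> sliceL x t"
    unfolding f_def using H3.tensor_lift_linear[OF HH.tensor_module bil]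
      H3.tensor_lift_tens[OF HH.tensor_module bil] by auto
  have f_assoc: "f (assoc (u \<star>\<^sub>4 p)) = sliceR x u \<star> p" if "u \<in> carrier HH.T" "p \<in> HC" for u p
    by (rule HH.linear_tensor_eqI[OF linear_maps_comp[OF linear_maps_comp[OF bilinear_left[OF H4.tens_bilinear that(2)] assoc_linear] f]
          linear_maps_comp[OF sliceR_linear[OF x] bilinear_left[OF HH.tens_bilinear that(2)]] that(1)])
      (use x that in \<open>simp_all add: assoc_tens f_tens sliceR_tens sliceL_tens HH.tens_smult_right HH.tens_smult_left\<close>)
  \<comment> \<open>The sliced middle leg is here the second leg of \<Delta> applied to the first
    leg of \<open>\<Delta>1\<close>, so \<open>mult_es\<close> turns the slice into right
    multiplication by \<open>es x\<close>.\<close>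
  have "f (assoc (\<Delta>_id \<Delta>1)) = \<Delta>1 \<bullet> (es x \<star> 1\<^sub>H)"
    by (rule HH.linear_tensor_eqI[OF linear_maps_comp[OF linear_maps_comp[OF \<Delta>_id_linear assoc_linear] f]
          tmult_right_linear])
      (use x in \<open>simp_all add: \<Delta>_id_tens f_assoc mult_es alg_simps\<close>)
  \<comment> \<open>Now the middle leg is a product ending in \<open>b\<close>, which
    \<open>sliceL_mult_right\<close> moves into the index, giving \<open>et (b \<cdot> x)\<close> on
    the last leg.\<close>
  moreover have "f ((1\<^sub>H \<star>\<^sub>3 \<Delta>1) \<bullet>\<^sub>3 assoc (\<Delta>1 \<star>\<^sub>4 1\<^sub>H)) = tensor_lift K HH.T (\<lambda>a b. a \<star> et (b \<cdot> x)) \<Delta>1"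
  proof (rule HH.tensor_lift_unique[OF HH.tensor_module _ linear_maps_comp[OF tens3_linear(2) f]])
    show "(\<lambda>a b. a \<star> et (b \<cdot> x)) \<in> bilinear_maps K H H HH.T"
      using bilinear_comp[OF HH.tens_bilinear linear_id
        linear_maps_comp[OF hmult_right_linear[OF x] et_linear] linear_id] by simp
  qed (use x in \<open>simp_all add: tens3_tens f_tens sliceL_mult_right et_slice\<close>)
  ultimately show ?thesis
    using comult_one2 coassoc[of "1\<^sub>H"] by simp
qed

section \<open>The transfer rule and its consequences\<close>

definition "id_et = tensor_lift K HH.T (\<lambda>a b. a \<star> et b)"

lemma id_et_linear: "id_et \<in> linear_maps K HH.T HH.T"
  and id_et_tens: "a \<in> HC \<Longrightarrow> b \<in> HC \<Longrightarrow> id_et (a \<star> b) = a \<star> et b"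
proof -
  have bil: "(\<lambda>a b. a \<star> et b) \<in> bilinear_maps K H H HH.T"
    using bilinear_comp[OF HH.tens_bilinear linear_id et_linear linear_id] by simp
  show "id_et \<in> linear_maps K HH.T HH.T" "a \<in> HC \<Longrightarrow> b \<in> HC \<Longrightarrow> id_et (a \<star> b) = a \<star> et b"
    unfolding id_et_def by (rule HH.tensor_lift_linear[OF HH.tensor_module bil])
      (rule HH.tensor_lift_tens[OF HH.tensor_module bil])
qed

text \<open>The case \<open>x = 1\<^sub>H\<close> of \<open>partial_counit_\<Delta>1\<close>. It
  places the second leg of \<open>\<Delta>1\<close> in \<open>Ht\<close> without writing
  \<open>\<Delta>1\<close> as a sum of pure tensors.\<close>

lemma id_et_\<Delta>1: "id_et \<Delta>1 = \<Delta>1"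
proof -
  have "id_et \<Delta>1 = tensor_lift K HH.T (\<lambda>a b. a \<star> et (b \<cdot> 1\<^sub>H)) \<Delta>1"
    unfolding id_et_def
    by (rule HH.tensor_lift_cong[OF HH.tensor_module, symmetric])
      (use bilinear_comp[OF HH.tens_bilinear linear_id et_linear linear_id] in simp_all)
  then show ?thesis
    using partial_counit_\<Delta>1[of "1\<^sub>H"] HH.T.alg.r_one[of \<Delta>1] by (simp add: es_one)
qed

lemma \<Delta>1_transfer:
  assumes x: "x \<in> Ht"
  shows "\<Delta>1 \<bullet> (1\<^sub>H \<star> x) = \<Delta>1 \<bullet> (es x \<star> 1\<^sub>H)"
proof -
  define w where "w = tensor_lift K HH.T (\<lambda>a b. a \<star> et (b \<cdot> x))"
  have bil: "(\<lambda>a b. a \<star> et (b \<cdot> x)) \<in> bilinear_maps K H H HH.T"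
    using bilinear_comp[OF HH.tens_bilinear linear_id
        linear_maps_comp[OF hmult_right_linear et_linear] linear_id] x by simp
  have w: "w \<in> linear_maps K HH.T HH.T" "\<And>a b. a \<in> HC \<Longrightarrow> b \<in> HC \<Longrightarrow> w (a \<star> b) = a \<star> et (b \<cdot> x)"
    unfolding w_def using HH.tensor_lift_linear[OF HH.tensor_module bil]
      HH.tensor_lift_tens[OF HH.tensor_module bil] by auto
  \<comment> \<open>Once \<open>id_et\<close> has put the second leg into \<open>Ht\<close>, its
    product with \<open>x\<close> lies there as well and is fixed by \<open>et\<close>, so
    \<open>w\<close> acts as right multiplication.\<close>
  have "w (id_et \<Delta>1) = id_et \<Delta>1 \<bullet> (1\<^sub>H \<star> x)"
    by (rule HH.linear_tensor_eqI[OF linear_maps_comp[OF id_et_linear w(1)]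
          linear_maps_comp[OF id_et_linear tmult_right_linear]])
      (use x in \<open>simp_all add: id_et_tens w(2) et_Ht HH.tensor_mult_tens\<close>)
  then show ?thesis
    using partial_counit_\<Delta>1[of x] x by (simp add: id_et_\<Delta>1 w_def)
qed

lemma \<Delta>_transfer:
  assumes "x \<in> Ht" "h \<in> HC"
  shows "\<Delta> h \<bullet> (1\<^sub>H \<star> x) = \<Delta> h \<bullet> (es x \<star> 1\<^sub>H)"
proof -
  have "\<Delta> h \<bullet> \<Delta>1 \<bullet> (1\<^sub>H \<star> x) = \<Delta> h \<bullet> \<Delta>1 \<bullet> (es x \<star> 1\<^sub>H)"
    using assms by (simp add: HH.tmult_assoc \<Delta>1_transfer del: \<Delta>_\<Delta>1)
  then show ?thesis using assms by simp
qed

text \<open>Inside \<open>es (x \<cdot> y)\<close> the factor \<open>x\<close> multiplies the second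
  leg of \<open>\<Delta>1\<close> from the right. Transferred to the first leg it becomes
  \<open>es x\<close>, again at the right end, behind the \<open>es y\<close> that the slice
  produces.\<close>

lemma es_antimult:
  assumes "x \<in> Ht" "y \<in> HC"
  shows "es (x \<cdot> y) = es y \<cdot> es x"
proof -
  have "es (x \<cdot> y) = sliceR y (\<Delta>1 \<bullet> (1\<^sub>H \<star> x))"
    using assms by (simp_all add: sliceR_mult_right es_slice module_axioms)
  also have "\<dots> = es y \<cdot> es x"
    using assms by (simp add: \<Delta>1_transfer sliceR_mult_right) (simp add: es_slice)
  finally show ?thesis .
qed

lemma Ht_mult_comult:
  assumes "x \<in> Ht" "h \<in> HC"
  shows "\<Delta> (x \<cdot> h) = (x \<star> 1\<^sub>H) \<bullet> \<Delta> h"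
  using assms by (simp add: comult_mult Ht_comult(1)[of x] HH.tmult_assoc)

lemma es_mult_comult:
  assumes "x \<in> HC" "h \<in> HC"
  shows "\<Delta> (es x \<cdot> h) = (1\<^sub>H \<star> es x) \<bullet> \<Delta> h"
  using assms by (simp add: comult_mult es_comult(2)[of x] HH.tmult_assoc)

text \<open>Prepares the unit condition on \<open>Gam\<close>: modulo the relations of
  \<open>H \<diamondop> H\<close> the factor \<open>\<Delta>1\<close> will disappear.\<close>

lemma Ht_es_comult:
  assumes "x \<in> Ht" "y \<in> HC"
  shows "\<Delta> (x \<cdot> es y) = \<Delta>1 \<bullet> (x \<star> es y)"
proof -
  have "\<Delta> (x \<cdot> es y) = (x \<star> 1\<^sub>H) \<bullet> \<Delta>1 \<bullet> (1\<^sub>H \<star> es y)"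
    using assms by (simp add: Ht_mult_comult es_comult(1) HH.tmult_assoc)
  also have "\<dots> = \<Delta>1 \<bullet> (x \<star> 1\<^sub>H) \<bullet> (1\<^sub>H \<star> es y)"
    using Ht_comult[OF assms(1)] by simp
  also have "\<dots> = \<Delta>1 \<bullet> (x \<star> es y)"
    using assms by (simp add: HH.tmult_assoc HH.tensor_mult_tens)
  finally show ?thesis .
qed

end

section \<open>Subalgebras, opposite algebras and endomorphisms\<close>

lemma (in k_algebra) subalgebra_k_algebra:
  assumes "submodule S K A" "\<one>\<^bsub>A\<^esub> \<in> S" "\<And>x y. x \<in> S \<Longrightarrow> y \<in> S \<Longrightarrow> x \<otimes>\<^bsub>A\<^esub> y \<in> S"
  shows "k_algebra K (A\<lparr>carrier := S\<rparr>)"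
proof -
  have sub [simp]: "x \<in> S \<Longrightarrow> x \<in> carrier A" for x
    using submoduleE(1)[OF assms(1)] by auto
  have m: "module K (A\<lparr>carrier := S\<rparr>)"
    by (rule submodule.submodule_is_module[OF assms(1) module_axioms])
  then interpret S: module K "A\<lparr>carrier := S\<rparr>" .
  show ?thesis
    by (intro k_algebra.intro m base.field_axioms k_algebra_axioms.intro ringI monoidI S.abelian_group_axioms)
      (simp_all add: assms alg.m_assoc alg.l_distr alg.r_distr smult_mult_left smult_mult_right)
qed

lemma opposite_sel [simp]:
  "carrier (opposite A) = carrier A" "zero (opposite A) = zero A" "add (opposite A) = add A"
  "smult (opposite A) = smult A" "one (opposite A) = one A" "x \<otimes>\<^bsub>opposite A\<^esub> y = y \<otimes>\<^bsub>A\<^esub> x"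
  by (auto simp: opposite_def)

lemma (in k_algebra) opposite_k_algebra: "k_algebra K (opposite A)"
proof -
  have m: "module K (opposite A)"
    by (rule module_cong[OF module_axioms]) simp_all
  then interpret S: module K "opposite A" .
  show ?thesis
    by (intro k_algebra.intro m base.field_axioms k_algebra_axioms.intro ringI monoidI S.abelian_group_axioms)
      (simp_all add: alg.m_assoc alg.l_distr alg.r_distr smult_mult_left smult_mult_right)
qed

lemma end_sel [simp]:
  "carrier (end_algebra K R) = linear_maps K R R \<inter> extensional (carrier R)"
  "mult (end_algebra K R) = compose (carrier R)" "one (end_algebra K R) = (\<lambda>x\<in>carrier R. x)"
  "zero (end_algebra K R) = (\<lambda>x\<in>carrier R. \<zero>\<^bsub>R\<^esub>)"
  "add (end_algebra K R) = (\<lambda>f g. \<lambda>x\<in>carrier R. f x \<oplus>\<^bsub>R\<^esub> g x)"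
  "smult (end_algebra K R) = (\<lambda>a f. \<lambda>x\<in>carrier R. a \<odot>\<^bsub>R\<^esub> f x)"
  by (auto simp: end_algebra_def)

lemma (in module) smult_left_commute:
  "a \<in> carrier R \<Longrightarrow> b \<in> carrier R \<Longrightarrow> x \<in> carrier M \<Longrightarrow> a \<odot>\<^bsub>M\<^esub> (b \<odot>\<^bsub>M\<^esub> x) = b \<odot>\<^bsub>M\<^esub> (a \<odot>\<^bsub>M\<^esub> x)"
  by (metis R.m_comm smult_assoc1)

lemma end_algebra_module:
  assumes "module K V"
  shows "module K (end_algebra K V)"
proof -
  interpret V: module K V by fact
  have lin: "(\<lambda>x\<in>carrier V. f x) \<in> linear_maps K V V \<longleftrightarrow> f \<in> linear_maps K V V" for f
    by (auto simp: linear_maps_def Pi_iff)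
  \<comment> \<open>Extensional maps are equal when they agree on \<open>V\<close>, so the module
    axioms reduce pointwise to those of \<open>V\<close>.\<close>
  have ext: "f = g" if "f \<in> carrier (end_algebra K V)" "g \<in> carrier (end_algebra K V)"
    "\<And>x. x \<in> carrier V \<Longrightarrow> f x = g x" for f g
    using that by (auto intro: extensionalityI)
  have c: "f x \<in> carrier V" if "f \<in> carrier (end_algebra K V)" "x \<in> carrier V" for f x
    using that linear_closed by auto
  have add: "f \<oplus>\<^bsub>end_algebra K V\<^esub> g \<in> carrier (end_algebra K V)"
    if "f \<in> carrier (end_algebra K V)" "g \<in> carrier (end_algebra K V)" for f g
    using that by (auto simp: lin linear_closed linear_add linear_smult V.M.a_ac V.smult_r_distr intro!: linear_mapsI)
  have smult: "a \<odot>\<^bsub>end_algebra K V\<^esub> f \<in> carrier (end_algebra K V)"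
    if "a \<in> carrier K" "f \<in> carrier (end_algebra K V)" for a f
    using that by (auto simp: lin linear_closed linear_add linear_smult V.smult_left_commute V.smult_r_distr intro!: linear_mapsI)
  have zero: "\<zero>\<^bsub>end_algebra K V\<^esub> \<in> carrier (end_algebra K V)"
    by (auto intro!: linear_mapsI)
  show ?thesis
  proof (intro moduleI abelian_groupI add smult zero V.R.is_cring)
    fix f assume f: "f \<in> carrier (end_algebra K V)"
    show "\<exists>g\<in>carrier (end_algebra K V). g \<oplus>\<^bsub>end_algebra K V\<^esub> f = \<zero>\<^bsub>end_algebra K V\<^esub>"
    proof (rule bexI[OF _ smult[of "\<ominus>\<^bsub>K\<^esub> \<one>\<^bsub>K\<^esub>" f]])
      show "(\<ominus>\<^bsub>K\<^esub> \<one>\<^bsub>K\<^esub>) \<odot>\<^bsub>end_algebra K V\<^esub> f \<oplus>\<^bsub>end_algebra K V\<^esub> f = \<zero>\<^bsub>end_algebra K V\<^esub>"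
        using c[OF f] by (auto simp: V.smult_l_minus V.M.l_neg intro!: restrict_ext)
    qed (use f in auto)
  qed ((assumption | (rule ext; (intro add smult zero V.R.a_closed V.R.m_closed V.R.one_closed; assumption)?;
      simp add: c V.M.a_ac V.smult_l_distr V.smult_r_distr V.smult_assoc1 del: end_sel(1)))+)
qed

section \<open>The bialgebra over the target subalgebra\<close>

text \<open>The construction reads only carriers and operations, so the regular module
  \<open>Hm\<close>, a longer record, has literally the same tensor square as \<open>H\<close>, and
  one set of calculations serves both.\<close>

lemma tensor_cong:
  assumes "carrier M' = carrier M" "add M' = add M" "smult M' = smult M" "mult M' = mult M" "one M' = one M"
    and "carrier N' = carrier N" "add N' = add N" "smult N' = smult N" "mult N' = mult N" "one N' = one N"
  shows "tens K M' N' = tens K M N" "tensor K M' N' = tensor K M N"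
proof -
  have n: "tensor_null K M' N' = tensor_null K M N"
    unfolding tensor_null_def Let_def by (simp only: assms)
  show t: "tens K M' N' = tens K M N"
    by (intro ext) (simp only: tens_def n assms)
  show "tensor K M' N' = tensor K M N"
    unfolding tensor_def Let_def n t by (simp only: assms)
qed

lemma left_regular_sel [simp]:
  "carrier (left_regular K R L \<iota>) = carrier L" "zero (left_regular K R L \<iota>) = zero L"
  "add (left_regular K R L \<iota>) = add L" "smult (left_regular K R L \<iota>) = smult L"
  "mult (left_regular K R L \<iota>) = mult L" "one (left_regular K R L \<iota>) = one L"
  "act (left_regular K R L \<iota>) r = (\<lambda>l. src K R \<iota> r \<otimes>\<^bsub>L\<^esub> l)"
  "bact (left_regular K R L \<iota>) r = (\<lambda>l. bar K R \<iota> r \<otimes>\<^bsub>L\<^esub> l)"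
  by (auto simp: left_regular_def module.defs env_module.defs)

lemma takeuchi_sel [simp]:
  "carrier (takeuchi K R L i) = takeuchi_carrier K R L i"
  "zero (takeuchi K R L i) = zero (diamond K R (left_regular K R L i) (left_regular K R L i))"
  "add (takeuchi K R L i) = add (diamond K R (left_regular K R L i) (left_regular K R L i))"
  "smult (takeuchi K R L i) = smult (diamond K R (left_regular K R L i) (left_regular K R L i))"
  by (simp_all add: takeuchi_def Let_def)

context weak_bialg
begin

abbreviation "Rt \<equiv> target_subalgebra K H \<Delta> \<epsilon>"
abbreviation "iota \<equiv> tensor_lift K H (\<lambda>x y. x \<cdot> es y)"
abbreviation "Hm \<equiv> left_regular K Rt H iota"
abbreviation "Gam \<equiv> diamond_proj K Rt Hm Hm \<circ> \<Delta>"
abbreviation "Cou \<equiv> \<lambda>h. \<lambda>x\<in>carrier Rt. et (h \<cdot> x)"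

lemma Rt_sel [simp]:
  "carrier Rt = Ht" "zero Rt = zero H" "add Rt = add H" "smult Rt = smult H" "mult Rt = mult H" "one Rt = one H"
  by (simp_all add: target_subalgebra_def Ht_def)

text \<open>\<open>Ht\<close> is the set of fixed points of the linear map \<open>et\<close>; each
  closure property exhibits the element as its own image.\<close>

lemma Ht_submodule: "submodule Ht K H"
proof (rule submoduleI)
  fix x y assume x: "x \<in> Ht" and y: "y \<in> Ht"
  have "x \<oplus>\<^bsub>H\<^esub> y = et (x \<oplus>\<^bsub>H\<^esub> y)"
    using x y by (simp add: linear_add[OF et_linear] et_Ht)
  then show "x \<oplus>\<^bsub>H\<^esub> y \<in> Ht" using x y by (metis Ht_closed M.a_closed et_in_Ht)
next
  fix a x assume a: "a \<in> carrier K" and x: "x \<in> Ht"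
  have "a *\<^sub>H x = et (a *\<^sub>H x)"
    using a x by (simp add: linear_smult[OF et_linear] et_Ht)
  then show "a *\<^sub>H x \<in> Ht" using a x by (metis Ht_closed smult_closed et_in_Ht)
next
  fix x assume x: "x \<in> Ht"
  have "\<ominus>\<^bsub>H\<^esub> x = et (\<ominus>\<^bsub>H\<^esub> x)"
    using x linear_minus[OF et_linear module_axioms module_axioms, of "\<zero>\<^bsub>H\<^esub>" x]
      linear_zero[OF et_linear module_axioms module_axioms] by (simp add: et_Ht a_minus_def)
  then show "\<ominus>\<^bsub>H\<^esub> x \<in> Ht" using x by (metis Ht_closed M.a_inv_closed et_in_Ht)
next
  have "\<zero>\<^bsub>H\<^esub> = et \<zero>\<^bsub>H\<^esub>"
    using linear_zero[OF et_linear module_axioms module_axioms] by simp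
  then show "\<zero>\<^bsub>H\<^esub> \<in> Ht" by (metis M.zero_closed et_in_Ht)
qed auto

lemma Rt_k_algebra: "k_algebra K Rt"
proof -
  have "Rt = H\<lparr>carrier := Ht\<rparr>"
    unfolding target_subalgebra_def Ht_def ..
  then show ?thesis using subalgebra_k_algebra[OF Ht_submodule Ht_one Ht_mult] by (simp only:)
qed

end

sublocale weak_bialg \<subseteq> RR: two_algebras K "target_subalgebra K H \<Delta> \<epsilon>" "opposite (target_subalgebra K H \<Delta> \<epsilon>)"
  by (intro two_algebras.intro Rt_k_algebra k_algebra.opposite_k_algebra)

context weak_bialg
begin

section \<open>The structure map on the enveloping algebra\<close>

lemma iota_bilinear: "(\<lambda>x y. x \<cdot> es y) \<in> bilinear_maps K Rt (opposite Rt) H"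
proof -
  have "id \<in> linear_maps K Rt H" "es \<in> linear_maps K (opposite Rt) H"
    using es_linear by (auto simp: linear_maps_def)
  from bilinear_comp[OF mult_bilinear this linear_id] show ?thesis by simp
qed

lemma iota_tens: "x \<in> Ht \<Longrightarrow> y \<in> Ht \<Longrightarrow> iota (tens K Rt (opposite Rt) x y) = x \<cdot> es y"
  by (rule RR.tensor_lift_tens[OF module_axioms iota_bilinear]) simp_all

lemma iota_linear: "iota \<in> linear_maps K RR.T H"
  by (rule RR.tensor_lift_linear[OF module_axioms iota_bilinear])

lemma iota_mult:
  assumes "z \<in> carrier RR.T" "w \<in> carrier RR.T"
  shows "iota (z \<otimes>\<^bsub>RR.T\<^esub> w) = iota z \<cdot> iota w"
proof (rule RR.linear_tensor_eqI[OF linear_maps_comp[OF bilinear_left[OF RR.tensor_mult_bilinear assms(2)] iota_linear]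
      linear_maps_comp[OF iota_linear hmult_right_linear] assms(1)])
  show "iota w \<in> HC" by (rule linear_closed[OF iota_linear assms(2)])
  fix x y assume xy: "x \<in> carrier Rt" "y \<in> carrier (opposite Rt)"
  then have c: "x \<in> Ht" "y \<in> Ht" by auto
  have lin: "(\<lambda>w. iota (tens K Rt (opposite Rt) x y \<otimes>\<^bsub>RR.T\<^esub> w)) \<in> linear_maps K RR.T H"
    "(\<lambda>w. iota (tens K Rt (opposite Rt) x y) \<cdot> iota w) \<in> linear_maps K RR.T H"
    by (rule linear_maps_comp[OF bilinear_right[OF RR.tensor_mult_bilinear RR.tens_closed[OF xy]] iota_linear])
      (rule linear_maps_comp[OF iota_linear hmult_left_linear[OF linear_closed[OF iota_linear RR.tens_closed[OF xy]]]])
  show "iota (tens K Rt (opposite Rt) x y \<otimes>\<^bsub>RR.T\<^esub> w) = iota (tens K Rt (opposite Rt) x y) \<cdot> iota w"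
  proof (rule RR.linear_tensor_eqI[OF lin assms(2)])
    fix x' y' assume "x' \<in> carrier Rt" "y' \<in> carrier (opposite Rt)"
    then have c': "x' \<in> Ht" "y' \<in> Ht" by auto
    \<comment> \<open>\<open>y' \<cdot> y\<close> is the product of \<open>y\<close> and
      \<open>y'\<close> in the opposite algebra; \<open>es\<close> reverses it back, and
      \<open>x'\<close> then passes \<open>es y\<close>.\<close>
    have "x \<cdot> x' \<cdot> es (y' \<cdot> y) = x \<cdot> (x' \<cdot> es y) \<cdot> es y'"
      using c c' by (simp add: es_antimult alg.m_assoc)
    also have "\<dots> = x \<cdot> es y \<cdot> (x' \<cdot> es y')"
      using c c' by (simp add: Ht_es_commute[of x'] alg.m_assoc)
    finally show "iota (tens K Rt (opposite Rt) x y \<otimes>\<^bsub>RR.T\<^esub> tens K Rt (opposite Rt) x' y') =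
        iota (tens K Rt (opposite Rt) x y) \<cdot> iota (tens K Rt (opposite Rt) x' y')"
      using c c' by (simp add: RR.tensor_mult_tens iota_tens)
  qed
qed

lemma src_iota [simp]: "r \<in> Ht \<Longrightarrow> src K Rt iota r = r"
  by (simp add: src_def iota_tens es_one)

lemma bar_iota [simp]: "r \<in> Ht \<Longrightarrow> bar K Rt iota r = es r"
  by (simp add: bar_def iota_tens)

lemma Hm_module: "module K Hm"
  by (rule module_cong[OF module_axioms]) simp_all

lemma Hm_env_mod: "env_mod K Rt Hm"
proof (intro env_mod.intro env_mod_axioms.intro Hm_module)
  fix r assume r: "r \<in> carrier Rt"
  then show "act Hm r \<in> linear_maps K Hm Hm" "bact Hm r \<in> linear_maps K Hm Hm"
    using hmult_left_linear[of r] hmult_left_linear[of "es r"] by (simp_all add: linear_maps_def)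
  fix s m assume "s \<in> carrier Rt" "m \<in> carrier Hm"
  with r show "act Hm r (bact Hm s m) = bact Hm s (act Hm r m)"
    by (simp add: Ht_es_commute flip: alg.m_assoc)
qed

lemma tensor_Hm [simp]: "tens K Hm Hm = tens K H H" "tensor K Hm Hm = tensor K H H"
  by (rule tensor_cong; simp)+

end

sublocale weak_bialg \<subseteq> MM: two_env K "target_subalgebra K H \<Delta> \<epsilon>"
    "left_regular K (target_subalgebra K H \<Delta> \<epsilon>) H (tensor_lift K H (\<lambda>x y. x \<otimes>\<^bsub>H\<^esub> counit_source' K H \<Delta> \<epsilon> y))"
    "left_regular K (target_subalgebra K H \<Delta> \<epsilon>) H (tensor_lift K H (\<lambda>x y. x \<otimes>\<^bsub>H\<^esub> counit_source' K H \<Delta> \<epsilon> y))"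
  by (intro two_env.intro Hm_env_mod)

context weak_bialg
begin

section \<open>The diamond square of the regular module\<close>

notation MM.dtensor_elt (infixl \<open>\<diamondop>\<close> 72)

lemma linear_maps_Hm [simp]: "linear_maps K Hm S = linear_maps K H S" "linear_maps K S Hm = linear_maps K S H"
  by (simp_all add: linear_maps_def)

lemma bilinear_maps_Hm: "bilinear_maps K Hm Hm S = bilinear_maps K H H S"
  by (simp add: bilinear_maps_def)

lemma balanced_HmI:
  assumes "\<phi> \<in> bilinear_maps K H H S"
    and "\<And>r m n. r \<in> Ht \<Longrightarrow> m \<in> HC \<Longrightarrow> n \<in> HC \<Longrightarrow> \<phi> (es r \<cdot> m) n = \<phi> m (r \<cdot> n)"
  shows "\<phi> \<in> balanced_maps K Rt Hm Hm S"
  by (rule balancedI) (simp_all add: bilinear_maps_Hm assms)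

lemmas dproj_linear = MM.dproj_linear[unfolded tensor_Hm]
  and dtens_bilinear = MM.dtens_bilinear[unfolded bilinear_maps_Hm]
  and diamond_lift_proj = MM.diamond_lift_proj[unfolded tensor_Hm]

lemma dproj_tens: "MM.dproj (a \<star> b) = a \<diamondop> b"
  by (simp add: dtens_def)

lemma dproj_closed [simp]: "t \<in> carrier HH.T \<Longrightarrow> MM.dproj t \<in> carrier MM.D"
  by (rule linear_closed[OF dproj_linear])

lemma dtens_bal: "r \<in> Ht \<Longrightarrow> m \<in> HC \<Longrightarrow> n \<in> HC \<Longrightarrow> es r \<cdot> m \<diamondop> n = m \<diamondop> r \<cdot> n"
  using MM.dtens_bal[of r m n] by simp

lemma Gam_linear: "Gam \<in> linear_maps K H MM.D"
  using linear_maps_comp[OF comult_linear dproj_linear] by (simp add: comp_def)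

lemma dproj_\<Delta>1_mult:
  assumes "m \<in> HC" "n \<in> HC"
  shows "MM.dproj (\<Delta>1 \<bullet> (m \<star> n)) = m \<diamondop> n"
proof -
  \<comment> \<open>This map sends \<open>a \<star> b\<close> to \<open>es b \<cdot> a\<close>. At
    \<open>\<Delta>1\<close> it gives \<open>1\<^sub>H\<close>, because \<open>\<Delta>1\<close> is
    idempotent and the counit law applies.\<close>
  have j: "(\<lambda>t. sliceR 1\<^sub>H (\<Delta>1 \<bullet> t)) \<in> linear_maps K HH.T H"
    by (rule linear_maps_comp[OF tmult_left_linear sliceR_linear]) simp_all
  have "MM.dproj (id_et \<Delta>1 \<bullet> (m \<star> n)) = sliceR 1\<^sub>H (\<Delta>1 \<bullet> \<Delta>1) \<cdot> m \<diamondop> n"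
  proof (rule HH.linear_tensor_eqI[OF linear_maps_comp[OF linear_maps_comp[OF id_et_linear tmult_right_linear] dproj_linear]
        linear_maps_comp[OF linear_maps_comp[OF j hmult_right_linear[OF assms(1)]] bilinear_left[OF dtens_bilinear assms(2)]]])
    fix a b assume c: "a \<in> HC" "b \<in> HC"
    have "a \<cdot> m \<diamondop> et b \<cdot> n = es (et b) \<cdot> (a \<cdot> m) \<diamondop> n"
      by (rule dtens_bal[symmetric]) (use c assms in simp_all)
    then show "MM.dproj (id_et (a \<star> b) \<bullet> (m \<star> n)) = sliceR 1\<^sub>H (\<Delta>1 \<bullet> (a \<star> b)) \<cdot> m \<diamondop> n"
      using c assms by (simp add: id_et_tens HH.tensor_mult_tens dproj_tens es_et sliceR_mult_right
          es_slice[symmetric] alg.m_assoc)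
  qed (use assms in simp_all)
  then show ?thesis
    using assms by (simp add: id_et_\<Delta>1 sliceR_one)
qed

lemma dproj_mult_left:
  assumes "t \<in> carrier HH.T" "t' \<in> carrier HH.T" "u \<in> carrier HH.T" "MM.dproj t = MM.dproj t'"
  shows "MM.dproj (t \<bullet> u) = MM.dproj (t' \<bullet> u)"
proof -
  \<comment> \<open>The relations are imposed from the left and \<open>u\<close> multiplies from the
    right, so \<open>?\<phi>\<close> is balanced; the class of \<open>t \<bullet> u\<close> is then
    a lift evaluated at the class of \<open>t\<close> alone.\<close>
  let ?\<phi> = "\<lambda>m n. MM.dproj (m \<star> n \<bullet> u)"
  have bal: "?\<phi> \<in> balanced_maps K Rt Hm Hm MM.D"
  proof (rule balanced_HmI)
    show "?\<phi> \<in> bilinear_maps K H H MM.D"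
      using bilinear_comp_out[OF HH.tens_bilinear linear_maps_comp[OF tmult_right_linear[OF assms(3)] dproj_linear]] by simp
    fix r m n assume c: "r \<in> Ht" "m \<in> HC" "n \<in> HC"
    show "MM.dproj (es r \<cdot> m \<star> n \<bullet> u) = MM.dproj (m \<star> r \<cdot> n \<bullet> u)"
      by (rule HH.linear_tensor_eqI[OF linear_maps_comp[OF tmult_left_linear dproj_linear]
            linear_maps_comp[OF tmult_left_linear dproj_linear] assms(3)])
        (use c in \<open>simp_all add: HH.tensor_mult_tens dproj_tens alg.m_assoc dtens_bal\<close>)
  qed
  have "MM.dproj (t \<bullet> u) = diamond_lift K MM.D ?\<phi> (MM.dproj t)" if "t \<in> carrier HH.T" for t
    unfolding diamond_lift_proj[OF MM.diamond_module bal that]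
    by (rule HH.tensor_lift_unique[OF MM.diamond_module balancedD(1)[OF bal, unfolded bilinear_maps_Hm]
          linear_maps_comp[OF tmult_right_linear[OF assms(3)] dproj_linear] that]) simp
  then show ?thesis using assms by simp
qed

lemma \<Delta>_mult_dproj:
  assumes "u \<in> carrier HH.T" "u' \<in> carrier HH.T" "h \<in> HC" "MM.dproj u = MM.dproj u'"
  shows "\<Delta> h \<bullet> u = \<Delta> h \<bullet> u'"
proof -
  let ?\<phi> = "\<lambda>m n. \<Delta> h \<bullet> (m \<star> n)"
  have lin: "(\<lambda>x. \<Delta> h \<bullet> x) \<in> linear_maps K HH.T HH.T"
    by (rule tmult_left_linear) (use assms in simp)
  have bal: "?\<phi> \<in> balanced_maps K Rt Hm Hm HH.T"
  proof (rule balanced_HmI)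
    show "?\<phi> \<in> bilinear_maps K H H HH.T"
      using bilinear_comp_out[OF HH.tens_bilinear lin] by simp
    fix r m n assume c: "r \<in> Ht" "m \<in> HC" "n \<in> HC"
    have "\<Delta> h \<bullet> (es r \<star> 1\<^sub>H) \<bullet> (m \<star> n) = \<Delta> h \<bullet> (1\<^sub>H \<star> r) \<bullet> (m \<star> n)"
      using c assms by (simp add: \<Delta>_transfer)
    then show "\<Delta> h \<bullet> (es r \<cdot> m \<star> n) = \<Delta> h \<bullet> (m \<star> r \<cdot> n)"
      using c assms by (simp add: HH.tmult_assoc HH.tensor_mult_tens)
  qed
  have "\<Delta> h \<bullet> u = diamond_lift K HH.T ?\<phi> (MM.dproj u)" if "u \<in> carrier HH.T" for u
    unfolding diamond_lift_proj[OF HH.tensor_module bal that]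
    by (rule HH.tensor_lift_unique[OF HH.tensor_module balancedD(1)[OF bal, unfolded bilinear_maps_Hm] lin that]) simp
  then show ?thesis using assms by simp
qed

section \<open>The Takeuchi product and the multiplicativity of \<open>Gam\<close>\<close>

abbreviation "Tk \<equiv> takeuchi K Rt H iota"

text \<open>On classes of tensors the Takeuchi condition compares right multiplication by
  \<open>es s \<star> 1\<^sub>H\<close> with right multiplication by
  \<open>1\<^sub>H \<star> s\<close>, which are the two sides of the transfer rule.\<close>

lemma takeuchi_sides:
  assumes s: "s \<in> Ht"
  shows "diamond_lift K MM.D (\<lambda>m n. m \<cdot> bar K Rt iota s \<diamondop> n) \<in> linear_maps K MM.D MM.D"
    and "diamond_lift K MM.D (\<lambda>m n. m \<diamondop> n \<cdot> src K Rt iota s) \<in> linear_maps K MM.D MM.D"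
    and "t \<in> carrier HH.T \<Longrightarrow> diamond_lift K MM.D (\<lambda>m n. m \<cdot> bar K Rt iota s \<diamondop> n) (MM.dproj t) = MM.dproj (t \<bullet> (es s \<star> 1\<^sub>H))"
    and "t \<in> carrier HH.T \<Longrightarrow> diamond_lift K MM.D (\<lambda>m n. m \<diamondop> n \<cdot> src K Rt iota s) (MM.dproj t) = MM.dproj (t \<bullet> (1\<^sub>H \<star> s))"
proof -
  have b1: "(\<lambda>m n. m \<cdot> bar K Rt iota s \<diamondop> n) \<in> balanced_maps K Rt Hm Hm MM.D"
    using bilinear_comp[OF dtens_bilinear hmult_right_linear[of "es s"] linear_id linear_id] s
    by (intro balanced_HmI) (simp_all add: alg.m_assoc dtens_bal)
  have b2: "(\<lambda>m n. m \<diamondop> n \<cdot> src K Rt iota s) \<in> balanced_maps K Rt Hm Hm MM.D"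
    using bilinear_comp[OF dtens_bilinear linear_id hmult_right_linear[of s] linear_id] s
    by (intro balanced_HmI) (simp_all add: alg.m_assoc dtens_bal)
  show "diamond_lift K MM.D (\<lambda>m n. m \<cdot> bar K Rt iota s \<diamondop> n) \<in> linear_maps K MM.D MM.D"
    "diamond_lift K MM.D (\<lambda>m n. m \<diamondop> n \<cdot> src K Rt iota s) \<in> linear_maps K MM.D MM.D"
    by (rule MM.diamond_lift_linear[OF MM.diamond_module b1]) (rule MM.diamond_lift_linear[OF MM.diamond_module b2])
  assume t: "t \<in> carrier HH.T"
  show "diamond_lift K MM.D (\<lambda>m n. m \<cdot> bar K Rt iota s \<diamondop> n) (MM.dproj t) = MM.dproj (t \<bullet> (es s \<star> 1\<^sub>H))"
    unfolding diamond_lift_proj[OF MM.diamond_module b1 t]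
    by (rule HH.tensor_lift_unique[OF MM.diamond_module balancedD(1)[OF b1, unfolded bilinear_maps_Hm]
          linear_maps_comp[OF tmult_right_linear dproj_linear] t, symmetric])
      (use s in \<open>simp_all add: HH.tensor_mult_tens dproj_tens\<close>)
  show "diamond_lift K MM.D (\<lambda>m n. m \<diamondop> n \<cdot> src K Rt iota s) (MM.dproj t) = MM.dproj (t \<bullet> (1\<^sub>H \<star> s))"
    unfolding diamond_lift_proj[OF MM.diamond_module b2 t]
    by (rule HH.tensor_lift_unique[OF MM.diamond_module balancedD(1)[OF b2, unfolded bilinear_maps_Hm]
          linear_maps_comp[OF tmult_right_linear dproj_linear] t, symmetric])
      (use s in \<open>simp_all add: HH.tensor_mult_tens dproj_tens\<close>)
qed

lemma takeuchi_carrier_iff: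
  "X \<in> takeuchi_carrier K Rt H iota \<longleftrightarrow> X \<in> carrier MM.D \<and>
    (\<forall>s\<in>Ht. diamond_lift K MM.D (\<lambda>m n. m \<cdot> bar K Rt iota s \<diamondop> n) X =
      diamond_lift K MM.D (\<lambda>m n. m \<diamondop> n \<cdot> src K Rt iota s) X)"
  by (simp add: takeuchi_carrier_def Let_def)

text \<open>For each \<open>s\<close> the condition equates two linear maps on the diamond square,
  hence cuts out a submodule.\<close>

lemma takeuchi_module: "module K Tk"
proof -
  note lin = takeuchi_sides(1,2)
  have "submodule (takeuchi_carrier K Rt H iota) K MM.D"
  proof (rule MM.D.submoduleI)
    fix x assume "x \<in> takeuchi_carrier K Rt H iota"
    then show "\<ominus>\<^bsub>MM.D\<^esub> x \<in> takeuchi_carrier K Rt H iota"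
      using linear_minus[OF lin(1) MM.diamond_module MM.diamond_module, of _ "\<zero>\<^bsub>MM.D\<^esub>" x]
        linear_minus[OF lin(2) MM.diamond_module MM.diamond_module, of _ "\<zero>\<^bsub>MM.D\<^esub>" x]
        linear_zero[OF lin(1) MM.diamond_module MM.diamond_module]
        linear_zero[OF lin(2) MM.diamond_module MM.diamond_module]
      by (simp add: takeuchi_carrier_iff a_minus_def)
  qed (simp_all add: subset_iff takeuchi_carrier_iff linear_add[OF lin(1)] linear_add[OF lin(2)] linear_smult[OF lin(1)]
      linear_smult[OF lin(2)] linear_zero[OF lin(1) MM.diamond_module MM.diamond_module]
      linear_zero[OF lin(2) MM.diamond_module MM.diamond_module] del: bar_iota src_iota)
  from submodule.submodule_is_module[OF this MM.diamond_module] show ?thesis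
    by (rule module_cong) simp_all
qed

lemma Gam_takeuchi: "h \<in> HC \<Longrightarrow> Gam h \<in> takeuchi_carrier K Rt H iota"
  by (simp add: takeuchi_carrier_iff takeuchi_sides(3,4) \<Delta>_transfer del: bar_iota src_iota)

text \<open>The product in \<open>takeuchi\<close> ranges over all members of two cosets; membership
  is translated here into equality of classes.\<close>

lemma mem_dproj:
  assumes "t \<in> carrier HH.T"
  shows "t \<in> MM.dproj t" and "u \<in> MM.dproj t \<Longrightarrow> u \<in> carrier HH.T \<and> MM.dproj u = MM.dproj t"
proof -
  interpret W: abelian_subgroup MM.dnull HH.T
    using submodule_abelian_subgroup[OF HH.tensor_module] MM.dnull_submodule by simp
  show "t \<in> MM.dproj t" unfolding diamond_proj_def using assms W.a_rcos_self by simp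
  assume "u \<in> MM.dproj t"
  then show "u \<in> carrier HH.T \<and> MM.dproj u = MM.dproj t"
    unfolding diamond_proj_def using assms W.a_repr_independence' W.a_elemrcos_carrier by (metis tensor_Hm(2))
qed

lemma Gam_mult:
  assumes "g \<in> HC" "h \<in> HC"
  shows "Gam g \<otimes>\<^bsub>Tk\<^esub> Gam h = Gam (g \<cdot> h)"
proof -
  have "MM.dproj (t \<bullet> u) = Gam (g \<cdot> h)" if t: "t \<in> Gam g" and u: "u \<in> Gam h" for t u
  proof -
    have c: "t \<in> carrier HH.T" "MM.dproj t = MM.dproj (\<Delta> g)" "u \<in> carrier HH.T" "MM.dproj u = MM.dproj (\<Delta> h)"
      using mem_dproj(2)[of "\<Delta> g" t] mem_dproj(2)[of "\<Delta> h" u] t u assms by auto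
    \<comment> \<open>The left representative is exchanged first: with \<open>\<Delta> g\<close> on
      the left, \<open>\<Delta>_mult_dproj\<close> allows the right one to be exchanged too.\<close>
    have "MM.dproj (t \<bullet> u) = MM.dproj (\<Delta> g \<bullet> u)"
      by (rule dproj_mult_left) (use c assms in simp_all)
    also have "\<Delta> g \<bullet> u = \<Delta> g \<bullet> \<Delta> h"
      by (rule \<Delta>_mult_dproj) (use c assms in simp_all)
    finally show ?thesis using assms by (simp add: comult_mult)
  qed
  moreover have "\<Delta> g \<in> Gam g" "\<Delta> h \<in> Gam h"
    using assms mem_dproj(1) by simp_all
  ultimately have "{MM.dproj (t \<bullet> u) |t u. t \<in> Gam g \<and> u \<in> Gam h} = {Gam (g \<cdot> h)}"
    by blast
  then show ?thesis
    by (simp add: takeuchi_def Let_def)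
qed

lemma Gam_alg_hom: "Gam \<in> alg_hom K H Tk"
proof -
  have "Gam 1\<^sub>H = 1\<^sub>H \<diamondop> 1\<^sub>H"
    using dproj_\<Delta>1_mult[of "1\<^sub>H" "1\<^sub>H"] HH.T.alg.r_one[of \<Delta>1] by simp
  then have one: "Gam 1\<^sub>H = \<one>\<^bsub>Tk\<^esub>"
    by (simp add: takeuchi_def Let_def)
  have "Gam \<in> linear_maps K H Tk"
    using Gam_linear Gam_takeuchi by (simp add: linear_maps_def)
  then show ?thesis
    using Gam_takeuchi one Gam_mult linear_add[OF Gam_linear]
    by (auto simp: alg_hom_def ring_hom_def simp del: comp_apply)
qed

text \<open>The coproduct of \<open>x \<cdot> es y\<close> carries a factor \<open>\<Delta>1\<close>
  on the left, which \<open>dproj_\<Delta>1_mult\<close> removes; uniqueness of lifts extends the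
  formula from pure tensors.\<close>

lemma Gam_unit:
  assumes "z \<in> carrier RR.T"
  shows "Gam (iota z) = takeuchi_unit K Rt H iota z"
proof -
  have lin: "Gam \<in> linear_maps K H Tk" using Gam_alg_hom by (simp add: alg_hom_def)
  have val: "Gam (x \<cdot> es y) = x \<diamondop> es y" if "x \<in> Ht" "y \<in> Ht" for x y
    using that by (simp add: Ht_es_comult dproj_\<Delta>1_mult)
  show ?thesis
    unfolding takeuchi_unit_def Let_def
    by (rule RR.tensor_lift_unique[OF takeuchi_module RR.bilinear_cong[OF bilinear_comp_out[OF iota_bilinear lin]]
        linear_maps_comp[OF iota_linear lin] assms])
      (simp_all add: val iota_tens del: comp_apply)
qed

section \<open>The counit as an action on the base algebra\<close>

lemma Cou_carrier:
  assumes "h \<in> HC"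
  shows "Cou h \<in> carrier (end_algebra K Rt)"
proof -
  have "(\<lambda>x. et (h \<cdot> x)) \<in> linear_maps K H H"
    by (rule linear_maps_comp[OF hmult_left_linear[OF assms] et_linear])
  then show ?thesis
    using assms submoduleE(4,5)[OF Ht_submodule] by (auto simp: linear_maps_def)
qed

lemma Cou_linear: "Cou \<in> linear_maps K H (end_algebra K Rt)"
  by (rule linear_mapsI[OF Cou_carrier])
    (auto intro!: restrict_ext simp: alg.l_distr smult_mult_left linear_add[OF et_linear] linear_smult[OF et_linear])

text \<open>Composing two such maps inserts an inner \<open>et\<close>, which \<open>et_mult\<close>
  erases; the unit acts as the identity because \<open>et\<close> fixes \<open>Ht\<close>.\<close>

lemma Cou_alg_hom: "Cou \<in> alg_hom K H (end_algebra K Rt)"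
proof -
  have "Cou (g \<cdot> h) = compose Ht (Cou g) (Cou h)" if "g \<in> HC" "h \<in> HC" for g h
    using that by (auto simp: compose_def et_mult alg.m_assoc intro!: restrict_ext)
  moreover have "Cou 1\<^sub>H = (\<lambda>x\<in>Ht. x)"
    by (auto simp: et_Ht intro!: restrict_ext)
  ultimately show ?thesis
    using Cou_linear Cou_carrier linear_add[OF Cou_linear]
    by (auto simp: alg_hom_def ring_hom_def simp del: end_sel(1))
qed

lemma Cou_unit:
  assumes "z \<in> carrier RR.T"
  shows "Cou (iota z) = end_unit K Rt z"
proof -
  have val: "Cou (x \<cdot> es y) = (\<lambda>t\<in>carrier Rt. x \<otimes>\<^bsub>Rt\<^esub> t \<otimes>\<^bsub>Rt\<^esub> y)" if c: "x \<in> Ht" "y \<in> Ht" for x y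
  proof (simp, rule restrict_ext)
    fix t assume t: "t \<in> Ht"
    \<comment> \<open>At the right end of the argument of \<open>et\<close>, \<open>es y\<close>
      cannot be told from \<open>y\<close>; what results is a product in \<open>Ht\<close>, fixed by
      \<open>et\<close>.\<close>
    have "x \<cdot> es y \<cdot> t = x \<cdot> t \<cdot> es y"
      using c t by (simp add: alg.m_assoc Ht_es_commute)
    then show "et (x \<cdot> es y \<cdot> t) = x \<cdot> t \<cdot> y"
      using c t by (simp add: et_mult_es et_Ht)
  qed
  show ?thesis
    unfolding end_unit_def
    by (rule RR.tensor_lift_unique[OF end_algebra_module[OF k_algebra.axioms(1)[OF Rt_k_algebra]]
          RR.bilinear_cong[OF bilinear_comp_out[OF iota_bilinear Cou_linear]] linear_maps_comp[OF iota_linear Cou_linear] assms])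
      (use val in \<open>simp_all add: iota_tens\<close>)
qed

section \<open>Coassociativity over the base algebra\<close>

lemma Gam_mult_Ht:
  assumes "r \<in> Ht" "h \<in> HC"
  shows "Gam (r \<cdot> h) = act MM.D r (Gam h)"
proof -
  have r: "r \<in> carrier Rt" using assms by simp
  have "MM.dproj ((r \<star> 1\<^sub>H) \<bullet> \<Delta> h) = act MM.D r (MM.dproj (\<Delta> h))"
    by (rule HH.linear_tensor_eqI[OF linear_maps_comp[OF tmult_left_linear dproj_linear]
          linear_maps_comp[OF dproj_linear MM.diamond_act_linear[OF r]]])
      (use assms MM.diamond_act_dtens[OF r] in \<open>simp_all add: HH.tensor_mult_tens dproj_tens\<close>)
  then show ?thesis using assms by (simp add: Ht_mult_comult)
qed

text \<open>Compatibility with the bar action makes \<open>Gam\<close> on the left factor respect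
  the relations of the diamond square; \<open>Gam_mult_Ht\<close> does this for \<open>Gam\<close>
  on the right factor.\<close>

lemma Gam_mult_es:
  assumes "r \<in> Ht" "h \<in> HC"
  shows "Gam (es r \<cdot> h) = bact MM.D r (Gam h)"
proof -
  have r: "r \<in> carrier Rt" using assms by simp
  have "MM.dproj ((1\<^sub>H \<star> es r) \<bullet> \<Delta> h) = bact MM.D r (MM.dproj (\<Delta> h))"
    by (rule HH.linear_tensor_eqI[OF linear_maps_comp[OF tmult_left_linear dproj_linear]
          linear_maps_comp[OF dproj_linear MM.diamond_bact_linear[OF r]]])
      (use assms MM.diamond_bact_dtens[OF r] in \<open>simp_all add: HH.tensor_mult_tens dproj_tens\<close>)
  then show ?thesis using assms by (simp add: es_mult_comult)
qed

lemma Gam_coassoc: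
  assumes "h \<in> HC"
  shows "diamond_assoc K Rt Hm Hm Hm (diamond_map K Rt MM.D Hm Gam id (Gam h))
    = diamond_map K Rt Hm MM.D id Gam (Gam h)"
proof -
  interpret X: two_env K Rt MM.D Hm by (intro two_env.intro MM.diamond_env_mod Hm_env_mod)
  interpret Y: two_env K Rt Hm MM.D by (intro two_env.intro MM.diamond_env_mod Hm_env_mod)
  have bX: "(\<lambda>m n. dtens K Rt MM.D Hm (Gam m) (id n)) \<in> balanced_maps K Rt Hm Hm X.D"
  proof (rule balanced_HmI)
    show "(\<lambda>m n. dtens K Rt MM.D Hm (Gam m) (id n)) \<in> bilinear_maps K H H X.D"
      using bilinear_comp[OF X.dtens_bilinear Gam_linear _ linear_id, of id H] linear_id[of K H] by simp
    fix r m n assume c: "r \<in> Ht" "m \<in> HC" "n \<in> HC"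
    then show "dtens K Rt MM.D Hm (Gam (es r \<cdot> m)) (id n) = dtens K Rt MM.D Hm (Gam m) (id (r \<cdot> n))"
      using X.dtens_bal[of r "Gam m" n] Gam_mult_es[OF c(1,2)] linear_closed[OF Gam_linear c(2)] by simp
  qed
  have bY: "(\<lambda>m n. dtens K Rt Hm MM.D (id m) (Gam n)) \<in> balanced_maps K Rt Hm Hm Y.D"
  proof (rule balanced_HmI)
    show "(\<lambda>m n. dtens K Rt Hm MM.D (id m) (Gam n)) \<in> bilinear_maps K H H Y.D"
      using bilinear_comp[OF Y.dtens_bilinear _ Gam_linear linear_id, of id H] linear_id[of K H] by simp
    fix r m n assume c: "r \<in> Ht" "m \<in> HC" "n \<in> HC"
    then show "dtens K Rt Hm MM.D (id (es r \<cdot> m)) (Gam n) = dtens K Rt Hm MM.D (id m) (Gam (r \<cdot> n))"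
      using Y.dtens_bal[of r m "Gam n"] Gam_mult_Ht[OF c(1,3)] linear_closed[OF Gam_linear c(3)] by simp
  qed
  \<comment> \<open>\<open>q\<close> is the canonical map from H \<otimes> (H \<otimes> H) to the
    iterated diamond product. Both sides of the claim turn out to be \<open>q\<close> of a side of
    ordinary coassociativity.\<close>
  define q where "q = tensor_lift K Y.D (\<lambda>m t. dtens K Rt Hm MM.D m (MM.dproj t))"
  have bq: "(\<lambda>m t. dtens K Rt Hm MM.D m (MM.dproj t)) \<in> bilinear_maps K H HH.T Y.D"
    using bilinear_comp[OF Y.dtens_bilinear _ dproj_linear linear_id, of id H] linear_id[of K H] by simp
  have q: "q \<in> linear_maps K H3.T Y.D"
    and q_tens: "\<And>m t. m \<in> HC \<Longrightarrow> t \<in> carrier HH.T \<Longrightarrow> q (m \<star>\<^sub>3 t) = dtens K Rt Hm MM.D m (MM.dproj t)"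
    unfolding q_def using H3.tensor_lift_linear[OF Y.diamond_module bq] H3.tensor_lift_tens[OF Y.diamond_module bq] by auto
  note dassoc = diamond_assoc_linear[OF Hm_env_mod Hm_env_mod Hm_env_mod]
    and dassoc_dtens = diamond_assoc_dtens[OF Hm_env_mod Hm_env_mod Hm_env_mod]
  \<comment> \<open>The rebracketings of tensor and diamond products are compatible with the
    projections.\<close>
  have assoc_q: "diamond_assoc K Rt Hm Hm Hm (dtens K Rt MM.D Hm (MM.dproj u) n) = q (assoc (u \<star>\<^sub>4 n))"
    if "u \<in> carrier HH.T" "n \<in> HC" for u n
    by (rule HH.linear_tensor_eqI[OF linear_maps_comp[OF linear_maps_comp[OF dproj_linear bilinear_left[OF X.dtens_bilinear]] dassoc]
          linear_maps_comp[OF linear_maps_comp[OF bilinear_left[OF H4.tens_bilinear that(2)] assoc_linear] q] that(1)])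
      (use that in \<open>simp_all add: assoc_tens q_tens dproj_tens dassoc_dtens\<close>)
  have "diamond_assoc K Rt Hm Hm Hm (diamond_map K Rt MM.D Hm Gam id (MM.dproj (\<Delta> h))) = q (assoc (\<Delta>_id (\<Delta> h)))"
    unfolding diamond_map_def
    by (rule HH.linear_tensor_eqI[OF linear_maps_comp[OF linear_maps_comp[OF dproj_linear
            MM.diamond_lift_linear[OF X.diamond_module bX]] dassoc]
          linear_maps_comp[OF linear_maps_comp[OF \<Delta>_id_linear assoc_linear] q]])
      (use assms in \<open>simp_all add: dproj_tens MM.diamond_lift_dtens[OF X.diamond_module bX, simplified] assoc_q \<Delta>_id_tens\<close>)
  also have "\<dots> = q (id_\<Delta> (\<Delta> h))"
    using coassoc[OF assms] by simp
  also have "\<dots> = diamond_map K Rt Hm MM.D id Gam (MM.dproj (\<Delta> h))"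
    unfolding diamond_map_def
    by (rule HH.linear_tensor_eqI[OF linear_maps_comp[OF id_\<Delta>_linear q]
          linear_maps_comp[OF dproj_linear MM.diamond_lift_linear[OF Y.diamond_module bY]]])
      (use assms in \<open>simp_all add: dproj_tens MM.diamond_lift_dtens[OF Y.diamond_module bY, simplified] id_\<Delta>_tens q_tens\<close>)
  finally show ?thesis by simp
qed

section \<open>The counit laws\<close>

lemma Gam_counit_bar:
  assumes "h \<in> HC"
  shows "diamond_lift K H (\<lambda>m n. bar K Rt iota (Cou n \<one>\<^bsub>Rt\<^esub>) \<cdot> m) (Gam h) = h"
proof -
  define \<phi> where "\<phi> = (\<lambda>m n. bar K Rt iota (Cou n \<one>\<^bsub>Rt\<^esub>) \<cdot> m)"
  have val: "\<phi> m n = es n \<cdot> m" if "n \<in> HC" for m n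
    using that by (simp add: \<phi>_def es_et)
  have bil: "(\<lambda>m n. es n \<cdot> m) \<in> bilinear_maps K H H H"
    using bilinear_comp[OF mult_bilinear es_linear linear_id linear_id] by (auto simp: bilinear_maps_def)
  \<comment> \<open>Balancing is the antimultiplicativity of \<open>es\<close>: both sides are
    \<open>es n \<cdot> es r \<cdot> m\<close>.\<close>
  have bal: "\<phi> \<in> balanced_maps K Rt Hm Hm H"
    by (intro balanced_HmI HH.bilinear_cong[OF bil]) (simp_all add: val es_antimult alg.m_assoc)
  \<comment> \<open>The slice by \<epsilon> of \<open>\<Delta>1 \<bullet> (a \<star> b)\<close> is
    \<open>es b \<cdot> a\<close>; the extra \<open>\<Delta>1\<close> is absorbed by
    \<open>\<Delta> h\<close>, which leaves the counit law of \<open>H\<close>.\<close>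
  have "diamond_lift K H \<phi> (MM.dproj (\<Delta> h)) = sliceR 1\<^sub>H (\<Delta>1 \<bullet> \<Delta> h)"
    by (rule HH.linear_tensor_eqI[OF linear_maps_comp[OF dproj_linear MM.diamond_lift_linear[OF module_axioms bal]]
          linear_maps_comp[OF tmult_left_linear sliceR_linear]])
      (use assms in \<open>simp_all add: dproj_tens MM.diamond_lift_dtens[OF module_axioms bal] sliceR_mult_right
        es_slice[symmetric] val\<close>)
  then show ?thesis
    using assms by (simp add: sliceR_one \<phi>_def[symmetric] del: bar_iota Rt_sel restrict_apply restrict_apply')
qed

lemma Gam_counit_src:
  assumes "h \<in> HC"
  shows "diamond_lift K H (\<lambda>m n. src K Rt iota (Cou m \<one>\<^bsub>Rt\<^esub>) \<cdot> n) (Gam h) = h"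
proof -
  define \<phi> where "\<phi> = (\<lambda>m n. src K Rt iota (Cou m \<one>\<^bsub>Rt\<^esub>) \<cdot> n)"
  have val: "\<phi> m n = et m \<cdot> n" if "m \<in> HC" for m n
    using that by (simp add: \<phi>_def)
  \<comment> \<open>This is the balancing condition: \<open>es r\<close> passes \<open>et m\<close>,
    counts as \<open>r\<close> at the right end under \<open>et\<close>, and the product then lies
    in \<open>Ht\<close>.\<close>
  have et_es: "et (es r \<cdot> m) = et m \<cdot> r" if "r \<in> Ht" "m \<in> HC" for r m
  proof -
    have "et (es r \<cdot> m) = et (es r \<cdot> et m)"
      using that by (simp add: et_mult)
    also have "\<dots> = et m \<cdot> r"
      using that by (simp add: Ht_es_commute[symmetric] et_mult_es et_Ht)
    finally show ?thesis .
  qed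
  have bil: "(\<lambda>m n. et m \<cdot> n) \<in> bilinear_maps K H H H"
    using bilinear_comp[OF mult_bilinear et_linear linear_id linear_id] by simp
  have bal: "\<phi> \<in> balanced_maps K Rt Hm Hm H"
    by (intro balanced_HmI HH.bilinear_cong[OF bil]) (simp_all add: val et_es alg.m_assoc)
  have "diamond_lift K H \<phi> (MM.dproj (\<Delta> h)) = sliceL 1\<^sub>H (\<Delta>1 \<bullet> \<Delta> h)"
    by (rule HH.linear_tensor_eqI[OF linear_maps_comp[OF dproj_linear MM.diamond_lift_linear[OF module_axioms bal]]
          linear_maps_comp[OF tmult_left_linear sliceL_linear]])
      (use assms in \<open>simp_all add: dproj_tens MM.diamond_lift_dtens[OF module_axioms bal] sliceL_mult_right
        et_slice[symmetric] val\<close>)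
  then show ?thesis
    using assms by (simp add: sliceL_one \<phi>_def[symmetric] del: src_iota Rt_sel restrict_apply restrict_apply')
qed

lemma iota_alg_hom: "iota \<in> alg_hom K (enveloping K Rt) H"
  using iota_linear iota_mult linear_closed[OF iota_linear] linear_add[OF iota_linear]
  by (auto simp: alg_hom_def ring_hom_def enveloping_def iota_tens es_one)

lemma times_bialgebra: "times_bialgebra K Rt H iota Gam Cou"
proof (intro times_bialgebra.intro times_bialgebra_axioms.intro enveloping_ring.intro
    enveloping_ring_axioms.intro Rt_k_algebra k_algebra_axioms iota_alg_hom Gam_alg_hom Cou_alg_hom)
  fix z assume "z \<in> carrier (enveloping K Rt)"
  then show "Gam (iota z) = takeuchi_unit K Rt H iota z" "Cou (iota z) = end_unit K Rt z"
    using Gam_unit[of z] Cou_unit[of z] by (simp_all only: enveloping_def)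
qed (use Gam_coassoc Gam_counit_bar Gam_counit_src in \<open>simp_all only:\<close>)

end

theorem theorem5p1:
  fixes K :: "'k ring" and H :: "('k, 'h) module"
    and \<Delta> :: "'h \<Rightarrow> ('h \<times> 'h \<Rightarrow> 'k) set" and \<epsilon> :: "'h \<Rightarrow> 'k"
  assumes "weak_bialgebra K H \<Delta> \<epsilon>"
  defines "R \<equiv> target_subalgebra K H \<Delta> \<epsilon>"
  defines "\<iota> \<equiv> tensor_lift K H (\<lambda>x y. x \<otimes>\<^bsub>H\<^esub> counit_source' K H \<Delta> \<epsilon> y)"
  defines "\<Gamma> \<equiv> diamond_proj K R (left_regular K R H \<iota>) (left_regular K R H \<iota>) \<circ> \<Delta>"
  defines "C \<equiv> \<lambda>h. \<lambda>x\<in>carrier R. counit_target K H \<Delta> \<epsilon> (h \<otimes>\<^bsub>H\<^esub> x)"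
  shows "(\<forall>x\<in>carrier R. \<forall>y\<in>carrier R.
            \<iota> (tens K R (opposite R) x y) = x \<otimes>\<^bsub>H\<^esub> counit_source' K H \<Delta> \<epsilon> y)
         \<and> times_bialgebra K R H \<iota> \<Gamma> C"
proof -
  interpret weak_bialg K H \<Delta> \<epsilon> by (rule weak_bialg.intro) fact
  show ?thesis
    using iota_tens times_bialgebra unfolding C_def \<Gamma>_def \<iota>_def R_def by simp
qed

end
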